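(* Let $\mathcal G$ be a $d$-rigid graph, $p^*\in\mathcal C$ a target configuration, $m^*=F(p^* )$, and let $(\nu,\eta)$ be a compatible formation controller defined on an open neighborhood of $(p^*,m^* )$ in $\mathcal S$. Write $\eta^*=\eta_{(p^*,m^* )}$ and $T=T_{m^*}\mathcal Q$ (so $\eta^*(T)\subseteq T$). If either (a) the transformation $-\eta^*|_T$ is Hurwitz (i.e. all eigenvalues of $\eta^*|_T$ have positive real part); or (b) the quadratic form $q_{\eta^*}(v)=\langle v,\eta^*(v)\rangle$ is positive definite on $T$, then the controller is locally exponentially stable at $p^*$. Moreover, (a) is necessary for local exponential stability: if the controller is locally exponentially stable at $p^*$, then $-\eta^*|_T$ is Hurwitz.
   Context: Fix $d\ge 1$ and a finite simple graph $\mathcal G=(\mathcal V,\mathcal E)$, $\mathcal V=\{1,\dots,n\}$. A configuration is $p=(p_1,\dots,p_n)\in(\mathbb R^d)^n=\mathbb R^{dn}$. The distance map is $F:\mathbb R^{dn}\to\mathbb R^{|\mathcal E|}$, $F(p)=(\|p_j-p_i\|^2)_{ij\in\mathcal E}$. The rigidity matrix $R(p)\in\mathbb R^{|\mathcal E|\times dn}$ has, in the row of edge $ij$, the block $(p_i-p_j)^\top$ at vertex $i$, $(p_j-p_i)^\top$ at vertex $j$, and zeros elsewhere; so $F(p)=R(p)p$ and $\mathrm dF_p=2R(p)$. Configurations are congruent if they differ by a Euclidean isometry of $\mathbb R^d$. Regular values: $m\in F(\mathbb R^{dn})$ is a regular value if near $m$ the image $F(\mathbb R^{dn})$ is a smooth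 embedded submanifold of $\mathbb R^{|\mathcal E|}$ and $\mathrm dF_p$ maps onto its tangent space at $m$ for every $p\in F^{-1}(m)$. $\mathcal Q$ is the set of regular values, $\mathcal C=F^{-1}(\mathcal Q)$ the set of regular configurations; for $m=F(p)\in\mathcal Q$, $T_m\mathcal Q=\operatorname{im}R(p)$. The graph $\mathcal G$ is $d$-rigid if for every $p\in\mathcal C$ there is a neighborhood of $p$ in which every $q$ with $F(q)=F(p)$ is congruent to $p$. $\mathcal S=\{(p,m)\in\mathcal C\times\mathcal Q: F(p)=m\}$. A compatible formation controller is a pair of linear operators $\nu_{(p,m)}:\mathbb R^{|\mathcal E|}\to\mathbb R^{dn}$, $\eta_{(p,m)}:\mathbb R^{|\mathcal E|}\to\mathbb R^{|\mathcal E|}$, depending smoothly on $(p,m)\in\mathcal S$ (or on an open subset of $\mathcal S$ containing the target state), with $(\nu_{(p,m)}x,\eta_{(p,m)}x)\in T_{(p,m)}\mathcal S$ for all $x$, equivalently $\eta_{(p,m)}=2R(p)\nu_{(p,m)}$. The closed-loop system with target $(p^*,m^* )$ is $\dot p=\nu_{(p,m)}(m^*-m)$, $\dot m=\eta_{(p,m)}(m^*-m)$. The controller is locally exponentially stable at $p^*\in\mathcal C$ if there is a neighborhood $U\ni p^*$ such that, for all initial conditions $(p^0,F(p^0))$ with $p^0\in U$, the node trajectory $p(t)$ of the closed-loop system converges exponentially to a configuration $q\in U$ congruent to $p^*$; exponential convergence means $\|p(t)-q\|\le Ke^{-ct}$ for all $t\ge0$, with constants $K,c>0$ not depending on $p^0\in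 U$. A linear map is Hurwitz if all its eigenvalues have negative real part. *)

theory Defs
  imports "HOL-Analysis.Analysis"
begin

section \<open>Smooth maps and embedded submanifolds of Euclidean space\<close>

fun C_k_on :: "nat \<Rightarrow> 'a::euclidean_space set \<Rightarrow> ('a \<Rightarrow> 'b::euclidean_space) \<Rightarrow> bool" where
  "C_k_on 0 W f \<longleftrightarrow> continuous_on W f"
| "C_k_on (Suc k) W f \<longleftrightarrow>
     (\<exists>f'. (\<forall>x\<in>W. (f has_derivative f' x) (at x)) \<and> (\<forall>v. C_k_on k W (\<lambda>x. f' x v)))"

text \<open>\<open>C_k_on\<close> is meant for open \<open>W\<close>. On an arbitrary set (in particular on an embedded
  submanifold) a map is smooth if it extends locally to a smooth map on an open set.\<close>

definition smooth_on :: "'a::euclidean_space set \<Rightarrow> ('a \<Rightarrow> 'b::euclidean_space) \<Rightarrow> bool" where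
  "smooth_on A f \<longleftrightarrow>
     (\<forall>a\<in>A. \<exists>W g. open W \<and> a \<in> W \<and> (\<forall>k. C_k_on k W g) \<and> (\<forall>x\<in>A \<inter> W. g x = f x))"

definition diffeo_on :: "'a::euclidean_space set \<Rightarrow> ('a \<Rightarrow> 'a) \<Rightarrow> bool" where
  "diffeo_on W \<phi> \<longleftrightarrow> open W \<and> open (\<phi> ` W) \<and> smooth_on W \<phi> \<and>
     (\<exists>\<psi>. smooth_on (\<phi> ` W) \<psi> \<and> (\<forall>x\<in>W. \<psi> (\<phi> x) = x))"

text \<open>Slice charts: near each of its points, \<open>M\<close> is carried to a linear subspace by a
  diffeomorphism between open sets of the ambient space.\<close>

definition embedded_submanifold :: "'a::euclidean_space set \<Rightarrow> bool" where
  "embedded_submanifold M \<longleftrightarrow>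
     (\<forall>x\<in>M. \<exists>W \<phi> L. x \<in> W \<and> diffeo_on W \<phi> \<and> subspace L \<and> \<phi> ` (W \<inter> M) = \<phi> ` W \<inter> L)"

text \<open>Tangent vectors are the velocities of smooth curves in \<open>M\<close>.\<close>

definition tangent_space :: "'a::euclidean_space set \<Rightarrow> 'a \<Rightarrow> 'a set" where
  "tangent_space M x = {v. \<exists>\<gamma> (\<epsilon>::real). 0 < \<epsilon> \<and> smooth_on {-\<epsilon><..<\<epsilon>} \<gamma> \<and>
     \<gamma> ` {-\<epsilon><..<\<epsilon>} \<subseteq> M \<and> \<gamma> 0 = x \<and> (\<gamma> has_vector_derivative v) (at 0)}"


section \<open>Frameworks\<close>

text \<open>The vertex set \<open>{1, \<dots>, n}\<close> is the finite linearly ordered type \<open>'n\<close>. A simple graph is given by the set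
  \<open>E\<close> of its edges, each listed once, as the pair \<open>(i, j)\<close> with \<open>i < j\<close>. A type of edges could not
  be empty, so the space of edge vectors is the coordinate subspace \<open>edge_space E\<close> of the vectors
  indexed by all pairs of vertices.\<close>

type_synonym ('d, 'n) config = "((real, 'd) vec, 'n) vec"
type_synonym 'n edge_vec = "(real, 'n \<times> 'n) vec"

definition simple_graph :: "('n::{finite,linorder} \<times> 'n) set \<Rightarrow> bool" where
  "simple_graph E \<longleftrightarrow> (\<forall>(i, j)\<in>E. i < j)"

definition edge_space :: "('n::{finite,linorder} \<times> 'n) set \<Rightarrow> 'n edge_vec set" where
  "edge_space E = {x. \<forall>e. e \<notin> E \<longrightarrow> x $ e = 0}"

definition dist_map ::
  "('n::{finite,linorder} \<times> 'n) set \<Rightarrow> ('d::finite, 'n) config \<Rightarrow> 'n edge_vec" where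
  "dist_map E p = (\<chi> e. if e \<in> E then (norm (p $ snd e - p $ fst e))\<^sup>2 else 0)"

definition rigidity_matrix ::
  "('n::{finite,linorder} \<times> 'n) set \<Rightarrow> ('d::finite, 'n) config \<Rightarrow> ('d, 'n) config \<Rightarrow> 'n edge_vec"
  where
  "rigidity_matrix E p w = (\<chi> e. if e \<in> E
     then (p $ fst e - p $ snd e) \<bullet> (w $ fst e) + (p $ snd e - p $ fst e) \<bullet> (w $ snd e) else 0)"

lemma dist_map_has_derivative:
  "(dist_map E has_derivative (\<lambda>w. 2 *\<^sub>R rigidity_matrix E p w)) (at p)"
proof -
  have comp: "((\<lambda>p. dist_map E p $ e) has_derivative
      (\<lambda>w. (2 *\<^sub>R rigidity_matrix E p w) $ e)) (at p)" for e
  proof (cases "e \<in> E")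
    case True
    have "((\<lambda>p. (p $ snd e - p $ fst e) \<bullet> (p $ snd e - p $ fst e)) has_derivative
        (\<lambda>w. (p $ snd e - p $ fst e) \<bullet> (w $ snd e - w $ fst e)
           + (w $ snd e - w $ fst e) \<bullet> (p $ snd e - p $ fst e))) (at p)"
      by (auto intro!: derivative_eq_intros bounded_linear.has_derivative[OF bounded_linear_vec_nth])
    with True show ?thesis
      by (simp add: dist_map_def rigidity_matrix_def power2_norm_eq_inner algebra_simps
          inner_commute)
  qed (simp add: dist_map_def rigidity_matrix_def)
  show ?thesis
    by (subst has_derivative_componentwise_within)
      (auto simp: Basis_vec_def inner_axis intro!: comp[simplified])
qed

definition congruent_configs :: "('d::finite, 'n::finite) config \<Rightarrow> ('d, 'n) config \<Rightarrow> bool" where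
  "congruent_configs p q \<longleftrightarrow>
     (\<exists>g. (\<forall>x y. dist (g x) (g y) = dist x y) \<and> (\<forall>i. q $ i = g (p $ i)))"

text \<open>Every notion below depends on the dimension \<open>'d\<close>. Where the arguments do not determine it,
  it is passed as \<open>TYPE('d)\<close>.\<close>

definition regular_values ::
  "'d::finite itself \<Rightarrow> ('n::{finite,linorder} \<times> 'n) set \<Rightarrow> 'n edge_vec set" where
  "regular_values _ E =
     (let F = dist_map E :: ('d, 'n) config \<Rightarrow> 'n edge_vec in
      {m \<in> range F.
         (\<exists>W. open W \<and> m \<in> W \<and> embedded_submanifold (range F \<inter> W)) \<and>
         (\<forall>p. F p = m \<longrightarrow> range (frechet_derivative F (at p)) = tangent_space (range F) m)})"

definition regular_configs ::
  "('n::{finite,linorder} \<times> 'n) set \<Rightarrow> ('d::finite, 'n) config set" where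
  "regular_configs E = dist_map E -` regular_values TYPE('d) E"

definition rigid :: "'d::finite itself \<Rightarrow> ('n::{finite,linorder} \<times> 'n) set \<Rightarrow> bool" where
  "rigid _ E \<longleftrightarrow> (\<forall>p \<in> regular_configs E :: ('d, 'n) config set.
     \<exists>N. open N \<and> p \<in> N \<and> (\<forall>q\<in>N. dist_map E q = dist_map E p \<longrightarrow> congruent_configs p q))"


section \<open>Formation controllers\<close>

definition state_space ::
  "('n::{finite,linorder} \<times> 'n) set \<Rightarrow> (('d::finite, 'n) config \<times> 'n edge_vec) set" where
  "state_space E = {(p, m). p \<in> regular_configs E \<and> m \<in> regular_values TYPE('d) E \<and>
     dist_map E p = m}"

text \<open>An operator on \<open>edge_space E\<close> is a function whose values off that subspace are irrelevant.\<close>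

definition linear_on_subspace ::
  "'a::real_vector set \<Rightarrow> ('a \<Rightarrow> 'b::real_vector) \<Rightarrow> bool" where
  "linear_on_subspace V f \<longleftrightarrow> (\<forall>x\<in>V. \<forall>y\<in>V. f (x + y) = f x + f y) \<and>
     (\<forall>c. \<forall>x\<in>V. f (c *\<^sub>R x) = c *\<^sub>R f x)"

definition compatible_controller ::
  "('n::{finite,linorder} \<times> 'n) set \<Rightarrow> (('d::finite, 'n) config \<times> 'n edge_vec) set \<Rightarrow>
   (('d, 'n) config \<times> 'n edge_vec \<Rightarrow> 'n edge_vec \<Rightarrow> ('d, 'n) config) \<Rightarrow>
   (('d, 'n) config \<times> 'n edge_vec \<Rightarrow> 'n edge_vec \<Rightarrow> 'n edge_vec) \<Rightarrow> bool" where
  "compatible_controller E A \<nu> \<eta> \<longleftrightarrow>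
     (\<forall>s\<in>A. linear_on_subspace (edge_space E) (\<nu> s) \<and> linear_on_subspace (edge_space E) (\<eta> s)) \<and>
     (\<forall>x\<in>edge_space E. smooth_on A (\<lambda>s. \<nu> s x) \<and> smooth_on A (\<lambda>s. \<eta> s x)) \<and>
     (\<forall>s\<in>A. \<forall>x\<in>edge_space E. (\<nu> s x, \<eta> s x) \<in> tangent_space (state_space E) s)"

definition closed_loop_trajectory ::
  "(('d::finite, 'n::{finite,linorder}) config \<times> 'n edge_vec) set \<Rightarrow>
   (('d, 'n) config \<times> 'n edge_vec \<Rightarrow> 'n edge_vec \<Rightarrow> ('d, 'n) config) \<Rightarrow>
   (('d, 'n) config \<times> 'n edge_vec \<Rightarrow> 'n edge_vec \<Rightarrow> 'n edge_vec) \<Rightarrow> 'n edge_vec \<Rightarrow>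
   (real \<Rightarrow> ('d, 'n) config) \<Rightarrow> (real \<Rightarrow> 'n edge_vec) \<Rightarrow> bool" where
  "closed_loop_trajectory A \<nu> \<eta> m' p m \<longleftrightarrow> (\<forall>t\<ge>0. (p t, m t) \<in> A \<and>
     (p has_vector_derivative \<nu> (p t, m t) (m' - m t)) (at t within {0..}) \<and>
     (m has_vector_derivative \<eta> (p t, m t) (m' - m t)) (at t within {0..}))"

text \<open>Solutions of the closed-loop system are unique where they exist, since the controller is
  smooth; hence the trajectory converges exponentially iff one exists for all \<open>t \<ge> 0\<close> and all of them converge.\<close>

definition locally_exp_stable ::
  "('n::{finite,linorder} \<times> 'n) set \<Rightarrow> (('d::finite, 'n) config \<times> 'n edge_vec) set \<Rightarrow>
   (('d, 'n) config \<times> 'n edge_vec \<Rightarrow> 'n edge_vec \<Rightarrow> ('d, 'n) config) \<Rightarrow>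
   (('d, 'n) config \<times> 'n edge_vec \<Rightarrow> 'n edge_vec \<Rightarrow> 'n edge_vec) \<Rightarrow> ('d, 'n) config \<Rightarrow> bool" where
  "locally_exp_stable E A \<nu> \<eta> p' \<longleftrightarrow>
     (\<exists>U K c. open U \<and> p' \<in> U \<and> 0 < K \<and> 0 < c \<and> (\<forall>p0\<in>U.
        (\<exists>p m. closed_loop_trajectory A \<nu> \<eta> (dist_map E p') p m \<and>
           p 0 = p0 \<and> m 0 = dist_map E p0) \<and>
        (\<forall>p m. closed_loop_trajectory A \<nu> \<eta> (dist_map E p') p m \<and>
           p 0 = p0 \<and> m 0 = dist_map E p0 \<longrightarrow>
           (\<exists>q\<in>U. congruent_configs p' q \<and> (\<forall>t\<ge>0. norm (p t - q) \<le> K * exp (- c * t))))))"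


section \<open>Eigenvalues of a real operator on an invariant subspace\<close>

text \<open>Eigenvalues are complex, i.e. those of the complexified operator \<open>f(u + \<i> v) = f u + \<i> f v\<close>
  on \<open>{u + \<i> v. u, v \<in> V}\<close>.\<close>

definition Re_vec :: "complex ^ 'k \<Rightarrow> real ^ 'k" where
  "Re_vec z = (\<chi> k. Re (z $ k))"

definition Im_vec :: "complex ^ 'k \<Rightarrow> real ^ 'k" where
  "Im_vec z = (\<chi> k. Im (z $ k))"

definition complexify :: "(real ^ 'k \<Rightarrow> real ^ 'k) \<Rightarrow> complex ^ 'k \<Rightarrow> complex ^ 'k" where
  "complexify f z = (\<chi> k. Complex (f (Re_vec z) $ k) (f (Im_vec z) $ k))"

definition eigenvalue_on ::
  "(real ^ 'k) set \<Rightarrow> (real ^ 'k \<Rightarrow> real ^ 'k) \<Rightarrow> complex \<Rightarrow> bool" where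
  "eigenvalue_on V f \<mu> \<longleftrightarrow>
     (\<exists>z. z \<noteq> 0 \<and> Re_vec z \<in> V \<and> Im_vec z \<in> V \<and> complexify f z = \<mu> *s z)"

definition Hurwitz_on :: "(real ^ 'k) set \<Rightarrow> (real ^ 'k \<Rightarrow> real ^ 'k) \<Rightarrow> bool" where
  "Hurwitz_on V f \<longleftrightarrow> (\<forall>\<mu>. eigenvalue_on V f \<mu> \<longrightarrow> Re \<mu> < 0)"

end

theory Submission
  imports Defs "HOL-Computational_Algebra.Fundamental_Theorem_Algebra"
begin

text \<open>Write \<open>F\<close> for the distance map and \<open>R p\<close> for the rigidity matrix, and let \<open>w p = F p - m\<^sup>*\<close>
  be the error. Along the closed loop the measurement is slaved to the configuration, \<open>m = F p\<close>, so
  only the equation \<open>p' = - \<nu>\<^sub>p (w p)\<close> remains, and it gives \<open>w' = - \<eta>\<^sub>p w\<close> with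
  \<open>\<eta>\<^sub>p = 2 R p \<nu>\<^sub>p\<close> close to \<open>\<eta>\<^sup>*\<close>. Moreover \<open>w\<close> is a point of a submanifold with tangent space
  \<open>T\<close>, so it lies in \<open>T\<close> up to an error of higher order. Hence near the target the error behaves
  like a solution of the linear equation \<open>w' = - \<eta>\<^sup>* w\<close> on \<open>T\<close>, and quadratic forms that are
  strictly monotone along the linear equation remain so along the nonlinear one
  (\<open>form_near_target\<close>, \<open>closed_loop_form_near_target\<close>).

  If \<open>- \<eta>\<^sup>*\<close> is Hurwitz on \<open>T\<close>, there is a definite form which decreases
  (\<open>Hurwitz_lyapunov_form\<close>). So the error decays exponentially, the velocity is bounded by the
  error, and the configuration converges before it can leave a small ball; its limit has zero
  error, and rigidity makes it congruent to the target (\<open>exponential_convergence\<close>,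
  \<open>Hurwitz_imp_stable\<close>). Condition (b) implies (a) by evaluating the form on the real and the
  imaginary part of an eigenvector (\<open>positive_form_imp_Hurwitz\<close>).

  Conversely, let the controller be stable with rate \<open>c\<close> and let \<open>- \<eta>\<^sup>*\<close> have an eigenvalue with
  nonnegative real part. For some \<open>\<beta>\<close> with \<open>0 < \<beta> < c\<close> the shifted operator \<open>- \<eta>\<^sup>* + \<beta>\<close> has no
  eigenvalue on the imaginary axis but has one to its right, so some form \<open>V\<close>, positive somewhere
  on \<open>T\<close>, increases along the shifted equation (\<open>unstable_lyapunov_form\<close>). Then
  \<open>exp (2 \<beta> t) V(w, w)\<close> does not decrease along trajectories near the target, whereas
  convergence at rate \<open>c\<close> forces it to \<open>0\<close>. Trajectories that start near the target do stay
  there: on a finite time interval because the target is an equilibrium, and afterwards because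
  the uniform exponential bound has become small (\<open>stable_imp_confined\<close>, \<open>stable_imp_Hurwitz\<close>).

  The differential equation makes sense near the target because the regular configurations form an
  open set (\<open>regular_configs_open\<close>), which rests on compactness of bounded sets of edge vectors.\<close>

section \<open>Quadratic Lyapunov forms of a real operator\<close>

text \<open>Separating real and imaginary parts lets the rest of the theory work with pairs of real vectors.\<close>

lemma eigenvalue_on_iff:
  "eigenvalue_on T f \<mu> \<longleftrightarrow> (\<exists>u\<in>T. \<exists>v\<in>T. (u \<noteq> 0 \<or> v \<noteq> 0) \<and>
     f u = Re \<mu> *\<^sub>R u - Im \<mu> *\<^sub>R v \<and> f v = Im \<mu> *\<^sub>R u + Re \<mu> *\<^sub>R v)"
proof
  assume "eigenvalue_on T f \<mu>"
  then obtain z where z: "z \<noteq> 0" "Re_vec z \<in> T" "Im_vec z \<in> T" "complexify f z = \<mu> *s z"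
    by (auto simp: eigenvalue_on_def)
  have "Re_vec z \<noteq> 0 \<or> Im_vec z \<noteq> 0"
    using z(1) by (auto simp: Re_vec_def Im_vec_def vec_eq_iff complex_eq_iff)
  moreover have "f (Re_vec z) = Re \<mu> *\<^sub>R Re_vec z - Im \<mu> *\<^sub>R Im_vec z"
    "f (Im_vec z) = Im \<mu> *\<^sub>R Re_vec z + Re \<mu> *\<^sub>R Im_vec z"
    using z(4) by (auto simp: vec_eq_iff complexify_def complex_eq_iff Re_vec_def Im_vec_def)
  ultimately show "\<exists>u\<in>T. \<exists>v\<in>T. (u \<noteq> 0 \<or> v \<noteq> 0) \<and>
     f u = Re \<mu> *\<^sub>R u - Im \<mu> *\<^sub>R v \<and> f v = Im \<mu> *\<^sub>R u + Re \<mu> *\<^sub>R v"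
    using z(2,3) by blast
next
  assume "\<exists>u\<in>T. \<exists>v\<in>T. (u \<noteq> 0 \<or> v \<noteq> 0) \<and>
     f u = Re \<mu> *\<^sub>R u - Im \<mu> *\<^sub>R v \<and> f v = Im \<mu> *\<^sub>R u + Re \<mu> *\<^sub>R v"
  then obtain u v where uv: "u \<in> T" "v \<in> T" "u \<noteq> 0 \<or> v \<noteq> 0"
    "f u = Re \<mu> *\<^sub>R u - Im \<mu> *\<^sub>R v" "f v = Im \<mu> *\<^sub>R u + Re \<mu> *\<^sub>R v" by blast
  define z where "z = (\<chi> k. Complex (u $ k) (v $ k))"
  have ReIm: "Re_vec z = u" "Im_vec z = v"
    by (auto simp: z_def Re_vec_def Im_vec_def vec_eq_iff)
  have "z \<noteq> 0"
  proof
    assume "z = 0"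
    then have "Re_vec z = 0" "Im_vec z = 0" by (simp_all add: Re_vec_def Im_vec_def vec_eq_iff)
    then show False using uv(3) ReIm by simp
  qed
  moreover have "complexify f z = \<mu> *s z"
    by (auto simp: complexify_def ReIm uv(4,5) vec_eq_iff complex_eq_iff) 
       (auto simp: z_def)
  ultimately show "eigenvalue_on T f \<mu>"
    unfolding eigenvalue_on_def using ReIm uv by (intro exI[of _ z]) auto
qed

lemma eigenvalue_on_cong:
  "(\<And>x. x \<in> T \<Longrightarrow> f x = g x) \<Longrightarrow> eigenvalue_on T f \<mu> \<longleftrightarrow> eigenvalue_on T g \<mu>"
  unfolding eigenvalue_on_iff by (metis (no_types, lifting))

lemma complexify_add: "linear f \<Longrightarrow> complexify f (z + w) = complexify f z + complexify f w"
proof -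
  assume f: "linear f"
  have "Re_vec (z + w) = Re_vec z + Re_vec w" "Im_vec (z + w) = Im_vec z + Im_vec w"
    by (auto simp: Re_vec_def Im_vec_def vec_eq_iff)
  then show ?thesis
    by (simp only: complexify_def linear_add[OF f]) (simp add: vec_eq_iff complex_eq_iff)
qed

lemma Re_vec_scale: "Re_vec (c *s z) = Re c *\<^sub>R Re_vec z - Im c *\<^sub>R Im_vec z"
  and Im_vec_scale: "Im_vec (c *s z) = Re c *\<^sub>R Im_vec z + Im c *\<^sub>R Re_vec z"
  by (auto simp: Re_vec_def Im_vec_def vec_eq_iff)

lemma complexify_scale: "linear f \<Longrightarrow> complexify f (c *s z) = c *s complexify f z"
  by (auto simp: complexify_def vec_eq_iff complex_eq_iff Re_vec_scale Im_vec_scale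
      linear_add linear_diff linear_scale)

lemma complexify_funpow_add:
  "linear f \<Longrightarrow> (complexify f ^^ i) (z + w) = (complexify f ^^ i) z + (complexify f ^^ i) w"
  by (induction i) (auto simp: complexify_add)

lemma complexify_funpow_scale:
  "linear f \<Longrightarrow> (complexify f ^^ i) (c *s z) = c *s (complexify f ^^ i) z"
  by (induction i) (auto simp: complexify_scale)

text \<open>Split off one linear factor \<open>X - r\<close> of \<open>p\<close> at a time: either \<open>f - r\<close> kills \<open>z\<close>, which is
  then an eigenvector, or \<open>(f - r) z\<close> is a nonzero vector annihilated by the quotient.\<close>

lemma annihilated_imp_eigenvalue:
  fixes f :: "real ^ 'k \<Rightarrow> real ^ 'k" and p :: "complex poly"
  assumes f: "linear f" and T: "subspace T" "f ` T \<subseteq> T"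
  shows "\<lbrakk>p \<noteq> 0; z \<noteq> 0; Re_vec z \<in> T; Im_vec z \<in> T;
      (\<Sum>i\<le>degree p. coeff p i *s (complexify f ^^ i) z) = 0\<rbrakk> \<Longrightarrow> \<exists>\<mu>. eigenvalue_on T f \<mu>"
proof (induction "degree p" arbitrary: p z)
  case 0
  then have "coeff p 0 *s z = 0" by simp
  moreover have "coeff p 0 \<noteq> 0" using 0 by (metis leading_coeff_0_iff)
  ultimately show ?case using 0 by (simp add: vec_eq_iff)
next
  case (Suc d)
  let ?G = "complexify f"
  have "\<not> constant (poly p)"
    using Suc(2) by (simp add: constant_degree)
  then obtain r where "poly p r = 0"
    using fundamental_theorem_of_algebra by blast
  then obtain q where p: "p = [:-r, 1:] * q"
    by (auto simp: poly_eq_0_iff_dvd dvd_def)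
  have q0: "q \<noteq> 0" using p Suc by auto
  have dp: "degree p = Suc (degree q)"
    unfolding p using q0 by (subst degree_mult_eq) auto
  define w where "w = ?G z - r *s z"
  show ?case
  proof (cases "w = 0")
    case True
    then have "eigenvalue_on T f r"
      unfolding eigenvalue_on_def using Suc by (intro exI[of _ z]) (auto simp: w_def)
    then show ?thesis by blast
  next
    case False
    have Gz: "Re_vec (?G z) = f (Re_vec z)" "Im_vec (?G z) = f (Im_vec z)"
      by (auto simp: complexify_def Re_vec_def Im_vec_def vec_eq_iff)
    have "Re_vec w = f (Re_vec z) - Re_vec (r *s z)" "Im_vec w = f (Im_vec z) - Im_vec (r *s z)"
      unfolding w_def Gz[symmetric] by (auto simp: Re_vec_def Im_vec_def vec_eq_iff)
    then have wT: "Re_vec w \<in> T" "Im_vec w \<in> T"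
      using T Suc(5,6) by (auto simp: Re_vec_scale Im_vec_scale
          intro!: subspace_diff subspace_add subspace_scale)
    have cp: "coeff p i = (case i of 0 \<Rightarrow> 0 | Suc j \<Rightarrow> coeff q j) - r * coeff q i" for i
      unfolding p by (simp add: coeff_pCons split: nat.split)
    have "(\<Sum>i\<le>Suc (degree q). coeff p i *s (?G ^^ i) z)
        = (\<Sum>i\<le>Suc (degree q). (case i of 0 \<Rightarrow> 0 | Suc j \<Rightarrow> coeff q j) *s (?G ^^ i) z)
          - (\<Sum>i\<le>Suc (degree q). (r * coeff q i) *s (?G ^^ i) z)"
      unfolding sum_subtractf[symmetric] cp by (simp add: vector_sub_rdistrib)
    also have "(\<Sum>i\<le>Suc (degree q). (case i of 0 \<Rightarrow> 0 | Suc j \<Rightarrow> coeff q j) *s (?G ^^ i) z)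
        = (\<Sum>i\<le>degree q. coeff q i *s (?G ^^ i) (?G z))"
      by (subst sum.atMost_Suc_shift) (simp add: funpow_swap1)
    also have "(\<Sum>i\<le>Suc (degree q). (r * coeff q i) *s (?G ^^ i) z)
        = (\<Sum>i\<le>degree q. coeff q i *s (?G ^^ i) (r *s z))"
      using coeff_eq_0[of q "Suc (degree q)"]
      by (simp add: complexify_funpow_scale[OF f] vector_smult_assoc mult.commute)
    also have "(\<Sum>i\<le>degree q. coeff q i *s (?G ^^ i) (?G z)) - \<dots>
        = (\<Sum>i\<le>degree q. coeff q i *s (?G ^^ i) w)"
    proof -
      have "(?G ^^ i) (?G z) = (?G ^^ i) w + (?G ^^ i) (r *s z)" for i
        unfolding complexify_funpow_add[OF f, symmetric] by (simp add: w_def)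
      then show ?thesis
        by (simp add: vector_add_ldistrib sum.distrib)
    qed
    finally have "(\<Sum>i\<le>degree q. coeff q i *s (?G ^^ i) w) = 0"
      using Suc(7) dp by simp
    then show ?thesis
      using Suc(1)[of q w] Suc(2) dp q0 False wT by simp
  qed
qed

text \<open>The vectors \<open>x, f x, f\<^sup>2 x, \<dots>\<close> are linearly dependent, so some nonzero polynomial in \<open>f\<close>
  annihilates \<open>x\<close>.\<close>

lemma eigenvalue_exists:
  fixes f :: "real ^ 'k \<Rightarrow> real ^ 'k"
  assumes f: "linear f" and T: "subspace T" "f ` T \<subseteq> T" and x: "x \<in> T" "x \<noteq> 0"
  shows "\<exists>\<mu>. eigenvalue_on T f \<mu>"
proof -
  let ?N = "DIM(real ^ 'k)"
  obtain c :: "nat \<Rightarrow> real" where c: "(\<Sum>i\<le>?N. c i *\<^sub>R (f ^^ i) x) = 0" "\<exists>i\<le>?N. c i \<noteq> 0"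
  proof (cases "inj_on (\<lambda>i. (f ^^ i) x) {..?N}")
    case True
    let ?S = "(\<lambda>i. (f ^^ i) x) ` {..?N}"
    have "card ?S = Suc ?N" using True by (simp only: card_image card_atMost)
    then have "dependent ?S" by (intro dependent_biggerset) auto
    then obtain u where u: "(\<Sum>v\<in>?S. u v *\<^sub>R v) = 0" "\<exists>v\<in>?S. u v \<noteq> 0"
      by (auto simp: dependent_finite)
    show thesis
    proof (rule that[of "\<lambda>i. u ((f ^^ i) x)"])
      show "(\<Sum>i\<le>?N. u ((f ^^ i) x) *\<^sub>R (f ^^ i) x) = 0"
        using u(1) unfolding sum.reindex[OF True] by (simp only: o_def)
      show "\<exists>i\<le>?N. u ((f ^^ i) x) \<noteq> 0" using u(2) by blast
    qed
  next
    case False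
    then obtain i j where ij: "i \<le> ?N" "j \<le> ?N" "i \<noteq> j" "(f ^^ i) x = (f ^^ j) x"
      by (auto simp: inj_on_def)
    have "(\<Sum>k\<le>?N. ((if k = i then 1 else 0) - (if k = j then 1 else 0)) *\<^sub>R (f ^^ k) x)
        = (\<Sum>k\<le>?N. (if k = i then (f ^^ k) x else 0)) - (\<Sum>k\<le>?N. (if k = j then (f ^^ k) x else 0))"
      unfolding sum_subtractf[symmetric] by (rule sum.cong) auto
    also have "\<dots> = 0" using ij by simp
    finally show thesis
      by (intro that[of "\<lambda>k. (if k = i then 1 else 0) - (if k = j then 1 else 0)"])
        (use ij in auto)
  qed
  define p where "p = (\<Sum>i\<le>?N. monom (complex_of_real (c i)) i)"
  have cp: "coeff p i = (if i \<le> ?N then of_real (c i) else 0)" for i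
    unfolding p_def coeff_sum by (simp add: if_distrib cong: if_cong)
  have p0: "p \<noteq> 0"
    using c(2) cp by (metis coeff_0 of_real_eq_0_iff)
  have deg: "degree p \<le> ?N"
    by (rule degree_le) (simp add: cp)
  define z where "z = (\<chi> k. complex_of_real (x $ k))"
  have pow: "(complexify f ^^ i) z = (\<chi> k. complex_of_real ((f ^^ i) x $ k))" for i
    by (induction i)
      (auto simp: z_def complexify_def vec_eq_iff complex_eq_iff Re_vec_def Im_vec_def
         linear_0[OF f] simp flip: zero_vec_def)
  have "(\<Sum>i\<le>degree p. coeff p i *s (complexify f ^^ i) z)
      = (\<Sum>i\<le>?N. coeff p i *s (complexify f ^^ i) z)"
    using deg by (intro sum.mono_neutral_left) (auto simp: coeff_eq_0)
  also have "\<dots> = (\<chi> k. complex_of_real ((\<Sum>i\<le>?N. c i *\<^sub>R (f ^^ i) x) $ k))"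
    by (auto simp: pow cp vec_eq_iff)
  also have "\<dots> = 0" unfolding c(1) by (simp add: vec_eq_iff)
  finally have "(\<Sum>i\<le>degree p. coeff p i *s (complexify f ^^ i) z) = 0" .
  moreover have "z \<noteq> 0" using x by (auto simp: z_def vec_eq_iff)
  moreover have "Re_vec z = x" "Im_vec z = 0"
    by (auto simp: z_def Re_vec_def Im_vec_def vec_eq_iff)
  ultimately show ?thesis
    using annihilated_imp_eigenvalue[OF f T p0, of z] x T(1) by (simp add: subspace_0)
qed

lemma linear_surj_on_imp_inj_on:
  fixes h :: "'a::euclidean_space \<Rightarrow> 'a"
  assumes h: "linear h" and S: "subspace S" and eq: "h ` S = S"
  shows "inj_on h S"
proof -
  obtain g where g: "range g \<subseteq> S" "linear g" "\<And>v. v \<in> S \<Longrightarrow> h (g v) = v"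
    using linear_exists_right_inverse_on[OF h S] eq by auto
  have "inj_on g (span S)" using g(3) S by (metis inj_on_inverseI span_eq_iff)
  then have "dim (g ` S) = dim S" using g(2) by (intro dim_image_eq)
  then have gS: "g ` S = S"
    using g S by (intro subspace_dim_equal linear_subspace_image) auto
  show ?thesis
  proof (rule inj_onI)
    fix x y assume xy: "x \<in> S" "y \<in> S" "h x = h y"
    obtain x' y' where "x = g x'" "x' \<in> S" "y = g y'" "y' \<in> S" using gS xy by blast
    then show "x = y" using xy(3) g(3) by auto
  qed
qed

text \<open>If \<open>\<mu>\<close> is an eigenvalue, \<open>f - \<mu>\<close> is not injective on the complexification \<open>T \<times> T\<close> of \<open>T\<close>, hence
  not surjective, and a vector orthogonal to its image is the required functional. The kernel of a
  left eigenvector is an invariant subspace, whose eigenvalues are eigenvalues of \<open>f\<close> on \<open>T\<close>; this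
  is why left rather than right eigenvectors drive the induction below.\<close>

lemma left_eigenvector_exists:
  fixes f :: "real ^ 'k \<Rightarrow> real ^ 'k"
  assumes f: "linear f" and T: "subspace T" "f ` T \<subseteq> T" and x: "x \<in> T" "x \<noteq> 0"
  obtains \<mu> and l :: "real ^ 'k \<Rightarrow> complex"
  where "eigenvalue_on T f \<mu>" "linear l" "\<exists>y\<in>T. l y \<noteq> 0" "\<And>y. y \<in> T \<Longrightarrow> l (f y) = \<mu> * l y"
proof -
  obtain \<mu> where \<mu>: "eigenvalue_on T f \<mu>" using eigenvalue_exists[OF assms] by blast
  define a b where "a = Re \<mu>" and "b = Im \<mu>"
  obtain u v where uv: "u \<in> T" "v \<in> T" "u \<noteq> 0 \<or> v \<noteq> 0"
     "f u = a *\<^sub>R u - b *\<^sub>R v" "f v = b *\<^sub>R u + a *\<^sub>R v"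
    using \<mu> unfolding eigenvalue_on_iff a_def b_def by blast
  define h where "h = (\<lambda>(u, v). (f u - (a *\<^sub>R u - b *\<^sub>R v), f v - (b *\<^sub>R u + a *\<^sub>R v)))"
  have lin: "linear h"
    by (rule linearI) (auto simp: h_def linear_add[OF f] linear_scale[OF f] algebra_simps)
  have sub: "subspace (T \<times> T)" using T by (simp add: subspace_Times)
  have im: "h ` (T \<times> T) \<subseteq> T \<times> T"
    using T by (auto simp: h_def intro!: subspace_diff subspace_add subspace_scale)
  have "h ` (T \<times> T) \<noteq> T \<times> T"
  proof
    assume eq: "h ` (T \<times> T) = T \<times> T"
    have "inj_on h (T \<times> T)"
      by (rule linear_surj_on_imp_inj_on[OF lin sub eq])
    moreover have "h (u, v) = h (0, 0)"
      using uv by (simp add: h_def linear_0[OF f])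
    ultimately show False
      using uv T by (auto dest!: inj_onD simp: subspace_0)
  qed
  then have "span (h ` (T \<times> T)) \<subset> span (T \<times> T)"
    using im span_eq_iff[of "T \<times> T"] span_eq_iff[of "h ` (T \<times> T)"]
      linear_subspace_image[OF lin sub] sub by (metis psubsetI)
  then obtain st where st: "st \<noteq> 0" "st \<in> T \<times> T"
    "\<And>y. y \<in> span (h ` (T \<times> T)) \<Longrightarrow> orthogonal st y"
    using orthogonal_to_subspace_exists_gen[of "h ` (T \<times> T)" "T \<times> T"] sub span_eq_iff by metis
  obtain s t where st_eq: "st = (s, t)" by (cases st)
  have orth: "s \<bullet> (f u - (a *\<^sub>R u - b *\<^sub>R v)) + t \<bullet> (f v - (b *\<^sub>R u + a *\<^sub>R v)) = 0"
    if "u \<in> T" "v \<in> T" for u v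
  proof -
    have "h (u, v) \<in> span (h ` (T \<times> T))" using that by (intro span_base imageI) auto
    from st(3)[OF this] show ?thesis by (simp add: st_eq orthogonal_def h_def)
  qed
  define l where "l = (\<lambda>y. Complex (s \<bullet> y) (- (t \<bullet> y)))"
  have "linear l"
    by (rule linearI) (auto simp: l_def inner_add_right complex_eq_iff)
  moreover have "\<exists>y\<in>T. l y \<noteq> 0"
  proof (cases "s = 0")
    case True
    then show ?thesis using st by (intro bexI[of _ t]) (auto simp: l_def st_eq complex_eq_iff zero_prod_def)
  next
    case False
    then show ?thesis using st by (intro bexI[of _ s]) (auto simp: l_def st_eq complex_eq_iff)
  qed
  moreover have "l (f y) = \<mu> * l y" if "y \<in> T" for y
    using orth[OF that subspace_0[OF T(1)]] orth[OF subspace_0[OF T(1)] that]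
    by (auto simp: l_def complex_eq_iff a_def b_def linear_0[OF f] inner_diff_right inner_add_right)
  ultimately show thesis using that \<mu> by blast
qed

text \<open>Completing the square absorbs the mixed term \<open>c A B\<close> once the weight of \<open>B\<^sup>2\<close> is large.\<close>

lemma quadratic_weight:
  fixes A B a c s :: real
  assumes a: "0 < a" and s: "c\<^sup>2 / (2 * a) + 1 \<le> s"
  shows "a / 2 * A\<^sup>2 + B\<^sup>2 \<le> a * A\<^sup>2 - c * A * B + s * B\<^sup>2"
proof -
  have "0 \<le> a / 2 * (A - c / a * B)\<^sup>2" using a by simp
  also have "\<dots> = a / 2 * A\<^sup>2 - c * A * B + c\<^sup>2 / (2 * a) * B\<^sup>2"
    using a by (simp add: power2_eq_square field_simps)
  also have "\<dots> \<le> a / 2 * A\<^sup>2 - c * A * B + (s - 1) * B\<^sup>2"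
    using s by (intro add_left_mono mult_right_mono) auto
  finally show ?thesis by (simp add: algebra_simps)
qed

text \<open>The form is built by induction on the dimension along the kernel \<open>T'\<close> of a left eigenvector \<open>l\<close>
  with eigenvalue \<open>\<mu>\<close>: take the form of \<open>T'\<close>, composed with a projection, and add the multiple
  \<open>s sgn (Re \<mu> - \<beta>)\<close> of \<open>Re (cnj (l x) l y)\<close>. The sign makes the added part increase along
  \<open>f - \<beta>\<close>, and a large \<open>s\<close> dominates the coupling between \<open>T'\<close> and its complement. The finite set
  \<open>L\<close> collects the real parts met on the way; they are the only shifts that must be avoided. If all
  of them lie to the left of \<open>\<beta>\<close>, all signs are negative, and so is the form.\<close>

lemma lyapunov_form_exists:
  fixes f :: "real ^ 'k \<Rightarrow> real ^ 'k"
  assumes f: "linear f"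
  shows "\<lbrakk>subspace T; f ` T \<subseteq> T\<rbrakk> \<Longrightarrow> \<exists>L. finite L \<and> (\<forall>r\<in>L. \<exists>\<mu>. eigenvalue_on T f \<mu> \<and> Re \<mu> = r) \<and>
    (\<forall>\<beta>. \<beta> \<notin> L \<longrightarrow> (\<exists>V a. bounded_bilinear V \<and> (\<forall>x y. V x y = V y x) \<and> (0::real) < a \<and>
        (\<forall>x\<in>T. a * (norm x)\<^sup>2 \<le> V x (f x - \<beta> *\<^sub>R x)) \<and>
        ((\<forall>r\<in>L. r < \<beta>) \<longrightarrow> (\<forall>x\<in>T. V x x \<le> - a * (norm x)\<^sup>2))))"
proof (induction "dim T" arbitrary: T rule: less_induct)
  case less
  note T = less(2,3)
  show ?case
  proof (cases "T = {0}")
    case True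
    have "bounded_bilinear (\<lambda>x y :: real ^ 'k. 0 :: real)"
      by standard (auto intro: exI[of _ 0])
    then show ?thesis
      using True by (intro exI[of _ "{}"]) (auto intro!: exI[of _ "\<lambda>x y. 0"] exI[of _ 1])
  next
    case False
    then obtain x0 where "x0 \<in> T" "x0 \<noteq> 0" using subspace_0[OF T(1)] by blast
    then obtain \<mu> and l :: "real ^ 'k \<Rightarrow> complex"
      where \<mu>: "eigenvalue_on T f \<mu>" and l: "linear l" "\<exists>y\<in>T. l y \<noteq> 0"
        "\<And>y. y \<in> T \<Longrightarrow> l (f y) = \<mu> * l y"
      using left_eigenvector_exists[OF f T] by metis
    define T' where "T' = {x \<in> T. l x = 0}"
    have sub: "subspace T'"
      using T(1) by (auto simp: T'_def subspace_def linear_0[OF l(1)] linear_add[OF l(1)] linear_scale[OF l(1)])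
    have inv: "f ` T' \<subseteq> T'" using T l(3) by (auto simp: T'_def)
    have "T' \<subset> T" using l(2) by (auto simp: T'_def)
    then have "dim T' < dim T"
      using sub T(1) by (metis dim_psubset span_eq_iff)
    from less(1)[OF this sub inv] obtain L where L: "finite L"
        "\<And>r. r \<in> L \<Longrightarrow> \<exists>\<mu>. eigenvalue_on T' f \<mu> \<and> Re \<mu> = r"
        "\<And>\<beta>. \<beta> \<notin> L \<Longrightarrow> (\<exists>V a. bounded_bilinear V \<and> (\<forall>x y. V x y = V y x) \<and> (0::real) < a \<and>
        (\<forall>x\<in>T'. a * (norm x)\<^sup>2 \<le> V x (f x - \<beta> *\<^sub>R x)) \<and>
        ((\<forall>r\<in>L. r < \<beta>) \<longrightarrow> (\<forall>x\<in>T'. V x x \<le> - a * (norm x)\<^sup>2)))" by blast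
    have ev: "eigenvalue_on T f \<nu>" if "eigenvalue_on T' f \<nu>" for \<nu>
      using that unfolding eigenvalue_on_def T'_def by blast
    obtain g where g: "range g \<subseteq> T" "linear g" "\<And>c. c \<in> l ` T \<Longrightarrow> l (g c) = c"
      using linear_exists_right_inverse_on[OF l(1) T(1)] by auto
    define P where "P = (\<lambda>x. x - g (l x))"
    have P: "linear P"
      unfolding P_def using linear_compose[OF l(1) g(2)] by (intro linear_compose_sub linear_ident) (simp_all add: o_def)
    have PT: "P x \<in> T'" if "x \<in> T" for x
      using that g T(1) by (auto simp: P_def T'_def linear_diff[OF l(1)] intro!: subspace_diff)
    have PT': "P x = x" if "x \<in> T'" for x
      using that by (simp add: P_def T'_def linear_0[OF g(2)])
    have V: "\<exists>V a. bounded_bilinear V \<and> (\<forall>x y. V x y = V y x) \<and> (0::real) < a \<and>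
        (\<forall>x\<in>T. a * (norm x)\<^sup>2 \<le> V x (f x - \<beta> *\<^sub>R x)) \<and>
        ((\<forall>r\<in>insert (Re \<mu>) L. r < \<beta>) \<longrightarrow> (\<forall>x\<in>T. V x x \<le> - a * (norm x)\<^sup>2))"
      if \<beta>: "\<beta> \<notin> insert (Re \<mu>) L" for \<beta>
    proof -
      obtain V a where V: "bounded_bilinear V" "\<And>x y. V x y = V y x" "(0::real) < a"
        "\<And>x. x \<in> T' \<Longrightarrow> a * (norm x)\<^sup>2 \<le> V x (f x - \<beta> *\<^sub>R x)"
        "(\<forall>r\<in>L. r < \<beta>) \<Longrightarrow> x \<in> T' \<Longrightarrow> V x x \<le> - a * (norm x)\<^sup>2" for x
        using L(3)[of \<beta>] \<beta> by blast
      interpret V: bounded_bilinear V by fact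
      define h where "h = (\<lambda>x. f x - \<beta> *\<^sub>R x)"
      have h: "linear h"
        unfolding h_def by (intro linear_compose_sub f linear_compose_scale_right linear_ident)
      have hT: "h x \<in> T" if "x \<in> T" for x
        using that T by (auto simp: h_def intro!: subspace_diff subspace_scale)
      have hT': "h x \<in> T'" if "x \<in> T'" for x
        using that inv sub by (auto simp: h_def intro!: subspace_diff subspace_scale)
      obtain K where K: "0 < K" "\<And>x y. \<bar>V x y\<bar> \<le> norm x * norm y * K"
        using V.pos_bounded by auto
      obtain G where G: "0 < G" "\<And>c. norm (g c) \<le> G * norm c"
        using linear_bounded_pos[OF g(2)] by blast
      obtain H where H: "0 < H" "\<And>c. norm (P (h (g c))) \<le> H * norm c"
        using linear_bounded_pos[OF linear_compose[OF linear_compose[OF g(2) h] P]] by (auto simp: o_def)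
      define d where "d = \<bar>Re \<mu> - \<beta>\<bar>"
      have d: "0 < d" using \<beta> by (auto simp: d_def)
      \<comment> \<open>This is the least weight for which \<open>s d\<close> satisfies the hypothesis of \<open>quadratic_weight\<close> with \<open>c = K H\<close>.\<close>
      define s where "s = ((K * H)\<^sup>2 / (2 * a) + 1) / d"
      have s: "0 < s" using d V(3) by (auto simp: s_def intro!: divide_pos_pos add_nonneg_pos)
      define W where "W = (\<lambda>x y. V (P x) (P y) + s * sgn (Re \<mu> - \<beta>) * (l x \<bullet> l y))"
      have bW: "bounded_bilinear W"
      proof -
        have P': "bounded_linear P" and l': "bounded_linear l"
          using P l(1) by (auto simp: linear_conv_bounded_linear)
        have "bounded_bilinear (\<lambda>x y. V (P x) (P y))"
          by (rule V.comp[OF P' P'])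
        moreover have "bounded_bilinear (\<lambda>x y. l x \<bullet> l y)"
          by (rule bounded_bilinear.comp[OF bounded_bilinear_inner l' l'])
        ultimately show ?thesis
          unfolding W_def
          by (auto simp: bilinear_conv_bounded_bilinear[symmetric] bilinear_def linear_iff algebra_simps)
      qed
      have norm_sq: "(norm x)\<^sup>2 \<le> (2 + 2 * G\<^sup>2) * ((norm (P x))\<^sup>2 + (norm (l x))\<^sup>2)" for x
      proof -
        have "norm x \<le> norm (P x) + norm (g (l x))"
          unfolding P_def by (metis diff_add_cancel norm_triangle_ineq)
        then have "norm x \<le> norm (P x) + G * norm (l x)" using G(2)[of "l x"] by linarith
        then have "(norm x)\<^sup>2 \<le> (norm (P x) + G * norm (l x))\<^sup>2" by (intro power_mono) auto
        also have "\<dots> \<le> 2 * (norm (P x))\<^sup>2 + 2 * (G * norm (l x))\<^sup>2"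
          using zero_le_power2[of "norm (P x) - G * norm (l x)"] by (simp add: power2_eq_square algebra_simps)
        also have "\<dots> \<le> (2 + 2 * G\<^sup>2) * ((norm (P x))\<^sup>2 + (norm (l x))\<^sup>2)"
          by (simp add: power_mult_distrib algebra_simps)
        finally show ?thesis .
      qed
      define b where "b = min (min (a / 2) 1) s / (2 + 2 * G\<^sup>2)"
      have G2: "0 < 2 + 2 * G\<^sup>2" by (intro add_pos_nonneg) auto
      have b: "0 < b" using V(3) s G2 by (simp add: b_def)
      have b_le: "b * (norm x)\<^sup>2 \<le> u * (norm (P x))\<^sup>2 + v * (norm (l x))\<^sup>2"
        if "min (min (a / 2) 1) s \<le> u" "min (min (a / 2) 1) s \<le> v" for x u v
      proof -
        have "b * (norm x)\<^sup>2 \<le> b * ((2 + 2 * G\<^sup>2) * ((norm (P x))\<^sup>2 + (norm (l x))\<^sup>2))"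
          using norm_sq b by (intro mult_left_mono) auto
        also have "\<dots> = min (min (a / 2) 1) s * ((norm (P x))\<^sup>2 + (norm (l x))\<^sup>2)"
          using G2 by (simp add: b_def)
        also have "\<dots> \<le> u * (norm (P x))\<^sup>2 + v * (norm (l x))\<^sup>2"
          unfolding distrib_left using that by (intro add_mono mult_right_mono) auto
        finally show ?thesis .
      qed
      have pos: "b * (norm x)\<^sup>2 \<le> W x (f x - \<beta> *\<^sub>R x)" if x: "x \<in> T" for x
      proof -
        have xd: "x = P x + g (l x)" by (simp add: P_def)
        have "P (h x) = P (h (P x)) + P (h (g (l x)))"
          by (subst xd) (simp only: linear_add[OF h] linear_add[OF P])
        also have "P (h (P x)) = h (P x)" using hT'[OF PT[OF x]] PT' by blast
        finally have "V (P x) (P (h x)) = V (P x) (h (P x)) + V (P x) (P (h (g (l x))))"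
          by (simp add: V.add_right)
        moreover have "a * (norm (P x))\<^sup>2 \<le> V (P x) (h (P x))"
          using V(4)[OF PT[OF x]] by (simp add: h_def)
        moreover have "\<bar>V (P x) (P (h (g (l x))))\<bar> \<le> K * H * norm (P x) * norm (l x)"
        proof -
          have "\<bar>V (P x) (P (h (g (l x))))\<bar> \<le> norm (P x) * norm (P (h (g (l x)))) * K" by (rule K(2))
          also have "\<dots> \<le> norm (P x) * (H * norm (l x)) * K"
            using H(2)[of "l x"] K(1) by (intro mult_right_mono mult_left_mono) auto
          finally show ?thesis by (simp add: mult_ac)
        qed
        ultimately have 1: "a * (norm (P x))\<^sup>2 - K * H * norm (P x) * norm (l x) \<le> V (P x) (P (h x))"
          by linarith
        have "l (h x) = (\<mu> - of_real \<beta>) * l x"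
          using l(3)[OF x] by (simp add: h_def linear_diff[OF l(1)] linear_scale[OF l(1)]
              left_diff_distrib) (simp add: scaleR_conv_of_real)
        moreover have "l x \<bullet> ((\<mu> - of_real \<beta>) * l x) = (Re \<mu> - \<beta>) * (norm (l x))\<^sup>2"
          unfolding cmod_power2 by (simp add: inner_complex_def power2_eq_square algebra_simps)
        ultimately have "l x \<bullet> l (h x) = (Re \<mu> - \<beta>) * (norm (l x))\<^sup>2" by metis
        then have 2: "s * sgn (Re \<mu> - \<beta>) * (l x \<bullet> l (h x)) = s * d * (norm (l x))\<^sup>2"
          by (simp add: d_def abs_sgn mult_ac)
        have "(K * H)\<^sup>2 / (2 * a) + 1 \<le> s * d" using d by (simp add: s_def)
        from quadratic_weight[OF V(3) this, of "norm (P x)" "norm (l x)"]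
        have "a / 2 * (norm (P x))\<^sup>2 + 1 * (norm (l x))\<^sup>2 \<le> W x (h x)"
          unfolding W_def 2 using 1 by simp
        moreover have "b * (norm x)\<^sup>2 \<le> a / 2 * (norm (P x))\<^sup>2 + 1 * (norm (l x))\<^sup>2"
          by (rule b_le) (auto simp: min_def)
        ultimately show ?thesis by (simp add: h_def)
      qed
      have neg: "W x x \<le> - b * (norm x)\<^sup>2"
        if x: "x \<in> T" and r: "\<forall>r\<in>insert (Re \<mu>) L. r < \<beta>" for x
      proof -
        have "V (P x) (P x) \<le> - a * (norm (P x))\<^sup>2" using V(5)[OF _ PT[OF x]] r by blast
        moreover have "sgn (Re \<mu> - \<beta>) = -1" using r by simp
        moreover have "b * (norm x)\<^sup>2 \<le> a * (norm (P x))\<^sup>2 + s * (norm (l x))\<^sup>2"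
          using V(3) by (intro b_le) auto
        ultimately show ?thesis by (simp add: W_def dot_square_norm)
      qed
      show ?thesis
        using bW V(2) b pos neg by (intro exI[of _ W] exI[of _ b]) (auto simp: W_def inner_commute)
    qed
    show ?thesis
      using L(1,2) \<mu> V ev by (intro exI[of _ "insert (Re \<mu>) L"]) (auto, blast)
  qed
qed

lemma Hurwitz_lyapunov_form:
  fixes f :: "real ^ 'k \<Rightarrow> real ^ 'k"
  assumes f: "linear f" and T: "subspace T" "f ` T \<subseteq> T" and H: "Hurwitz_on T f"
  shows "\<exists>V a. bounded_bilinear V \<and> (\<forall>x y. V x y = V y x) \<and> (0::real) < a \<and>
    (\<forall>x\<in>T. a * (norm x)\<^sup>2 \<le> V x (f x)) \<and> (\<forall>x\<in>T. V x x \<le> - a * (norm x)\<^sup>2)"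
proof -
  obtain S where S: "\<forall>s\<in>S. \<exists>\<mu>. eigenvalue_on T f \<mu> \<and> Re \<mu> = s"
    "\<forall>\<beta>. \<beta> \<notin> S \<longrightarrow> (\<exists>V a. bounded_bilinear V \<and> (\<forall>x y. V x y = V y x) \<and> (0::real) < a \<and>
        (\<forall>x\<in>T. a * (norm x)\<^sup>2 \<le> V x (f x - \<beta> *\<^sub>R x)) \<and>
        ((\<forall>s\<in>S. s < \<beta>) \<longrightarrow> (\<forall>x\<in>T. V x x \<le> - a * (norm x)\<^sup>2)))"
    using lyapunov_form_exists[OF f T] by (elim exE conjE)
  have neg: "\<forall>s\<in>S. s < 0"
  proof
    fix s assume "s \<in> S"
    with S(1) obtain \<mu> where "eigenvalue_on T f \<mu>" "Re \<mu> = s" by blast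
    then show "s < 0" using H unfolding Hurwitz_on_def by blast
  qed
  then have "0 \<notin> S" by blast
  obtain V a where V: "bounded_bilinear V" "\<forall>x y. V x y = V y x" "(0::real) < a"
      "\<forall>x\<in>T. a * (norm x)\<^sup>2 \<le> V x (f x - 0 *\<^sub>R x)"
      "(\<forall>s\<in>S. s < 0) \<longrightarrow> (\<forall>x\<in>T. V x x \<le> - a * (norm x)\<^sup>2)"
    using mp[OF spec[OF S(2)] \<open>0 \<notin> S\<close>] by (elim exE conjE)
  have "\<forall>x\<in>T. V x x \<le> - a * (norm x)\<^sup>2" by (rule mp[OF V(5) neg])
  moreover have "\<forall>x\<in>T. a * (norm x)\<^sup>2 \<le> V x (f x)" using V(4) by simp
  ultimately show ?thesis using V(1,2,3) by (intro exI[of _ V]) (rule exI[of _ a], intro conjI)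
qed

text \<open>Only finitely many shifts are excluded, so one in \<open>(-c, 0)\<close> is available. The form is positive
  somewhere because on an eigenvector \<open>u + \<i> v\<close> its increase equals
  \<open>(Re \<mu> + \<beta>) (V u u + V v v)\<close>.\<close>

lemma unstable_lyapunov_form:
  fixes f :: "real ^ 'k \<Rightarrow> real ^ 'k"
  assumes f: "linear f" and T: "subspace T" "f ` T \<subseteq> T"
    and \<mu>: "eigenvalue_on T f \<mu>" "0 \<le> Re \<mu>" and c: "0 < c"
  shows "\<exists>\<beta> V a x. 0 < \<beta> \<and> \<beta> < c \<and> bounded_bilinear V \<and> (\<forall>x y. V x y = V y x) \<and> (0::real) < a \<and>
    (\<forall>x\<in>T. a * (norm x)\<^sup>2 \<le> V x (f x - (- \<beta>) *\<^sub>R x)) \<and> x \<in> T \<and> 0 < V x x"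
proof -
  obtain S where S: "finite S"
    "\<forall>\<beta>. \<beta> \<notin> S \<longrightarrow> (\<exists>V a. bounded_bilinear V \<and> (\<forall>x y. V x y = V y x) \<and> (0::real) < a \<and>
        (\<forall>x\<in>T. a * (norm x)\<^sup>2 \<le> V x (f x - \<beta> *\<^sub>R x)) \<and>
        ((\<forall>s\<in>S. s < \<beta>) \<longrightarrow> (\<forall>x\<in>T. V x x \<le> - a * (norm x)\<^sup>2)))"
    using lyapunov_form_exists[OF f T] by (elim exE conjE)
  have "infinite {-c<..<0}" using c by simp
  then have "\<not> {-c<..<0} \<subseteq> S" using S(1) finite_subset by blast
  then obtain \<beta>' where "\<beta>' \<in> {-c<..<0}" and notin: "\<beta>' \<notin> S" by blast
  then have \<beta>': "- c < \<beta>'" "\<beta>' < 0" by simp_all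
  obtain V a where V: "bounded_bilinear V" "\<forall>x y. V x y = V y x" "(0::real) < a"
      "\<forall>x\<in>T. a * (norm x)\<^sup>2 \<le> V x (f x - \<beta>' *\<^sub>R x)"
    using mp[OF spec[OF S(2)] notin] by (elim exE conjE)
  interpret V: bounded_bilinear V by fact
  obtain u v where uv: "u \<in> T" "v \<in> T" "u \<noteq> 0 \<or> v \<noteq> 0"
     "f u = Re \<mu> *\<^sub>R u - Im \<mu> *\<^sub>R v" "f v = Im \<mu> *\<^sub>R u + Re \<mu> *\<^sub>R v"
    using \<mu>(1) unfolding eigenvalue_on_iff by blast
  have "V u (f u - \<beta>' *\<^sub>R u) + V v (f v - \<beta>' *\<^sub>R v) = (Re \<mu> - \<beta>') * (V u u + V v v)"
    using V(2)[rule_format, of u v]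
    by (simp add: uv(4,5) V.diff_right V.add_right V.scaleR_right algebra_simps)
  moreover have "a * (norm u)\<^sup>2 + a * (norm v)\<^sup>2 \<le> V u (f u - \<beta>' *\<^sub>R u) + V v (f v - \<beta>' *\<^sub>R v)"
    by (intro add_mono bspec[OF V(4)] uv(1,2))
  moreover have "0 < a * (norm u)\<^sup>2 + a * (norm v)\<^sup>2"
    using uv(3) V(3) by (auto intro: add_pos_nonneg add_nonneg_pos)
  ultimately have "0 < (Re \<mu> - \<beta>') * (V u u + V v v)" by linarith
  moreover have "0 < Re \<mu> - \<beta>'" using \<mu>(2) \<beta>' by linarith
  ultimately have "0 < V u u + V v v" by (simp add: zero_less_mult_iff)
  then have "0 < V u u \<or> 0 < V v v" by linarith
  then obtain x where x: "x \<in> T" "0 < V x x" using uv(1,2) by blast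
  have "\<forall>x\<in>T. a * (norm x)\<^sup>2 \<le> V x (f x - (- (- \<beta>')) *\<^sub>R x)" using V(4) by simp
  then show ?thesis
    using V(1,2,3) x \<beta>'(1,2)
    by (rule_tac exI[of _ "- \<beta>'"], rule_tac exI[of _ V], rule_tac exI[of _ a], rule_tac exI[of _ x]) simp
qed

lemma positive_form_imp_Hurwitz:
  fixes f :: "real ^ 'k \<Rightarrow> real ^ 'k"
  assumes "\<And>v. v \<in> T \<Longrightarrow> v \<noteq> 0 \<Longrightarrow> 0 < v \<bullet> f v"
  shows "Hurwitz_on T (\<lambda>v. - f v)"
  unfolding Hurwitz_on_def
proof (intro allI impI)
  fix \<mu> assume "eigenvalue_on T (\<lambda>v. - f v) \<mu>"
  then obtain u v where uv: "u \<in> T" "v \<in> T" "u \<noteq> 0 \<or> v \<noteq> 0"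
     "- f u = Re \<mu> *\<^sub>R u - Im \<mu> *\<^sub>R v" "- f v = Im \<mu> *\<^sub>R u + Re \<mu> *\<^sub>R v"
    unfolding eigenvalue_on_iff by blast
  have nonneg: "0 \<le> w \<bullet> f w" if "w \<in> T" for w
    using assms[OF that] by (cases "w = 0") auto
  have "0 < u \<bullet> f u + v \<bullet> f v"
  proof (cases "u = 0")
    case True
    then show ?thesis using uv(3) assms[OF uv(2)] by simp
  next
    case False
    then show ?thesis using assms[OF uv(1)] nonneg[OF uv(2)] by linarith
  qed
  moreover have "u \<bullet> (- f u) + v \<bullet> (- f v) = Re \<mu> * (u \<bullet> u + v \<bullet> v)"
    unfolding uv(4,5) by (simp add: inner_diff_right inner_add_right inner_commute[of u v] algebra_simps)
  ultimately have "Re \<mu> * (u \<bullet> u + v \<bullet> v) < 0" by simp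
  then show "Re \<mu> < 0" by (simp add: mult_less_0_iff not_less add_nonneg_nonneg) (smt (verit) inner_ge_zero)
qed

section \<open>Ordinary differential equations and quadratic Lyapunov functions\<close>

lemma truncated_integral_lipschitz:
  fixes f :: "real \<Rightarrow> 'x::euclidean_space"
  assumes f: "continuous_on UNIV f" and M: "\<And>s. norm (f s) \<le> M"
  shows "norm (integral {0..max 0 t} f - integral {0..max 0 s} f) \<le> M * \<bar>t - s\<bar>"
proof -
  have "norm (integral {0..max 0 t} f - integral {0..max 0 s} f) \<le> M * (t - s)" if "s \<le> t" for s t
  proof -
    have int: "f integrable_on {0..max 0 t}"
      using f by (intro integrable_continuous_real) (blast intro: continuous_on_subset)
    have "integral {0..max 0 s} f + integral {max 0 s..max 0 t} f = integral {0..max 0 t} f"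
      using that by (intro Henstock_Kurzweil_Integration.integral_combine int) auto
    then have "integral {0..max 0 t} f - integral {0..max 0 s} f = integral {max 0 s..max 0 t} f"
      by (simp add: algebra_simps)
    also have "norm \<dots> \<le> M * (max 0 t - max 0 s)"
      using that M by (intro integral_bound) (auto intro: continuous_on_subset[OF f])
    also have "\<dots> \<le> M * (t - s)"
      using that order_trans[OF norm_ge_zero M[of 0]] by (intro mult_left_mono) auto
    finally show ?thesis .
  qed
  from this[of s t] this[of t s] show ?thesis
    by (cases "s \<le> t") (auto simp: norm_minus_commute)
qed

text \<open>Write a solution as \<open>x\<^sub>0 + exp (\<lambda> t) u(t)\<close>. In terms of the bounded continuous function \<open>u\<close> the
  integral equation is a contraction with constant \<open>L / \<lambda>\<close>, so a single application of Banach's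
  fixed point theorem gives the solution for all times. Boundedness of \<open>G\<close> keeps \<open>u\<close> bounded.\<close>

lemma global_solution_exists:
  fixes G :: "'x::euclidean_space \<Rightarrow> 'x"
  assumes lip: "L-lipschitz_on UNIV G" and M: "\<And>x. norm (G x) \<le> M"
  obtains p where "p 0 = x0" "continuous_on {0..} p"
    "\<And>t. 0 \<le> t \<Longrightarrow> (p has_vector_derivative G (p t)) (at t within {0..})"
proof -
  define lam where "lam = L + 1"
  have L: "0 \<le> L" using lip by (rule lipschitz_on_nonneg)
  have lam: "0 < lam" using L by (simp add: lam_def)
  have M0: "0 \<le> M" using order_trans[OF norm_ge_zero M] by blast
  have contG: "continuous_on UNIV G" using lip by (rule lipschitz_on_continuous_on)
  define g where "g = (\<lambda>(u :: real \<Rightarrow>\<^sub>C 'x) s. G (x0 + exp (lam * s) *\<^sub>R u s))"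
  have gc: "continuous_on UNIV (g u)" for u
    unfolding g_def by (intro continuous_on_compose2[OF contG] continuous_intros) auto
  have gM: "norm (g u s) \<le> M" for u s using M by (simp add: g_def)
  define J where "J = (\<lambda>u t. integral {0..max 0 t} (g u))"
  have Jlip: "norm (J u t - J u s) \<le> M * \<bar>t - s\<bar>" for u s t
    unfolding J_def by (rule truncated_integral_lipschitz[OF gc gM])
  have Jc: "continuous_on UNIV (J u)" for u
    by (rule lipschitz_on_continuous_on[where L = M], rule lipschitz_onI)
      (use Jlip M0 in \<open>auto simp: dist_norm\<close>)
  define \<Phi> where "\<Phi> = (\<lambda>u t. exp (- (lam * max 0 t)) *\<^sub>R J u t)"
  have Phi_in: "\<Phi> u \<in> bcontfun" for u
    unfolding bcontfun_def mem_Collect_eq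
  proof
    have c: "continuous_on UNIV (\<lambda>t::real. exp (- (lam * max 0 t)))"
      by (intro continuous_intros continuous_on_max)
    show "continuous_on UNIV (\<Phi> u)" unfolding \<Phi>_def
      by (intro continuous_on_scaleR c Jc)
    have "norm (\<Phi> u t) \<le> M / lam" for t
    proof -
      have "norm (J u t) \<le> M * max 0 t"
        using Jlip[of u "max 0 t" 0] by (simp add: J_def)
      also have "\<dots> \<le> M * (exp (lam * max 0 t) / lam)"
      proof (intro mult_left_mono M0)
        have "lam * max 0 t \<le> exp (lam * max 0 t)"
          using exp_ge_add_one_self[of "lam * max 0 t"] by linarith
        then show "max 0 t \<le> exp (lam * max 0 t) / lam" 
          using lam by (subst pos_le_divide_eq) (simp_all only: mult.commute)
      qed
      finally have "exp (- (lam * max 0 t)) * norm (J u t)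
          \<le> exp (- (lam * max 0 t)) * (M * (exp (lam * max 0 t) / lam))"
        by (intro mult_left_mono) auto
      then show ?thesis by (simp add: \<Phi>_def exp_minus field_simps)
    qed
    then show "bounded (range (\<Phi> u))" by (auto simp: bounded_iff)
  qed
  have contr: "dist (Bcontfun (\<Phi> u)) (Bcontfun (\<Phi> v)) \<le> L / lam * dist u v" for u v
  proof (rule dist_bound)
    fix t :: real
    define \<tau> where "\<tau> = max 0 t"
    have \<tau>: "0 \<le> \<tau>" by (simp add: \<tau>_def)
    have int: "g w integrable_on {0..\<tau>}" for w
      by (intro integrable_continuous_real) (blast intro: continuous_on_subset gc)
    have pe: "((\<lambda>s. L * dist u v * exp (lam * s)) has_integral
        L * dist u v * (exp (lam * \<tau>) / lam) - L * dist u v * (exp (lam * 0) / lam)) {0..\<tau>}"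
      using lam \<tau> by (intro fundamental_theorem_of_calculus)
        (auto intro!: derivative_eq_intros simp flip: has_real_derivative_iff_has_vector_derivative)
    have "norm (J u t - J v t) = norm (integral {0..\<tau>} (\<lambda>s. g u s - g v s))"
      by (simp add: J_def \<tau>_def[symmetric] Henstock_Kurzweil_Integration.integral_diff[OF int int])
    also have "\<dots> \<le> integral {0..\<tau>} (\<lambda>s. L * dist u v * exp (lam * s))"
    proof (rule integral_norm_bound_integral)
      show "(\<lambda>s. g u s - g v s) integrable_on {0..\<tau>}" by (intro integrable_diff int)
      show "(\<lambda>s. L * dist u v * exp (lam * s)) integrable_on {0..\<tau>}" using pe by blast
      fix s
      have "norm (g u s - g v s) \<le> L * norm (exp (lam * s) *\<^sub>R u s - exp (lam * s) *\<^sub>R v s)"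
        unfolding g_def
        using lipschitz_on_normD[OF lip, of "x0 + exp (lam * s) *\<^sub>R u s" "x0 + exp (lam * s) *\<^sub>R v s"] by simp
      also have "\<dots> = L * (exp (lam * s) * dist (u s) (v s))"
        by (simp add: dist_norm flip: scaleR_diff_right)
      also have "\<dots> \<le> L * (exp (lam * s) * dist u v)"
        using L by (intro mult_left_mono dist_bounded) auto
      finally show "norm (g u s - g v s) \<le> L * dist u v * exp (lam * s)" by (simp add: mult_ac)
    qed
    also have "\<dots> \<le> L * dist u v * (exp (lam * \<tau>) / lam)"
      unfolding integral_unique[OF pe] using L lam by simp
    finally have "exp (- (lam * \<tau>)) * norm (J u t - J v t)
        \<le> exp (- (lam * \<tau>)) * (L * dist u v * (exp (lam * \<tau>) / lam))"
      by (intro mult_left_mono) auto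
    also have "\<dots> = L / lam * dist u v" by (simp add: exp_minus field_simps)
    finally show "dist (Bcontfun (\<Phi> u) t) (Bcontfun (\<Phi> v) t) \<le> L / lam * dist u v"
      unfolding Bcontfun_inverse[OF Phi_in]
      by (simp add: \<Phi>_def \<tau>_def dist_norm flip: scaleR_diff_right)
  qed
  have "\<exists>!u. Bcontfun (\<Phi> u) = u"
    by (rule banach_fix_type[of "L / lam"]) (use contr L lam in \<open>auto simp: lam_def\<close>)
  then obtain u where u: "Bcontfun (\<Phi> u) = u" by blast
  define p where "p = (\<lambda>t. x0 + exp (lam * t) *\<^sub>R u t)"
  have uPhi: "apply_bcontfun u = \<Phi> u" using Bcontfun_inverse[OF Phi_in, of u] u by simp
  have p_eq: "p t = x0 + integral {0..t} (g u)" if "0 \<le> t" for t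
    using that by (simp add: p_def uPhi \<Phi>_def J_def exp_minus)
  have der: "(p has_vector_derivative G (p t)) (at t within {0..})" if t: "0 \<le> t" for t
  proof -
    have "((\<lambda>s. integral {0..s} (g u)) has_vector_derivative g u t) (at t within {0..t + 1})"
      using t by (intro integral_has_vector_derivative continuous_on_subset[OF gc]) auto
    then have "((\<lambda>s. x0 + integral {0..s} (g u)) has_vector_derivative g u t) (at t within {0..t + 1})"
      by (auto intro!: derivative_eq_intros)
    moreover have "at t within {0..t + 1} = at t within {0..}"
      by (rule at_within_nhd[of t "{..<t + 1}"]) auto
    ultimately have "((\<lambda>s. x0 + integral {0..s} (g u)) has_vector_derivative g u t) (at t within {0..})"
      by simp
    moreover have "g u t = G (p t)" by (simp add: g_def p_def)
    ultimately show ?thesis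
      using has_vector_derivative_transform[of t "{0..}" p "\<lambda>s. x0 + integral {0..s} (g u)"] p_eq t
      by auto
  qed
  show thesis
  proof (rule that[of p])
    show "p 0 = x0" using p_eq[of 0] by simp
    show "continuous_on {0..} p"
      using der by (auto simp: continuous_on_eq_continuous_within intro: has_vector_derivative_continuous)
  qed (use der in auto)
qed

text \<open>Consider the first time at which the curve is outside \<open>B\<close>.\<close>

lemma continuous_stays_in_open:
  fixes p :: "real \<Rightarrow> 'x::metric_space"
  assumes p: "continuous_on {0..} p" and B: "open B"
    and step: "\<And>t. 0 \<le> t \<Longrightarrow> t \<le> r \<Longrightarrow> (\<And>s. 0 \<le> s \<Longrightarrow> s < t \<Longrightarrow> p s \<in> B) \<Longrightarrow> p t \<in> B"
    and t: "0 \<le> t" "t \<le> r"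
  shows "p t \<in> B"
proof (rule ccontr)
  assume "p t \<notin> B"
  define S where "S = {0..} \<inter> p -` (- B)"
  have S: "closed S"
    unfolding S_def using p B by (intro continuous_closed_preimage) auto
  have tS: "t \<in> S" using t \<open>p t \<notin> B\<close> by (simp add: S_def)
  have bb: "bdd_below S" by (auto simp: S_def bdd_below_def)
  have inS: "Inf S \<in> S" using S tS bb by (intro closed_contains_Inf) auto
  have le: "Inf S \<le> s" if "s \<in> S" for s using that bb by (rule cInf_lower)
  have "p (Inf S) \<in> B"
  proof (rule step)
    show "0 \<le> Inf S" using inS by (simp add: S_def)
    show "Inf S \<le> r" using le[OF tS] t by simp
    show "p s \<in> B" if "0 \<le> s" "s < Inf S" for s
      using le[of s] that by (auto simp: S_def)
  qed
  with inS show False by (simp add: S_def)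
qed

text \<open>The equation is required only while the curve is inside \<open>B\<close>. In this way solutions of a vector
  field that was modified outside \<open>B\<close>, and trajectories not yet known to remain in \<open>B\<close>, are
  treated alike.\<close>

definition solves_in :: "'x set \<Rightarrow> ('x \<Rightarrow> 'x) \<Rightarrow> (real \<Rightarrow> 'x::real_normed_vector) \<Rightarrow> bool" where
  "solves_in B G p \<longleftrightarrow> continuous_on {0..} p \<and>
     (\<forall>t\<ge>0. p t \<in> B \<longrightarrow> (p has_vector_derivative G (p t)) (at t within {0..}))"

lemma solves_in_subset: "solves_in B G p \<Longrightarrow> B' \<subseteq> B \<Longrightarrow> solves_in B' G p"
  by (auto simp: solves_in_def)

text \<open>The derivative of \<open>exp (2 \<kappa> t) V(w, w)\<close> is nonpositive. As \<open>V\<close> may be indefinite and \<open>\<kappa>\<close> negative, the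
  lemma serves for decay of the error, for Gronwall's estimate (\<open>V\<close> the inner product, \<open>\<kappa>\<close>
  negative), and for the growth estimate that refutes stability (\<open>- V\<close> in place of \<open>V\<close>).\<close>

lemma form_decay:
  fixes w :: "'x::euclidean_space \<Rightarrow> 'y::euclidean_space" and V :: "'y \<Rightarrow> 'y \<Rightarrow> real"
  assumes p: "solves_in B G p" and V: "bounded_bilinear V" "\<And>x y. V x y = V y x"
    and w: "\<And>x. x \<in> B \<Longrightarrow> (w has_derivative w' x) (at x)"
    and dec: "\<And>x. x \<in> B \<Longrightarrow> V (w x) (w' x (G x)) \<le> - \<kappa> * V (w x) (w x)"
    and t: "0 \<le> t" "\<And>s. 0 \<le> s \<Longrightarrow> s \<le> t \<Longrightarrow> p s \<in> B"
  shows "V (w (p t)) (w (p t)) \<le> exp (- 2 * \<kappa> * t) * V (w (p 0)) (w (p 0))"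
proof -
  interpret V: bounded_bilinear V by fact
  define h where "h = (\<lambda>t. exp (2 * \<kappa> * t) * V (w (p t)) (w (p t)))"
  have "h t \<le> h 0"
  proof (rule DERIV_nonpos_imp_decreasing_open[OF t(1)])
    fix s assume s: "0 < s" "s < t"
    have ats: "at s within {0..} = at s"
      using s by (intro at_within_interior) auto
    have "(p has_vector_derivative G (p s)) (at s within {0..})"
      using p s t(2)[of s] by (simp add: solves_in_def)
    then have ps: "(p has_vector_derivative G (p s)) (at s)" unfolding ats .
    have ps': "(w has_derivative w' (p s)) (at (p s))" using w t(2) s by simp
    interpret w': bounded_linear "w' (p s)" using ps' by (rule has_derivative_bounded_linear)
    have "((\<lambda>t. w (p t)) has_derivative (\<lambda>x. w' (p s) (x *\<^sub>R G (p s)))) (at s)"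
      using diff_chain_at[OF ps[unfolded has_vector_derivative_def] ps'] by (simp add: o_def)
    then have wp: "((\<lambda>t. w (p t)) has_derivative (\<lambda>x. x *\<^sub>R w' (p s) (G (p s)))) (at s)"
      by (simp add: w'.scaleR)
    have "((\<lambda>t. V (w (p t)) (w (p t))) has_derivative
        (\<lambda>x. V (w (p s)) (x *\<^sub>R w' (p s) (G (p s))) + V (x *\<^sub>R w' (p s) (G (p s))) (w (p s)))) (at s)"
      by (rule V.FDERIV[OF wp wp])
    then have vd: "((\<lambda>t. V (w (p t)) (w (p t))) has_real_derivative
        2 * V (w (p s)) (w' (p s) (G (p s)))) (at s)"
      unfolding has_field_derivative_def
      by (rule has_derivative_eq_rhs) (auto simp: V.scaleR_left V.scaleR_right V(2)[of _ "w (p s)"])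
    have "(h has_real_derivative
        2 * \<kappa> * exp (2 * \<kappa> * s) * V (w (p s)) (w (p s)) +
        exp (2 * \<kappa> * s) * (2 * V (w (p s)) (w' (p s) (G (p s))))) (at s)"
      unfolding h_def by (rule derivative_eq_intros vd refl | simp)+
    moreover have "2 * \<kappa> * exp (2 * \<kappa> * s) * V (w (p s)) (w (p s)) +
        exp (2 * \<kappa> * s) * (2 * V (w (p s)) (w' (p s) (G (p s))))
      = 2 * exp (2 * \<kappa> * s) * (V (w (p s)) (w' (p s) (G (p s))) + \<kappa> * V (w (p s)) (w (p s)))"
      by (simp add: algebra_simps)
    moreover have "\<dots> \<le> 0"
      using dec[of "p s"] t(2)[of s] s by (intro mult_nonneg_nonpos) auto
    ultimately show "\<exists>y. (h has_real_derivative y) (at s) \<and> y \<le> 0" by metis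
  next
    have pc: "continuous_on {0..t} p" using p by (auto simp: solves_in_def intro: continuous_on_subset)
    have "continuous_on (p ` {0..t}) w"
      using has_derivative_continuous[OF w] t(2) by (intro continuous_at_imp_continuous_on) auto
    then have "continuous_on {0..t} (\<lambda>s. w (p s))"
      by (rule continuous_on_compose2[OF _ pc]) auto
    then show "continuous_on {0..t} h"
      unfolding h_def by (intro continuous_intros V.continuous_on)
  qed
  then have "exp (- 2 * \<kappa> * t) * h t \<le> exp (- 2 * \<kappa> * t) * h 0" by (intro mult_left_mono) auto
  moreover have "exp (- 2 * \<kappa> * t) * h t = V (w (p t)) (w (p t))"
    by (simp add: h_def mult.assoc[symmetric] exp_add[symmetric])
  moreover have "h 0 = V (w (p 0)) (w (p 0))" by (simp add: h_def)
  ultimately show ?thesis by (simp only:)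
qed

lemma exponential_increments:
  fixes p :: "real \<Rightarrow> 'x::euclidean_space"
  assumes p: "solves_in B G p" and \<kappa>: "0 < \<kappa>" and st: "0 \<le> s" "s \<le> t"
    and B: "\<And>r. 0 \<le> r \<Longrightarrow> r < t \<Longrightarrow> p r \<in> B"
    and bd: "\<And>r. 0 \<le> r \<Longrightarrow> r < t \<Longrightarrow> norm (G (p r)) \<le> C * exp (- \<kappa> * r)" and C: "0 \<le> C"
  shows "norm (p t - p s) \<le> C / \<kappa> * exp (- \<kappa> * s)"
proof (cases "s = t")
  case True
  then show ?thesis using C \<kappa> by simp
next
  case False
  have "norm (p t - p s) \<le> - (C / \<kappa>) * exp (- \<kappa> * t) - (- (C / \<kappa>) * exp (- \<kappa> * s))"
  proof (rule differentiable_bound_general[where f' = "\<lambda>r. G (p r)"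
        and \<phi>' = "\<lambda>r. C * exp (- \<kappa> * r)"])
    show "s < t" using False st by simp
    show "continuous_on {s..t} p"
      using p st by (auto simp: solves_in_def intro: continuous_on_subset)
    show "continuous_on {s..t} (\<lambda>r. - (C / \<kappa>) * exp (- \<kappa> * r))" by (intro continuous_intros)
    fix r assume r: "s < r" "r < t"
    have atr: "at r within {0..} = at r"
      using r st by (intro at_within_interior) auto
    have "(p has_vector_derivative G (p r)) (at r within {0..})"
      using p r st B[of r] by (simp add: solves_in_def)
    then show "(p has_vector_derivative G (p r)) (at r)" unfolding atr .
    show "((\<lambda>r. - (C / \<kappa>) * exp (- \<kappa> * r)) has_vector_derivative C * exp (- \<kappa> * r)) (at r)"
      using \<kappa> by (auto intro!: derivative_eq_intros
          simp flip: has_real_derivative_iff_has_vector_derivative)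
    show "norm (G (p r)) \<le> C * exp (- \<kappa> * r)" using bd r st by simp
  qed
  also have "\<dots> \<le> C / \<kappa> * exp (- \<kappa> * s)" using C \<kappa> by simp
  finally show ?thesis .
qed

text \<open>Exponential decay of \<open>w\<close> bounds the speed by a multiple of \<open>exp (- \<kappa> t)\<close>, hence the remaining path
  length at each time. A start with \<open>dist c (p 0) + R norm (w (p 0)) < \<epsilon>\<close> therefore can neither leave
  the ball nor converge to a point violating the same inequality, so that the points satisfying
  it form a neighbourhood of \<open>c\<close> that also contains the limits \<open>q\<close>.\<close>

lemma exponential_convergence:
  fixes w :: "'x::euclidean_space \<Rightarrow> 'y::euclidean_space" and V :: "'y \<Rightarrow> 'y \<Rightarrow> real"
  assumes V: "bounded_bilinear V" "\<And>x y. V x y = V y x"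
    and w: "\<And>x. x \<in> ball c \<epsilon> \<Longrightarrow> (w has_derivative w' x) (at x)"
    and dec: "\<And>x. x \<in> ball c \<epsilon> \<Longrightarrow> V (w x) (w' x (G x)) \<le> - \<kappa> * V (w x) (w x)"
    and \<kappa>: "0 < \<kappa>" and b: "0 < b" "\<And>x. x \<in> ball c \<epsilon> \<Longrightarrow> b * (norm (w x))\<^sup>2 \<le> V (w x) (w x)"
    and M: "0 \<le> M" "\<And>x. x \<in> ball c \<epsilon> \<Longrightarrow> norm (G x) \<le> M * norm (w x)"
  obtains R where "0 < R" "\<And>p. solves_in (ball c \<epsilon>) G p \<Longrightarrow> dist c (p 0) + R * norm (w (p 0)) < \<epsilon> \<Longrightarrow>
    (\<forall>t\<ge>0. p t \<in> ball c \<epsilon>) \<and>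
    (\<exists>q. dist c q \<le> dist c (p 0) + R * norm (w (p 0)) \<and> w q = 0 \<and>
      (\<forall>t\<ge>0. norm (p t - q) \<le> R * norm (w (p 0)) * exp (- \<kappa> * t)))"
proof -
  interpret V: bounded_bilinear V by fact
  obtain D where D: "0 < D" "\<And>x y. \<bar>V x y\<bar> \<le> norm x * norm y * D"
    using V.pos_bounded by auto
  define K where "K = sqrt (D / b)"
  have K: "0 < K" using D(1) b(1) by (simp add: K_def)
  \<comment> \<open>The path length is at most \<open>M K / \<kappa>\<close> times the initial value of \<open>norm (w (p 0))\<close>; the \<open>1\<close> makes \<open>R\<close> positive even if \<open>M = 0\<close>.\<close>
  define R where "R = M * K / \<kappa> + 1"
  have R: "0 < R" using M(1) K \<kappa> by (auto simp: R_def intro!: add_nonneg_pos)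
  let ?B = "ball c \<epsilon>"
  show thesis
  proof (rule that[OF R])
    fix p assume p: "solves_in ?B G p" and start: "dist c (p 0) + R * norm (w (p 0)) < \<epsilon>"
    let ?w0 = "norm (w (p 0))"
    have pc: "continuous_on {0..} p" using p by (simp add: solves_in_def)
    have wdec: "norm (w (p t)) \<le> K * ?w0 * exp (- \<kappa> * t)"
      if t: "0 \<le> t" "\<And>s. 0 \<le> s \<Longrightarrow> s \<le> t \<Longrightarrow> p s \<in> ?B" for t
    proof -
      have "b * (norm (w (p t)))\<^sup>2 \<le> V (w (p t)) (w (p t))" using b(2) t by simp
      also have "\<dots> \<le> exp (- 2 * \<kappa> * t) * V (w (p 0)) (w (p 0))"
        by (rule form_decay[OF p V w dec t])
      also have "\<dots> \<le> exp (- 2 * \<kappa> * t) * (?w0 * ?w0 * D)"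
        using D(2)[of "w (p 0)" "w (p 0)"] by (intro mult_left_mono) auto
      also have "\<dots> = b * (K * ?w0 * exp (- \<kappa> * t))\<^sup>2"
      proof -
        have "(exp (- \<kappa> * t))\<^sup>2 = exp (- 2 * \<kappa> * t)"
          by (simp add: power2_eq_square flip: exp_add)
        then show ?thesis
          using D(1) b(1) by (simp add: K_def power_mult_distrib) (simp add: power2_eq_square)
      qed
      finally have "(norm (w (p t)))\<^sup>2 \<le> (K * ?w0 * exp (- \<kappa> * t))\<^sup>2" using b(1) by simp
      then show ?thesis using K by (rule_tac power2_le_imp_le) auto
    qed
    have incr: "norm (p t - p s) \<le> R * ?w0 * exp (- \<kappa> * s)"
      if st: "0 \<le> s" "s \<le> t" "\<And>r. 0 \<le> r \<Longrightarrow> r < t \<Longrightarrow> p r \<in> ?B" for s t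
    proof -
      have "norm (p t - p s) \<le> (M * (K * ?w0)) / \<kappa> * exp (- \<kappa> * s)"
      proof (rule exponential_increments[OF p \<kappa> st])
        fix r assume r: "0 \<le> r" "r < t"
        have "norm (G (p r)) \<le> M * norm (w (p r))" using M(2) st(3) r by blast
        also have "\<dots> \<le> M * (K * ?w0 * exp (- \<kappa> * r))"
          using r st(3) M(1) by (intro mult_left_mono wdec) auto
        finally show "norm (G (p r)) \<le> M * (K * ?w0) * exp (- \<kappa> * r)" by (simp add: mult_ac)
      qed (use M K in auto)
      also have "\<dots> = (M * K / \<kappa>) * ?w0 * exp (- \<kappa> * s)" by simp
      also have "\<dots> \<le> R * ?w0 * exp (- \<kappa> * s)" by (intro mult_right_mono) (auto simp: R_def)
      finally show ?thesis .
    qed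
    have stay: "p t \<in> ?B" if "0 \<le> t" for t
    proof (rule continuous_stays_in_open[OF pc open_ball _ that order_refl])
      fix s :: real assume s: "0 \<le> s" and in_ball: "\<And>r. 0 \<le> r \<Longrightarrow> r < s \<Longrightarrow> p r \<in> ?B"
      have "dist c (p s) \<le> dist c (p 0) + norm (p s - p 0)"
        using dist_triangle[of c "p s" "p 0"] by (simp add: dist_norm norm_minus_commute)
      also have "\<dots> \<le> dist c (p 0) + R * ?w0"
        using incr[of 0 s] s in_ball by simp
      finally show "p s \<in> ?B" using start by simp
    qed
    define X where "X = (\<lambda>n. p (real n))"
    have elim0: "(\<lambda>n. R * ?w0 * exp (- \<kappa> * real n)) \<longlonglongrightarrow> 0"
    proof -
      have "(\<lambda>n. exp (- \<kappa>) ^ n) \<longlonglongrightarrow> 0" using \<kappa> by (intro LIMSEQ_power_zero) auto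
      then have "(\<lambda>n. exp (- \<kappa> * real n)) \<longlonglongrightarrow> 0"
        by (simp add: exp_of_nat_mult[symmetric] mult.commute)
      from tendsto_mult_right_zero[OF this, of "R * ?w0"] show ?thesis by simp
    qed
    have "Cauchy X"
    proof (rule metric_CauchyI)
      fix e :: real assume e: "0 < e"
      obtain N where N: "\<And>n. n \<ge> N \<Longrightarrow> norm (R * ?w0 * exp (- \<kappa> * real n)) < e / 2"
        using LIMSEQ_D[OF elim0, of "e / 2"] e by auto
      have "dist (X m) (X n) < e" if "m \<ge> N" "n \<ge> N" for m n
      proof -
        have "dist (X k) (X N) < e / 2" if "k \<ge> N" for k
          using incr[of "real N" "real k"] that N[of N] stay by (simp add: X_def dist_norm)
        from this[OF that(1)] this[OF that(2)] show ?thesis by (metis dist_triangle_half_l dist_commute)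
      qed
      then show "\<exists>N. \<forall>m\<ge>N. \<forall>n\<ge>N. dist (X m) (X n) < e" by blast
    qed
    then obtain q where q: "X \<longlonglongrightarrow> q" using Cauchy_convergent convergent_def by blast
    have pq: "norm (p t - q) \<le> R * ?w0 * exp (- \<kappa> * t)" if t: "0 \<le> t" for t
    proof (rule tendsto_upperbound)
      show "(\<lambda>n. norm (p t - X n)) \<longlonglongrightarrow> norm (p t - q)" by (intro tendsto_intros q)
      obtain N where N: "t \<le> real N" using real_arch_simple by blast
      have "norm (p t - X n) \<le> R * ?w0 * exp (- \<kappa> * t)" if "n \<ge> N" for n
        using incr[of t "real n"] that N t stay by (simp add: X_def norm_minus_commute)
      then show "\<forall>\<^sub>F n in sequentially. norm (p t - X n) \<le> R * ?w0 * exp (- \<kappa> * t)"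
        using eventually_sequentially by blast
    qed auto
    have dq: "dist c q \<le> dist c (p 0) + R * ?w0"
      using pq[of 0] dist_triangle[of c q "p 0"] by (simp add: dist_norm)
    then have "q \<in> ?B" using start by simp
    then have "isCont w q" using w has_derivative_continuous by blast
    then have lim1: "(\<lambda>n. w (X n)) \<longlonglongrightarrow> w q" using q by (simp add: isCont_tendsto_compose)
    have "w q = 0"
    proof -
      have "(\<lambda>n. K / R * (R * ?w0 * exp (- \<kappa> * real n))) \<longlonglongrightarrow> 0"
        by (rule tendsto_mult_right_zero[OF elim0])
      moreover have "norm (w (X n)) \<le> K / R * (R * ?w0 * exp (- \<kappa> * real n))" for n
        using wdec[of "real n"] stay R by (simp add: X_def)
      ultimately have "(\<lambda>n. w (X n)) \<longlonglongrightarrow> 0"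
        by (intro tendsto_0_le[where K = 1 and g = "\<lambda>n. w (X n)"]) 
          (auto simp: intro!: always_eventually order_trans[OF _ abs_ge_self])
      then show ?thesis using lim1 LIMSEQ_unique by blast
    qed
    then show "(\<forall>t\<ge>0. p t \<in> ?B) \<and> (\<exists>q. dist c q \<le> dist c (p 0) + R * ?w0 \<and> w q = 0 \<and>
      (\<forall>t\<ge>0. norm (p t - q) \<le> R * ?w0 * exp (- \<kappa> * t)))"
      using stay dq pq by blast
  qed
qed

lemma exp_eventually_small:
  fixes C k e :: real
  assumes k: "0 < k" and e: "0 < e"
  shows "\<exists>t\<ge>0. C * exp (- k * t) < e"
proof (cases "0 < C")
  case False
  then have "C * exp (- k * 0) < e" using e by simp
  then show ?thesis by (intro exI[of _ 0]) simp
next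
  case True
  define t where "t = max 0 ((ln (C / e) + 1) / k)"
  have "ln (C / e) + 1 \<le> k * t"
  proof -
    have "(ln (C / e) + 1) / k \<le> t" by (simp add: t_def)
    then show ?thesis using k by (simp add: pos_divide_le_eq mult.commute)
  qed
  then have "exp (- k * t) < exp (- ln (C / e))" by (subst exp_less_cancel_iff) linarith
  also have "\<dots> = e / C" using True e by (simp add: exp_minus)
  finally have "C * exp (- k * t) < e" using True by (simp add: pos_less_divide_eq mult.commute)
  moreover have "0 \<le> t" by (simp add: t_def)
  ultimately show ?thesis by blast
qed

text \<open>Gronwall's estimate, applied up to the first exit time from the ball.\<close>

lemma solution_near_equilibrium:
  fixes G :: "'x::euclidean_space \<Rightarrow> 'x"
  assumes G: "\<And>x. x \<in> ball c \<epsilon> \<Longrightarrow> norm (G x) \<le> L * dist c x"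
    and p: "solves_in (ball c \<epsilon>) G p" and L: "0 \<le> L" and r: "0 \<le> r"
    and start: "exp (L * r) * dist c (p 0) < \<epsilon>"
    and t: "0 \<le> t" "t \<le> r"
  shows "dist c (p t) \<le> exp (L * r) * dist c (p 0)"
proof -
  let ?B = "ball c \<epsilon>"
  have est: "dist c (p t) \<le> exp (L * r) * dist c (p 0)"
    if t: "0 \<le> t" "t \<le> r" "\<And>s. 0 \<le> s \<Longrightarrow> s \<le> t \<Longrightarrow> p s \<in> ?B" for t
  proof -
    have "(p t - c) \<bullet> (p t - c) \<le> exp (- 2 * (- L) * t) * ((p 0 - c) \<bullet> (p 0 - c))"
    proof (rule form_decay[OF p bounded_bilinear_inner inner_commute _ _ t(1,3)])
      show "((\<lambda>x. x - c) has_derivative (\<lambda>h. h)) (at x)" for x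
        by (auto intro!: derivative_eq_intros)
      fix x assume x: "x \<in> ?B"
      have "(x - c) \<bullet> G x \<le> norm (x - c) * norm (G x)" by (rule norm_cauchy_schwarz)
      also have "\<dots> \<le> norm (x - c) * (L * dist c x)" using G[OF x] by (intro mult_left_mono) auto
      finally show "(x - c) \<bullet> G x \<le> - (- L) * ((x - c) \<bullet> (x - c))"
        by (simp add: dist_norm norm_minus_commute[of c] dot_square_norm power2_eq_square mult_ac)
    qed
    also have "\<dots> = (exp (L * t) * dist c (p 0))\<^sup>2"
      by (simp add: dist_norm norm_minus_commute dot_square_norm power_mult_distrib
          flip: exp_of_nat_mult)
    finally have "(dist c (p t))\<^sup>2 \<le> (exp (L * t) * dist c (p 0))\<^sup>2"
      by (simp add: dist_norm norm_minus_commute dot_square_norm)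
    then have "dist c (p t) \<le> exp (L * t) * dist c (p 0)" by (rule power2_le_imp_le) auto
    also have "\<dots> \<le> exp (L * r) * dist c (p 0)"
      using t L by (intro mult_right_mono) (auto intro: mult_left_mono)
    finally show ?thesis .
  qed
  have pc: "continuous_on {0..} p" using p by (simp add: solves_in_def)
  have "p s \<in> ?B" if s: "0 \<le> s" "s \<le> r" for s
  proof (rule continuous_stays_in_open[OF pc open_ball _ s])
    fix t assume t: "0 \<le> t" "t \<le> r" "\<And>s. 0 \<le> s \<Longrightarrow> s < t \<Longrightarrow> p s \<in> ?B"
    show "p t \<in> ?B"
    proof (cases "t = 0")
      case True
      have "1 * dist c (p 0) \<le> exp (L * r) * dist c (p 0)"
        using L r by (intro mult_right_mono) auto
      then show ?thesis using start True by simp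
    next
      case False
      have "dist c (p t) \<le> exp (L * r) * dist c (p 0)"
      proof (rule tendsto_upperbound)
        have "(p \<longlongrightarrow> p t) (at t within {0..})"
          using pc t by (auto simp: continuous_on_def)
        then have "(p \<longlongrightarrow> p t) (at t within {0..<t})" by (rule tendsto_within_subset) auto
        then show "((\<lambda>s. dist c (p s)) \<longlongrightarrow> dist c (p t)) (at t within {0..<t})" by (intro tendsto_intros)
        show "\<forall>\<^sub>F s in at t within {0..<t}. dist c (p s) \<le> exp (L * r) * dist c (p 0)"
          using est t by (auto simp: eventually_at_filter intro!: always_eventually)
        show "at t within {0..<t} \<noteq> bot"
          using False t by (simp add: at_within_eq_bot_iff)
      qed
      then show ?thesis using start by simp
    qed
  qed
  then show ?thesis using est t by simp
qed

section \<open>Smooth maps\<close>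

lemma smooth_on_imp_has_derivative:
  assumes "smooth_on A f" "a \<in> A"
  obtains W g g' where "open W" "a \<in> W" "\<And>k. C_k_on k W g" "\<And>x. x \<in> A \<inter> W \<Longrightarrow> g x = f x"
    "\<And>x. x \<in> W \<Longrightarrow> (g has_derivative g' x) (at x)"
proof -
  obtain W g where W: "open W" "a \<in> W" "\<forall>k. C_k_on k W g" "\<forall>x\<in>A \<inter> W. g x = f x"
    using assms unfolding smooth_on_def by blast
  have "C_k_on (Suc 0) W g" using W(3) by blast
  then obtain g' where "\<forall>x\<in>W. (g has_derivative g' x) (at x)" by auto
  then show thesis using W that[of W g g'] by blast
qed

lemma C_k_on_compose_line:
  fixes g :: "'a::euclidean_space \<Rightarrow> 'b::euclidean_space" and a v :: 'a
  assumes "C_k_on k W g" "\<And>t::real. t \<in> I \<Longrightarrow> a + t *\<^sub>R v \<in> W"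
  shows "C_k_on k I (\<lambda>t. g (a + t *\<^sub>R v))"
  using assms(1)
proof (induction k arbitrary: g)
  case 0
  show ?case
    using assms(2) 0 by (auto intro!: continuous_on_compose2[of W g] continuous_intros)
next
  case (Suc k)
  then obtain g' where g': "\<And>x. x \<in> W \<Longrightarrow> (g has_derivative g' x) (at x)" "\<And>u. C_k_on k W (\<lambda>x. g' x u)"
    by auto
  have "((\<lambda>t. g (a + t *\<^sub>R v)) has_derivative (\<lambda>s. g' (a + t *\<^sub>R v) (s *\<^sub>R v))) (at t)"
    if "t \<in> I" for t
    by (rule has_derivative_compose[of "\<lambda>t. a + t *\<^sub>R v" "\<lambda>s. s *\<^sub>R v"])
      (auto intro!: derivative_eq_intros g' assms(2) that)
  moreover have "C_k_on k I (\<lambda>t. g' (a + t *\<^sub>R v) (s *\<^sub>R v))" for s :: real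
    by (rule Suc.IH) (rule g')
  ultimately show ?case
    unfolding C_k_on.simps by (intro exI[of _ "\<lambda>t s. g' (a + t *\<^sub>R v) (s *\<^sub>R v)"]) blast
qed

lemma C_k_on_quadratic_curve:
  fixes a b c :: "'b::euclidean_space"
  shows "C_k_on k I (\<lambda>t::real. a + t *\<^sub>R b + t\<^sup>2 *\<^sub>R c)"
proof (induction k arbitrary: a b c)
  case 0
  show ?case by (auto intro!: continuous_intros)
next
  case (Suc k)
  have "((\<lambda>t. a + t *\<^sub>R b + t\<^sup>2 *\<^sub>R c) has_derivative
      (\<lambda>s. s *\<^sub>R b + t *\<^sub>R ((2 * s) *\<^sub>R c) + t\<^sup>2 *\<^sub>R 0)) (at t)" for t :: real
    by (auto intro!: derivative_eq_intros simp: algebra_simps)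
  then show ?case
    unfolding C_k_on.simps
    using Suc.IH[of "s *\<^sub>R b" "(2 * s) *\<^sub>R c" 0 for s]
    by (intro exI[of _ "\<lambda>t s. s *\<^sub>R b + t *\<^sub>R ((2 * s) *\<^sub>R c) + t\<^sup>2 *\<^sub>R 0"]) blast
qed

lemma C1_imp_locally_lipschitz:
  fixes g :: "'a::euclidean_space \<Rightarrow> 'b::euclidean_space"
  assumes g: "C_k_on (Suc 0) W g" and W: "open W" "a \<in> W"
  obtains r L where "0 < r" "cball a r \<subseteq> W" "L-lipschitz_on (cball a r) g"
proof -
  obtain g' where g': "\<And>x. x \<in> W \<Longrightarrow> (g has_derivative g' x) (at x)"
    "\<And>u. continuous_on W (\<lambda>x. g' x u)"
    using g by auto
  obtain r where r: "0 < r" "cball a r \<subseteq> W" using W open_contains_cball by blast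
  have "\<exists>C. \<forall>x\<in>cball a r. norm (g' x i) \<le> C" for i
  proof -
    have "compact ((\<lambda>x. g' x i) ` cball a r)"
      using g'(2) r by (intro compact_continuous_image) (auto intro: continuous_on_subset)
    then have "bounded ((\<lambda>x. g' x i) ` cball a r)" by (rule compact_imp_bounded)
    then show ?thesis by (auto simp: bounded_iff)
  qed
  then obtain C where C: "\<And>i x. x \<in> cball a r \<Longrightarrow> norm (g' x i) \<le> C i" by metis
  define L where "L = (\<Sum>i\<in>Basis. C i)"
  have a: "a \<in> cball a r" using r by simp
  have L: "0 \<le> L" unfolding L_def using order_trans[OF norm_ge_zero C[OF a]] by (intro sum_nonneg) auto
  have "onorm (g' x) \<le> L" if x: "x \<in> cball a r" for x
  proof (rule onorm_le)
    fix h
    interpret bounded_linear "g' x" using g'(1) x r by (blast intro: has_derivative_bounded_linear)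
    have "g' x h = g' x (\<Sum>i\<in>Basis. (h \<bullet> i) *\<^sub>R i)" by (simp add: euclidean_representation)
    also have "\<dots> = (\<Sum>i\<in>Basis. (h \<bullet> i) *\<^sub>R g' x i)" by (simp add: sum scaleR)
    also have "norm \<dots> \<le> (\<Sum>i\<in>Basis. norm h * C i)"
      using C[OF x] by (intro sum_norm_le) (auto intro!: mult_mono Basis_le_norm order_trans[OF norm_ge_zero])
    finally show "norm (g' x h) \<le> L * norm h" by (simp add: L_def sum_distrib_left mult.commute)
  qed
  moreover have "(g has_derivative g' x) (at x within cball a r)" if "x \<in> cball a r" for x
    using g'(1) r that has_derivative_at_withinI by blast
  ultimately have "L-lipschitz_on (cball a r) g"
    using L by (intro bounded_derivative_imp_lipschitz[where f' = g']) auto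
  then show thesis using that r by blast
qed

lemma has_vector_derivative_quotient:
  fixes f :: "real \<Rightarrow> 'a::real_normed_vector"
  assumes "(f has_vector_derivative D) (at 0)"
  shows "((\<lambda>t. (f t - f 0) /\<^sub>R t) \<longlongrightarrow> D) (at 0)"
proof (rule LIM_zero_cancel, rule tendsto_norm_zero_cancel)
  have "((\<lambda>t. norm (f t - f 0 - t *\<^sub>R D) / norm t) \<longlongrightarrow> 0) (at 0)"
    using assms unfolding has_vector_derivative_def has_derivative_at by simp
  moreover have "norm (f t - f 0 - t *\<^sub>R D) / norm t = norm ((f t - f 0) /\<^sub>R t - D)" if "t \<noteq> 0" for t
  proof -
    have "norm ((f t - f 0) /\<^sub>R t - D) = norm ((f t - f 0 - t *\<^sub>R D) /\<^sub>R t)"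
      using that by (simp add: scaleR_diff_right)
    then show ?thesis by (simp add: divide_inverse mult.commute)
  qed
  ultimately show "((\<lambda>t. norm ((f t - f 0) /\<^sub>R t - D)) \<longlongrightarrow> 0) (at 0)"
    using Lim_transform_eventually[of "\<lambda>t. norm (f t - f 0 - t *\<^sub>R D) / norm t" 0 "at 0"]
    by (simp add: eventually_at_filter)
qed

section \<open>Slice charts\<close>

text \<open>Both inclusions come from transporting curves: a curve in \<open>N\<close> is mapped into the closed set \<open>L\<close>,
  so its velocity lands in \<open>L\<close>; conversely the inverse chart turns a straight line in \<open>L\<close> into a
  smooth curve in \<open>N\<close>.\<close>

lemma slice_chart_tangent:
  assumes dif: "diffeo_on W \<phi>" and L: "subspace L" and W0: "open W0"
    and im: "\<phi> ` (W \<inter> (N \<inter> W0)) = \<phi> ` W \<inter> L" and y: "y \<in> W" "y \<in> N" "y \<in> W0"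
  obtains d d' where "(\<phi> has_derivative d) (at y)" "bounded_linear d'" "\<And>v. d' (d v) = v" "\<And>v. d (d' v) = v"
    "tangent_space N y = {v. d v \<in> L}"
proof -
  have W: "open W" "open (\<phi> ` W)" "smooth_on W \<phi>" using dif by (auto simp: diffeo_on_def)
  obtain \<psi> where \<psi>: "smooth_on (\<phi> ` W) \<psi>" "\<And>x. x \<in> W \<Longrightarrow> \<psi> (\<phi> x) = x"
    using dif by (auto simp: diffeo_on_def)
  have phi_der: "\<exists>d. (\<phi> has_derivative d) (at x)" if x: "x \<in> W" for x
  proof -
    obtain U g g' where U: "open U" "x \<in> U" "\<And>z. z \<in> W \<inter> U \<Longrightarrow> g z = \<phi> z"
      "\<And>x. x \<in> U \<Longrightarrow> (g has_derivative g' x) (at x)"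
      using smooth_on_imp_has_derivative[OF W(3) x] by metis
    have "(\<phi> has_derivative g' x) (at x)"
      by (rule has_derivative_transform_within_open[OF U(4)[OF U(2)], of "W \<inter> U"])
        (use U W x in auto)
    then show ?thesis by blast
  qed
  then obtain d where d: "(\<phi> has_derivative d) (at y)" using y by blast
  have cont: "continuous_on W \<phi>"
    using phi_der has_derivative_continuous by (intro continuous_at_imp_continuous_on) blast
  obtain U g g' where U: "open U" "\<phi> y \<in> U" "\<And>k. C_k_on k U g" "\<And>z. z \<in> \<phi> ` W \<inter> U \<Longrightarrow> g z = \<psi> z"
      "\<And>x. x \<in> U \<Longrightarrow> (g has_derivative g' x) (at x)"
    using smooth_on_imp_has_derivative[OF \<psi>(1), of "\<phi> y"] y by (metis imageI)
  define d' where "d' = g' (\<phi> y)"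
  have gder: "(g has_derivative d') (at (\<phi> y))" using U by (simp add: d'_def)
  have bd: "bounded_linear d" and bd': "bounded_linear d'"
    using d gder has_derivative_bounded_linear by blast+
  interpret d: bounded_linear d by fact
  interpret d': bounded_linear d' by fact
  have inv1: "d' (d v) = v" for v
  proof -
    have comp: "((\<lambda>x. g (\<phi> x)) has_derivative (\<lambda>v. d' (d v))) (at y)"
      using has_derivative_compose[OF d gder] .
    have op: "open (W \<inter> \<phi> -` U)" using continuous_open_preimage[OF cont W(1) U(1)] .
    have "((\<lambda>x. x) has_derivative (\<lambda>v. d' (d v))) (at y)"
      by (rule has_derivative_transform_within_open[OF comp op]) (use y U \<psi> in auto)
    then have "(\<lambda>v. d' (d v)) = (\<lambda>v. v)"
      using has_derivative_ident has_derivative_unique by blast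
    then show ?thesis by meson
  qed
  have "inj d" using inv1 by (metis injI)
  then have "surj d" using linear_injective_imp_surjective d.linear_axioms by blast
  then have inv2: "d (d' v) = v" for v using inv1 by (metis surjD)
  have "tangent_space N y \<subseteq> {v. d v \<in> L}"
  proof
    fix v assume "v \<in> tangent_space N y"
    then obtain \<gamma> and e :: real where \<gamma>: "0 < e" "\<gamma> ` {-e<..<e} \<subseteq> N" "\<gamma> 0 = y"
      "(\<gamma> has_vector_derivative v) (at 0)" by (auto simp: tangent_space_def)
    have "((\<lambda>t. \<phi> (\<gamma> t)) has_derivative (\<lambda>s. d (s *\<^sub>R v))) (at 0)"
      using has_derivative_compose[OF \<gamma>(4)[unfolded has_vector_derivative_def]] d \<gamma>(3) by blast
    then have der: "((\<lambda>t. \<phi> (\<gamma> t)) has_vector_derivative d v) (at 0)"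
      by (simp add: has_vector_derivative_def d.scaleR)
    have lim: "((\<lambda>t. (\<phi> (\<gamma> t) - \<phi> y) /\<^sub>R t) \<longlongrightarrow> d v) (at 0)"
      using has_vector_derivative_quotient[OF der] \<gamma>(3) by simp
    have "isCont \<gamma> 0" using \<gamma>(4) has_vector_derivative_continuous by blast
    then have "(\<gamma> \<longlongrightarrow> y) (at 0)" using \<gamma>(3) by (simp add: isCont_def)
    then have "\<forall>\<^sub>F t in at 0. \<gamma> t \<in> W \<inter> W0"
      by (rule topological_tendstoD) (use W W0 y in auto)
    moreover have "\<forall>\<^sub>F t in at 0. t \<in> {-e<..<e}"
      using \<gamma>(1) by (intro eventually_at_in_open') auto
    ultimately have "\<forall>\<^sub>F t in at 0. (\<phi> (\<gamma> t) - \<phi> y) /\<^sub>R t \<in> L"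
    proof eventually_elim
      case (elim t)
      then have "\<gamma> t \<in> N" using \<gamma>(2) by blast
      then have "\<phi> (\<gamma> t) \<in> L" "\<phi> y \<in> L" using elim im y by blast+
      then show ?case using L by (intro subspace_scale subspace_diff)
    qed
    then have "d v \<in> L"
      using lim closed_subspace[OF L] by (rule_tac Lim_in_closed_set) (auto simp: trivial_limit_at)
    then show "v \<in> {v. d v \<in> L}" by simp
  qed
  moreover have "{v. d v \<in> L} \<subseteq> tangent_space N y"
  proof
    fix v assume "v \<in> {v. d v \<in> L}"
    then have v: "d v \<in> L" by simp
    have phiL: "\<phi> y \<in> L" using im y by blast
    have "open (\<phi> ` W \<inter> U)" using W U by blast
    then have "open ((\<lambda>t::real. \<phi> y + t *\<^sub>R d v) -` (\<phi> ` W \<inter> U))"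
      by (intro open_vimage continuous_intros)
    moreover have "(0::real) \<in> (\<lambda>t. \<phi> y + t *\<^sub>R d v) -` (\<phi> ` W \<inter> U)" using y U by auto
    ultimately obtain e :: real where e: "0 < e" "ball 0 e \<subseteq> (\<lambda>t. \<phi> y + t *\<^sub>R d v) -` (\<phi> ` W \<inter> U)"
      using open_contains_ball by metis
    have line: "\<phi> y + t *\<^sub>R d v \<in> \<phi> ` W \<inter> U" if "t \<in> {-e<..<e}" for t
      using e that by (auto simp: subset_iff dist_norm)
    define \<gamma> where "\<gamma> = (\<lambda>t. g (\<phi> y + t *\<^sub>R d v))"
    have "smooth_on {-e<..<e} \<gamma>"
      unfolding smooth_on_def
    proof (intro ballI exI conjI allI)
      show "C_k_on k {-e<..<e} \<gamma>" for k
        unfolding \<gamma>_def by (rule C_k_on_compose_line[OF U(3)]) (use line in auto)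
    qed auto
    moreover have "\<gamma> ` {-e<..<e} \<subseteq> N"
    proof
      fix z assume "z \<in> \<gamma> ` {-e<..<e}"
      then obtain t where t: "t \<in> {-e<..<e}" "z = \<gamma> t" by blast
      have "\<phi> y + t *\<^sub>R d v \<in> \<phi> ` W \<inter> L"
        using line[OF t(1)] phiL v L by (simp add: subspace_add subspace_scale)
      then have "\<phi> y + t *\<^sub>R d v \<in> \<phi> ` (W \<inter> (N \<inter> W0))" by (simp only: im)
      then obtain x where x: "\<phi> y + t *\<^sub>R d v = \<phi> x" "x \<in> W \<inter> (N \<inter> W0)" by (rule imageE)
      have "\<phi> x \<in> \<phi> ` W \<inter> U" using line[OF t(1)] unfolding x(1) .
      then have "g (\<phi> x) = x" using U(4) \<psi>(2) x(2) by simp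
      then show "z \<in> N" using x t(2) by (simp add: \<gamma>_def)
    qed
    moreover have "\<gamma> 0 = y"
    proof -
      have "\<phi> y \<in> \<phi> ` W \<inter> U" using U(2) y(1) by blast
      then show ?thesis using U(4) \<psi>(2)[OF y(1)] by (simp add: \<gamma>_def)
    qed
    moreover have "(\<gamma> has_vector_derivative v) (at 0)"
    proof -
      have "((\<lambda>t. \<phi> y + t *\<^sub>R d v) has_derivative (\<lambda>s. s *\<^sub>R d v)) (at 0)"
        by (auto intro!: derivative_eq_intros)
      moreover have "(g has_derivative d') (at (\<phi> y + 0 *\<^sub>R d v))" using gder by simp
      ultimately have "(\<gamma> has_derivative (\<lambda>s. d' (s *\<^sub>R d v))) (at 0)"
        unfolding \<gamma>_def by (rule has_derivative_compose)
      then show ?thesis by (simp add: has_vector_derivative_def d'.scaleR inv1)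
    qed
    ultimately show "v \<in> tangent_space N y"
      unfolding tangent_space_def mem_Collect_eq using e(1) by (intro exI[of _ \<gamma>] exI[of _ e] conjI)
  qed
  ultimately have "tangent_space N y = {v. d v \<in> L}" by (rule subset_antisym)
  then show thesis by (rule that[OF d bd' inv1 inv2])
qed

lemma dim_linear_preimage:
  fixes d :: "'a::euclidean_space \<Rightarrow> 'a"
  assumes "(\<phi> has_derivative d) F" "\<And>v. d' (d v) = v" "\<And>v. d (d' v) = v" "subspace L"
  shows "dim {v. d v \<in> L} = dim L"
proof -
  have lin: "linear d" using has_derivative_linear[OF assms(1)] .
  have "d ` {v. d v \<in> L} = L"
    using assms(3) by (auto simp: image_iff) (metis)
  moreover have "inj_on d (span {v. d v \<in> L})"
    using assms(2) by (metis inj_on_inverseI)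
  ultimately show ?thesis using dim_image_eq[OF lin] by metis
qed

text \<open>One chart around \<open>m\<close> computes the tangent spaces at all nearby points, so they have the dimension
  of \<open>L\<close>. Differentiability of that chart at \<open>m\<close> alone shows that \<open>y - m\<close> lies in the tangent space
  up to an error \<open>o(norm (y - m))\<close>.\<close>

lemma submanifold_near_tangent_space:
  fixes N :: "'a::euclidean_space set"
  assumes W0: "open W0" "embedded_submanifold (N \<inter> W0)" and m: "m \<in> N" "m \<in> W0"
  shows "subspace (tangent_space N m)"
    and "\<exists>U. open U \<and> m \<in> U \<and> (\<forall>y\<in>N \<inter> U. subspace (tangent_space N y) \<and>
           dim (tangent_space N y) = dim (tangent_space N m))"
    and "0 < \<epsilon> \<Longrightarrow> \<exists>\<delta>>0. \<forall>y\<in>N. dist y m < \<delta> \<longrightarrow>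
           (\<exists>v\<in>tangent_space N m. norm (y - m - v) \<le> \<epsilon> * norm (y - m))"
proof -
  obtain W \<phi> L where W: "m \<in> W" "diffeo_on W \<phi>" "subspace L" "\<phi> ` (W \<inter> (N \<inter> W0)) = \<phi> ` W \<inter> L"
  proof -
    have "m \<in> N \<inter> W0" using m by simp
    with W0(2) show thesis using that unfolding embedded_submanifold_def by meson
  qed
  note chart = slice_chart_tangent[OF W(2,3) W0(1) W(4)]
  have opW: "open W" using W by (simp add: diffeo_on_def)
  have sub_dim: "subspace (tangent_space N y) \<and> dim (tangent_space N y) = dim L"
    if y: "y \<in> W" "y \<in> N" "y \<in> W0" for y
  proof -
    obtain d d' where d: "(\<phi> has_derivative d) (at y)" "bounded_linear d'" "\<And>v. d' (d v) = v" "\<And>v. d (d' v) = v"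
      "tangent_space N y = {v. d v \<in> L}" by (rule chart[OF y]) blast
    have "linear d" using has_derivative_linear[OF d(1)] .
    then have "subspace (d -` L)" using W(3) by (rule linear_subspace_vimage)
    then show ?thesis
      using dim_linear_preimage[OF d(1,3,4) W(3)] unfolding d(5) vimage_def by blast
  qed
  show "subspace (tangent_space N m)" using sub_dim W m by blast
  show "\<exists>U. open U \<and> m \<in> U \<and> (\<forall>y\<in>N \<inter> U. subspace (tangent_space N y) \<and>
           dim (tangent_space N y) = dim (tangent_space N m))"
    using sub_dim W(1) m opW W0 by (intro exI[of _ "W \<inter> W0"]) auto
  assume \<epsilon>: "0 < \<epsilon>"
  obtain d d' where d: "(\<phi> has_derivative d) (at m)" "bounded_linear d'" "\<And>v. d' (d v) = v" "\<And>v. d (d' v) = v"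
      "tangent_space N m = {v. d v \<in> L}" by (rule chart[OF W(1) m]) blast
  interpret d': bounded_linear d' by fact
  obtain B where B: "0 < B" "\<And>v. norm (d' v) \<le> norm v * B" using d'.pos_bounded by blast
  obtain \<delta>1 where \<delta>1: "0 < \<delta>1" "\<And>y. norm (y - m) < \<delta>1 \<Longrightarrow>
      norm (\<phi> y - \<phi> m - d (y - m)) \<le> \<epsilon> / B * norm (y - m)"
  proof -
    have "0 < \<epsilon> / B" using \<epsilon> B(1) by simp
    then have "\<exists>\<delta>>0. \<forall>y. norm (y - m) < \<delta> \<longrightarrow> norm (\<phi> y - \<phi> m - d (y - m)) \<le> \<epsilon> / B * norm (y - m)"
      using d(1) unfolding has_derivative_at_alt by blast
    then show thesis using that by blast
  qed
  obtain \<delta>2 where \<delta>2: "0 < \<delta>2" "ball m \<delta>2 \<subseteq> W \<inter> W0"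
    using openE[of "W \<inter> W0" m] opW W0(1) W(1) m by blast
  show "\<exists>\<delta>>0. \<forall>y\<in>N. dist y m < \<delta> \<longrightarrow>
           (\<exists>v\<in>tangent_space N m. norm (y - m - v) \<le> \<epsilon> * norm (y - m))"
  proof (intro exI[of _ "min \<delta>1 \<delta>2"] conjI ballI impI)
    show "0 < min \<delta>1 \<delta>2" using \<delta>1 \<delta>2 by simp
    fix y assume y: "y \<in> N" "dist y m < min \<delta>1 \<delta>2"
    then have "y \<in> W \<inter> W0" using \<delta>2 by (auto simp: subset_iff dist_commute)
    then have "\<phi> y \<in> \<phi> ` W \<inter> L" "\<phi> m \<in> \<phi> ` W \<inter> L" unfolding W(4)[symmetric] using W(1) y(1) m by blast+
    then have L: "\<phi> y - \<phi> m \<in> L" using W(3) by (simp add: subspace_diff)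
    let ?v = "d' (\<phi> y - \<phi> m)"
    have "?v \<in> tangent_space N m" using d L by simp
    moreover have "norm (y - m - ?v) \<le> \<epsilon> * norm (y - m)"
    proof -
      have "y - m - ?v = - d' (\<phi> y - \<phi> m - d (y - m))"
        by (simp only: d'.diff d(3)) simp
      then have "norm (y - m - ?v) \<le> norm (\<phi> y - \<phi> m - d (y - m)) * B"
        using B(2) by simp
      also have "\<dots> \<le> \<epsilon> / B * norm (y - m) * B"
        using \<delta>1(2)[of y] y(2) B by (intro mult_right_mono) (auto simp: dist_norm)
      finally show ?thesis using B by simp
    qed
    ultimately show "\<exists>v\<in>tangent_space N m. norm (y - m - v) \<le> \<epsilon> * norm (y - m)" by blast
  qed
qed

section \<open>The distance map\<close>

text \<open>Bilinearity and symmetry of \<open>(p, w) \<mapsto> R p w\<close> together with \<open>F p = R p p\<close> give all the analytic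
  properties of the distance map that are used below.\<close>

lemma bounded_bilinear_rigidity_matrix:
  "bounded_bilinear (rigidity_matrix E :: ('d::finite, 'n::{finite,linorder}) config \<Rightarrow> _)"
  unfolding bilinear_conv_bounded_bilinear[symmetric] bilinear_def
  by (auto simp: linear_iff rigidity_matrix_def vec_eq_iff algebra_simps)

lemma rigidity_matrix_component:
  "rigidity_matrix E p w $ e =
     (if e \<in> E then (p $ snd e - p $ fst e) \<bullet> (w $ snd e - w $ fst e) else 0)"
  by (simp add: rigidity_matrix_def algebra_simps)

lemma dist_map_eq_rigidity_matrix: "dist_map E p = rigidity_matrix E p p"
  by (simp add: dist_map_def vec_eq_iff rigidity_matrix_component power2_norm_eq_inner)

lemma rigidity_matrix_commute: "rigidity_matrix E p w = rigidity_matrix E w p"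
  by (simp add: vec_eq_iff rigidity_matrix_component inner_commute)

lemma dist_map_line:
  "dist_map E (p + t *\<^sub>R w) =
     dist_map E p + t *\<^sub>R (2 *\<^sub>R rigidity_matrix E p w) + t\<^sup>2 *\<^sub>R dist_map E w"
proof -
  interpret bounded_bilinear "rigidity_matrix E" by (rule bounded_bilinear_rigidity_matrix)
  show ?thesis
    by (simp add: dist_map_eq_rigidity_matrix add_left add_right scaleR_left scaleR_right
        rigidity_matrix_commute[of E w p] power2_eq_square vec_eq_iff
        distrib_left)
qed

lemma rigidity_matrix_in_edge_space: "rigidity_matrix E p w \<in> edge_space E"
  by (simp add: edge_space_def rigidity_matrix_def)

lemma dist_map_in_edge_space: "dist_map E p \<in> edge_space E"
  by (simp add: edge_space_def dist_map_def)

lemma subspace_edge_space: "subspace (edge_space E)"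
  by (auto simp: edge_space_def subspace_def)

lemma congruent_configs_imp_dist_map_eq:
  "congruent_configs p q \<Longrightarrow> dist_map E q = dist_map E p"
  unfolding congruent_configs_def dist_map_def dist_norm[symmetric] by auto

lemma range_frechet_derivative_dist_map:
  "range (frechet_derivative (dist_map E) (at p)) = range (rigidity_matrix E p)"
proof -
  interpret bounded_bilinear "rigidity_matrix E" by (rule bounded_bilinear_rigidity_matrix)
  have "frechet_derivative (dist_map E) (at p) = (\<lambda>w. 2 *\<^sub>R rigidity_matrix E p w)"
    using frechet_derivative_at[OF dist_map_has_derivative] by (rule sym)
  moreover have "range (\<lambda>w. 2 *\<^sub>R rigidity_matrix E p w) = range (rigidity_matrix E p)"
  proof -
    have "rigidity_matrix E p w = 2 *\<^sub>R rigidity_matrix E p ((1/2) *\<^sub>R w)" for w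
      by (simp add: scaleR_right)
    moreover have "2 *\<^sub>R rigidity_matrix E p w = rigidity_matrix E p (2 *\<^sub>R w)" for w
      by (simp add: scaleR_right)
    ultimately show ?thesis by (intro subset_antisym subsetI; elim imageE; metis rangeI)
  qed
  ultimately show ?thesis by simp
qed

lemma range_rigidity_matrix_subset_tangent_space:
  fixes p :: "('d::finite, 'n::{finite,linorder}) config"
  assumes e: "0 < e" "\<And>t. t \<in> {-e<..<e} \<Longrightarrow> dist_map E (p + t *\<^sub>R w) \<in> N"
  shows "2 *\<^sub>R rigidity_matrix E p w \<in> tangent_space N (dist_map E p)"
proof -
  define \<gamma> where "\<gamma> = (\<lambda>t::real. dist_map E p + t *\<^sub>R (2 *\<^sub>R rigidity_matrix E p w) + t\<^sup>2 *\<^sub>R dist_map E w)"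
  have "smooth_on {-e<..<e} \<gamma>"
    unfolding smooth_on_def
  proof (intro ballI exI conjI allI)
    show "C_k_on k {-e<..<e} \<gamma>" for k
      unfolding \<gamma>_def by (rule C_k_on_quadratic_curve)
  qed auto
  moreover have "\<gamma> ` {-e<..<e} \<subseteq> N"
    using e(2) unfolding \<gamma>_def dist_map_line[symmetric] by blast
  moreover have "\<gamma> 0 = dist_map E p" by (simp add: \<gamma>_def)
  moreover have "(\<gamma> has_vector_derivative 2 *\<^sub>R rigidity_matrix E p w) (at 0)"
    unfolding \<gamma>_def has_vector_derivative_def by (auto intro!: derivative_eq_intros)
  ultimately show ?thesis
    unfolding tangent_space_def mem_Collect_eq using e(1) by (intro exI[of _ \<gamma>] exI[of _ e] conjI)
qed

text \<open>The rank of \<open>R p\<close> is lower semicontinuous in \<open>p\<close>; the point is uniformity over the fibre of \<open>m\<close>,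
  which is not compact. But \<open>R p\<close> depends on \<open>p\<close> only through the vector \<open>D p\<close> of edge differences,
  whose range is closed and whose norm is controlled by \<open>F p\<close>. So a sequence violating the claim
  has edge differences converging to those of a point in the fibre.\<close>

lemma rigidity_rank_semicontinuous:
  fixes m :: "'n::{finite,linorder} edge_vec"
  assumes rank: "\<And>p :: ('d::finite, 'n) config. dist_map E p = m \<Longrightarrow> r \<le> dim (range (rigidity_matrix E p))"
  shows "\<exists>\<delta>>0. \<forall>p :: ('d, 'n) config. dist (dist_map E p) m < \<delta> \<longrightarrow> r \<le> dim (range (rigidity_matrix E p))"
proof (rule ccontr)
  assume "\<not> ?thesis"
  then have "\<exists>p :: ('d, 'n) config. dist (dist_map E p) m < 1 / real (Suc k) \<and>
      dim (range (rigidity_matrix E p)) < r" for k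
    by (metis not_le of_nat_0_less_iff zero_less_Suc zero_less_divide_1_iff)
  then obtain P :: "nat \<Rightarrow> ('d, 'n) config" where
    P: "\<And>k. dist (dist_map E (P k)) m < 1 / real (Suc k)"
       "\<And>k. dim (range (rigidity_matrix E (P k))) < r" by metis
  define D :: "('d, 'n) config \<Rightarrow> ((real ^ 'd) ^ ('n \<times> 'n))"
    where "D = (\<lambda>p. \<chi> e. if e \<in> E then p $ snd e - p $ fst e else 0)"
  define \<Phi> :: "((real ^ 'd) ^ ('n \<times> 'n)) \<Rightarrow> ((real ^ 'd) ^ ('n \<times> 'n)) \<Rightarrow> 'n edge_vec"
    where "\<Phi> = (\<lambda>y z. \<chi> e. y $ e \<bullet> z $ e)"
  have linD: "linear D"
    by (rule linearI) (auto simp: D_def vec_eq_iff algebra_simps)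
  have bil: "bounded_bilinear \<Phi>"
    unfolding bilinear_conv_bounded_bilinear[symmetric] bilinear_def
    by (auto simp: linear_iff \<Phi>_def vec_eq_iff algebra_simps)
  interpret \<Phi>: bounded_bilinear \<Phi> by fact
  have R: "rigidity_matrix E p w = \<Phi> (D p) (D w)" for p w
    by (simp add: vec_eq_iff rigidity_matrix_component D_def \<Phi>_def)
  have F: "dist_map E p = \<Phi> (D p) (D p)" for p by (simp add: dist_map_eq_rigidity_matrix R)
  define \<rho> where "\<rho> = 1 + (\<Sum>e\<in>(UNIV :: ('n \<times> 'n) set). norm m + 1)"
  have \<rho>: "0 < \<rho>" unfolding \<rho>_def by (intro add_pos_nonneg sum_nonneg) auto
  have bd: "norm (D (P k)) \<le> \<rho>" for k
  proof -
    have "norm (dist_map E (P k)) \<le> norm m + 1"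
    proof -
      have "1 / real (Suc k) \<le> 1" by simp
      then have "dist (dist_map E (P k)) m \<le> 1" using P(1)[of k] by linarith
      then show ?thesis using norm_triangle_ineq2[of "dist_map E (P k)" m] by (simp add: dist_norm)
    qed
    moreover have "(norm (D (P k) $ e))\<^sup>2 \<le> norm (dist_map E (P k))" for e
      using component_le_norm_cart[of "dist_map E (P k)" e]
      by (simp add: F \<Phi>_def dot_square_norm)
    ultimately have comp: "(norm (D (P k) $ e))\<^sup>2 \<le> norm m + 1" for e by (meson order_trans)
    have "(norm (D (P k)))\<^sup>2 \<le> (\<Sum>e\<in>(UNIV :: ('n \<times> 'n) set). norm m + 1)"
    proof -
      have "(norm (D (P k)))\<^sup>2 = (\<Sum>e\<in>UNIV. (norm (D (P k) $ e))\<^sup>2)"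
        unfolding norm_vec_def[of "D (P k)"] L2_set_def by (rule real_sqrt_pow2) (simp add: sum_nonneg)
      then show ?thesis using comp by (simp only:) (rule sum_mono)
    qed
    also have "\<dots> \<le> \<rho>\<^sup>2"
    proof -
      have "\<rho> * 1 \<le> \<rho> * \<rho>"
        using \<rho> by (intro mult_left_mono) (auto simp: \<rho>_def intro!: sum_nonneg)
      then show ?thesis by (simp add: power2_eq_square \<rho>_def)
    qed
    finally show ?thesis using \<rho> by (rule_tac power2_le_imp_le) auto
  qed
  have "closed (range D)" using linD by (intro closed_subspace linear_subspace_image) auto
  then have "compact (range D \<inter> cball 0 \<rho>)" by (intro closed_Int_compact) auto
  then have "seq_compact (range D \<inter> cball 0 \<rho>)" by (rule compact_imp_seq_compact)
  moreover have "\<forall>k. D (P k) \<in> range D \<inter> cball 0 \<rho>" using bd by simp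
  ultimately obtain z s where z: "z \<in> range D \<inter> cball 0 \<rho>" "strict_mono (s :: nat \<Rightarrow> nat)"
      and "((\<lambda>k. D (P k)) \<circ> s) \<longlonglongrightarrow> z"
    by (rule seq_compactE)
  then have lim: "(\<lambda>k. D (P (s k))) \<longlonglongrightarrow> z" by (simp add: o_def)
  from z(1) obtain p where p: "z = D p" by blast
  have "(\<lambda>k. dist_map E (P k)) \<longlonglongrightarrow> m"
  proof (rule iffD2[OF tendsto_dist_iff], rule tendsto_sandwich[OF _ _ tendsto_const])
    show "\<forall>\<^sub>F k in sequentially. dist (dist_map E (P k)) m \<le> 1 / real (Suc k)"
      by (rule always_eventually) (intro allI less_imp_le P(1))
    show "(\<lambda>k. 1 / real (Suc k)) \<longlonglongrightarrow> 0"
      using LIMSEQ_inverse_real_of_nat by (simp add: inverse_eq_divide)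
  qed simp
  then have "(\<lambda>k. dist_map E (P (s k))) \<longlonglongrightarrow> m"
    using LIMSEQ_subseq_LIMSEQ[of "\<lambda>k. dist_map E (P k)" m s] z(2) unfolding o_def by blast
  moreover have "(\<lambda>k. dist_map E (P (s k))) \<longlonglongrightarrow> dist_map E p"
    unfolding F p[symmetric] by (intro \<Phi>.tendsto lim)
  ultimately have "dist_map E p = m" using LIMSEQ_unique by blast
  then have rp: "r \<le> dim (range (rigidity_matrix E p))" by (rule rank)
  have linR: "linear (rigidity_matrix E q)" for q
    using bounded_bilinear.bounded_linear_right[OF bounded_bilinear_rigidity_matrix]
    by (simp add: linear_conv_bounded_linear)
  define S where "S = range (rigidity_matrix E p)"
  have S: "subspace S" unfolding S_def by (intro linear_subspace_image linR) auto
  obtain g where g: "linear g" "\<And>y. y \<in> S \<Longrightarrow> rigidity_matrix E p (g y) = y"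
    using linear_exists_right_inverse_on[OF linR subspace_UNIV] unfolding S_def by blast
  have lin: "linear (\<lambda>y. D (g y))" using linear_compose[OF g(1) linD] by (simp add: o_def)
  obtain B where B: "0 < B" "\<And>y. norm (D (g y)) \<le> B * norm y"
    using linear_bounded_pos[OF lin] by blast
  obtain K where K: "0 < K" "\<And>y z. norm (\<Phi> y z) \<le> norm y * norm z * K" using \<Phi>.pos_bounded by blast
  obtain k where k: "dist (D (P (s k))) z < 1 / (B * K)"
  proof -
    have "0 < 1 / (B * K)" using B K by simp
    then have "\<exists>k. dist (D (P (s k))) z < 1 / (B * K)" using lim unfolding lim_sequentially by blast
    then show thesis using that by blast
  qed
  let ?q = "P (s k)"
  \<comment> \<open>On the range of \<open>R p\<close> this map is close to the identity, hence injective.\<close>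
  let ?h = "\<lambda>y. rigidity_matrix E ?q (g y)"
  have linh: "linear ?h" using linear_compose[OF g(1) linR] by (simp add: o_def)
  have "inj_on ?h (span S)"
  proof (rule linear_inj_on_iff_eq_0[OF linh subspace_span, THEN iffD2], intro ballI impI)
    fix y assume y: "y \<in> span S" "?h y = 0"
    then have yS: "y \<in> S" using S by (metis span_eq_iff)
    have "y = rigidity_matrix E p (g y) - ?h y" using g(2)[OF yS] y by simp
    also have "\<dots> = \<Phi> (z - D ?q) (D (g y))" by (simp add: R p \<Phi>.diff_left)
    finally have "norm y \<le> norm (z - D ?q) * norm (D (g y)) * K" using K(2) by metis
    also have "\<dots> \<le> norm (z - D ?q) * (B * norm y) * K"
      using B K by (intro mult_right_mono mult_left_mono) auto
    also have "\<dots> = (norm (z - D ?q) * (B * K)) * norm y" by simp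
    finally have le: "norm y \<le> (norm (z - D ?q) * (B * K)) * norm y" .
    have "norm (z - D ?q) * (B * K) < 1"
      using k B K by (simp add: dist_norm norm_minus_commute pos_less_divide_eq)
    then have "(norm (z - D ?q) * (B * K)) * norm y < 1 * norm y" if "y \<noteq> 0"
      using that by (intro mult_strict_right_mono) auto
    then show "y = 0" using le by fastforce
  qed
  then have "dim S = dim (?h ` S)" using dim_image_eq[OF linh] by metis
  also have "\<dots> \<le> dim (range (rigidity_matrix E ?q))" by (rule dim_subset) auto
  finally show False using rp P(2)[of "s k"] by (simp add: S_def)
qed

lemma regular_values_D:
  fixes p :: "('d::finite, 'n::{finite,linorder}) config"
  assumes "m \<in> regular_values TYPE('d) E"
  shows "\<exists>W. open W \<and> m \<in> W \<and> embedded_submanifold (range (dist_map E :: ('d, 'n) config \<Rightarrow> _) \<inter> W)"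
    and "dist_map E p = m \<Longrightarrow>
      tangent_space (range (dist_map E :: ('d, 'n) config \<Rightarrow> _)) m = range (rigidity_matrix E p)"
  using assms unfolding regular_values_def Let_def range_frechet_derivative_dist_map by auto

text \<open>Near \<open>m\<close> the tangent spaces of the image have constant dimension. They contain the range of the
  rigidity matrix, whose dimension does not drop, and so they agree with it.\<close>

lemma regular_values_open:
  fixes m :: "'n::{finite,linorder} edge_vec"
  assumes m: "m \<in> regular_values TYPE('d::finite) E"
  shows "\<exists>\<delta>>0. \<forall>y \<in> range (dist_map E :: ('d, 'n) config \<Rightarrow> _). dist y m < \<delta> \<longrightarrow> y \<in> regular_values TYPE('d) E"
proof -
  let ?N = "range (dist_map E :: ('d, 'n) config \<Rightarrow> _)"
  have mN: "m \<in> ?N" using m by (auto simp: regular_values_def Let_def)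
  obtain W where W: "open W" "m \<in> W" "embedded_submanifold (?N \<inter> W)"
    using regular_values_D(1)[OF m] by blast
  obtain U where U: "open U" "m \<in> U"
    "\<And>y. y \<in> ?N \<inter> U \<Longrightarrow> subspace (tangent_space ?N y)"
    "\<And>y. y \<in> ?N \<inter> U \<Longrightarrow> dim (tangent_space ?N y) = dim (tangent_space ?N m)"
    using submanifold_near_tangent_space(2)[OF W(1,3) mN W(2)] by blast
  obtain \<delta>1 where \<delta>1: "0 < \<delta>1" "\<And>p :: ('d, 'n) config. dist (dist_map E p) m < \<delta>1 \<Longrightarrow>
      dim (tangent_space ?N m) \<le> dim (range (rigidity_matrix E p))"
    using rigidity_rank_semicontinuous[of E m "dim (tangent_space ?N m)", where 'd = 'd]
      regular_values_D(2)[OF m] by (metis order_refl)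
  obtain \<delta>2 where \<delta>2: "0 < \<delta>2" "ball m \<delta>2 \<subseteq> W \<inter> U"
    using openE[of "W \<inter> U" m] W(1,2) U(1,2) by blast
  show ?thesis
  proof (intro exI[of _ "min \<delta>1 \<delta>2"] conjI ballI impI)
    show "0 < min \<delta>1 \<delta>2" using \<delta>1 \<delta>2 by simp
    fix y assume y: "y \<in> ?N" "dist y m < min \<delta>1 \<delta>2"
    then have yWU: "y \<in> W \<inter> U" using \<delta>2 by (auto simp: subset_iff dist_commute)
    have "range (rigidity_matrix E p) = tangent_space ?N y" if p: "dist_map E p = y" for p :: "('d, 'n) config"
    proof (rule subspace_dim_equal)
      interpret bounded_bilinear "rigidity_matrix E" by (rule bounded_bilinear_rigidity_matrix)
      have "linear (rigidity_matrix E p)"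
        using bounded_linear_right by (simp add: linear_conv_bounded_linear)
      then show "subspace (range (rigidity_matrix E p))" by (intro linear_subspace_image) auto
      show "subspace (tangent_space ?N y)" using U(3) y yWU by blast
      show "range (rigidity_matrix E p) \<subseteq> tangent_space ?N y"
      proof safe
        fix w
        have "2 *\<^sub>R rigidity_matrix E p ((1/2) *\<^sub>R w) \<in> tangent_space ?N (dist_map E p)"
          by (rule range_rigidity_matrix_subset_tangent_space[of 1]) auto
        then show "rigidity_matrix E p w \<in> tangent_space ?N y" by (simp add: p scaleR_right)
      qed
      show "dim (tangent_space ?N y) \<le> dim (range (rigidity_matrix E p))"
        using \<delta>1(2)[of p] U(4)[of y] y yWU p by simp
    qed
    then show "y \<in> regular_values TYPE('d) E"
      unfolding regular_values_def Let_def range_frechet_derivative_dist_map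
      using y(1) yWU W by blast
  qed
qed

lemma regular_configs_open: "open (regular_configs E :: ('d::finite, 'n::{finite,linorder}) config set)"
proof (subst open_contains_ball, intro ballI)
  fix p :: "('d, 'n) config" assume "p \<in> regular_configs E"
  then obtain \<delta> where \<delta>: "0 < \<delta>" "\<And>q :: ('d, 'n) config. dist (dist_map E q) (dist_map E p) < \<delta> \<Longrightarrow>
      dist_map E q \<in> regular_values TYPE('d) E"
    using regular_values_open[of "dist_map E p" E, where 'd = 'd] unfolding regular_configs_def by auto
  have "isCont (dist_map E) p"
    using has_derivative_continuous[OF dist_map_has_derivative] .
  then obtain e where "0 < e" "\<And>q. dist q p < e \<Longrightarrow> dist (dist_map E q) (dist_map E p) < \<delta>"
    using \<delta>(1) unfolding continuous_at_eps_delta by blast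
  then show "\<exists>e>0. ball p e \<subseteq> regular_configs E"
    using \<delta>(2) by (intro exI[of _ e]) (auto simp: regular_configs_def dist_commute)
qed

lemma tangent_space_mono:
  assumes "A \<subseteq> B" shows "tangent_space A x \<subseteq> tangent_space B x"
proof
  fix v assume "v \<in> tangent_space A x"
  then obtain \<gamma> and e :: real where "0 < e" "smooth_on {-e<..<e} \<gamma>" "\<gamma> ` {-e<..<e} \<subseteq> A"
      "\<gamma> 0 = x" "(\<gamma> has_vector_derivative v) (at 0)"
    unfolding tangent_space_def mem_Collect_eq by (elim exE conjE)
  then show "v \<in> tangent_space B x"
    unfolding tangent_space_def mem_Collect_eq using assms
    by (intro exI[of _ \<gamma>] exI[of _ e] conjI) (auto dest: subsetD)
qed

text \<open>A straight line through \<open>p\<close> stays among the regular configurations for a short time, so its image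
  is a curve of regular values.\<close>

lemma tangent_space_regular_values:
  fixes p :: "('d::finite, 'n::{finite,linorder}) config"
  assumes p: "p \<in> regular_configs E"
  shows "tangent_space (regular_values TYPE('d) E) (dist_map E p) = range (rigidity_matrix E p)"
proof
  let ?N = "range (dist_map E :: ('d, 'n) config \<Rightarrow> _)"
  have m: "dist_map E p \<in> regular_values TYPE('d) E" using p by (simp add: regular_configs_def)
  have "tangent_space (regular_values TYPE('d) E) (dist_map E p) \<subseteq> tangent_space ?N (dist_map E p)"
    by (rule tangent_space_mono) (auto simp: regular_values_def Let_def)
  then show "tangent_space (regular_values TYPE('d) E) (dist_map E p) \<subseteq> range (rigidity_matrix E p)"
    unfolding regular_values_D(2)[OF m refl] .
  show "range (rigidity_matrix E p) \<subseteq> tangent_space (regular_values TYPE('d) E) (dist_map E p)"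
  proof safe
    fix w :: "('d, 'n) config"
    interpret bounded_bilinear "rigidity_matrix E" by (rule bounded_bilinear_rigidity_matrix)
    let ?w = "(1/2) *\<^sub>R w"
    have "open ((\<lambda>t::real. p + t *\<^sub>R ?w) -` regular_configs E)"
      by (intro open_vimage regular_configs_open continuous_intros)
    moreover have "(0::real) \<in> (\<lambda>t. p + t *\<^sub>R ?w) -` regular_configs E" using p by simp
    ultimately obtain e :: real where e: "0 < e" "ball 0 e \<subseteq> (\<lambda>t. p + t *\<^sub>R ?w) -` regular_configs E"
      by (rule openE)
    have "2 *\<^sub>R rigidity_matrix E p ?w \<in> tangent_space (regular_values TYPE('d) E) (dist_map E p)"
    proof (rule range_rigidity_matrix_subset_tangent_space[OF e(1)])
      fix t assume "t \<in> {-e<..<e}"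
      then have "t \<in> ball 0 e" by (auto simp: dist_norm)
      then have "p + t *\<^sub>R ?w \<in> regular_configs E" using e(2) by blast
      then show "dist_map E (p + t *\<^sub>R ?w) \<in> regular_values TYPE('d) E"
        by (simp add: regular_configs_def)
    qed
    then show "rigidity_matrix E p w \<in> tangent_space (regular_values TYPE('d) E) (dist_map E p)"
      by (simp add: scaleR_right)
  qed
qed

text \<open>The state space is the graph of the distance map over the regular configurations, so the second
  component of a tangent vector is the derivative of that map along the first.\<close>

lemma state_space_tangent:
  fixes s :: "('d::finite, 'n::{finite,linorder}) config \<times> 'n edge_vec"
  assumes "(x, y) \<in> tangent_space (state_space E) s"
  shows "y = 2 *\<^sub>R rigidity_matrix E (fst s) x"
proof -
  obtain \<gamma> and e :: real where \<gamma>: "0 < e" "\<gamma> ` {-e<..<e} \<subseteq> state_space E" "\<gamma> 0 = s"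
      "(\<gamma> has_vector_derivative (x, y)) (at 0)"
    using assms unfolding tangent_space_def mem_Collect_eq by (elim exE conjE)
  have d1: "((\<lambda>t. fst (\<gamma> t)) has_vector_derivative x) (at 0)"
    using bounded_linear.has_vector_derivative[OF bounded_linear_fst \<gamma>(4)] by simp
  have d2: "((\<lambda>t. snd (\<gamma> t)) has_vector_derivative y) (at 0)"
    using bounded_linear.has_vector_derivative[OF bounded_linear_snd \<gamma>(4)] by simp
  interpret R: bounded_bilinear "rigidity_matrix E" by (rule bounded_bilinear_rigidity_matrix)
  have "(\<lambda>t. 2 *\<^sub>R rigidity_matrix E (fst (\<gamma> 0)) (t *\<^sub>R x)) =
      (\<lambda>t. t *\<^sub>R (2 *\<^sub>R rigidity_matrix E (fst s) x))"
    by (simp add: R.scaleR_right \<gamma>(3) mult.commute)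
  then have "((\<lambda>t. dist_map E (fst (\<gamma> t))) has_vector_derivative 2 *\<^sub>R rigidity_matrix E (fst s) x) (at 0)"
    using has_derivative_compose[OF d1[unfolded has_vector_derivative_def] dist_map_has_derivative]
    unfolding has_vector_derivative_def by metis
  moreover have "open {-e<..<e}" "0 \<in> {-e<..<e}" using \<gamma>(1) by auto
  moreover have "dist_map E (fst (\<gamma> t)) = snd (\<gamma> t)" if "t \<in> {-e<..<e}" for t
  proof -
    have "\<gamma> t \<in> state_space E" using \<gamma>(2) that by blast
    then show ?thesis unfolding state_space_def by (cases "\<gamma> t") simp
  qed
  ultimately have "((\<lambda>t. snd (\<gamma> t)) has_vector_derivative 2 *\<^sub>R rigidity_matrix E (fst s) x) (at 0)"
    by (rule has_vector_derivative_transform_within_open)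
  then show ?thesis by (rule vector_derivative_unique_at[OF d2])
qed

section \<open>Local Lipschitz continuity of a controller\<close>

lemma linear_on_subspace_sum:
  assumes f: "linear_on_subspace V f" and V: "subspace V" and b: "\<And>i. i \<in> I \<Longrightarrow> b i \<in> V"
  shows "f (\<Sum>i\<in>I. c i *\<^sub>R b i) = (\<Sum>i\<in>I. c i *\<^sub>R f (b i))"
proof -
  have f0: "f 0 = 0"
  proof -
    have "f (0 *\<^sub>R 0) = 0 *\<^sub>R f 0" using f V subspace_0 unfolding linear_on_subspace_def by blast
    then show ?thesis by simp
  qed
  show ?thesis
    using b
  proof (induction I rule: infinite_finite_induct)
    case (insert i I)
    have "(\<Sum>i\<in>I. c i *\<^sub>R b i) \<in> V" "c i *\<^sub>R b i \<in> V"
      using insert.prems V by (auto intro!: subspace_sum subspace_scale)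
    then have "f (c i *\<^sub>R b i + (\<Sum>i\<in>I. c i *\<^sub>R b i)) = f (c i *\<^sub>R b i) + f (\<Sum>i\<in>I. c i *\<^sub>R b i)"
      using f unfolding linear_on_subspace_def by blast
    moreover have "f (c i *\<^sub>R b i) = c i *\<^sub>R f (b i)"
      using f insert.prems unfolding linear_on_subspace_def by blast
    ultimately show ?case using insert by simp
  qed (simp_all add: f0)
qed

lemma axis_in_edge_space: "e \<in> E \<Longrightarrow> axis e 1 \<in> edge_space E"
  by (auto simp: edge_space_def axis_def)

lemma edge_space_expansion:
  assumes "x \<in> edge_space E" shows "x = (\<Sum>e\<in>E. (x $ e) *\<^sub>R axis e 1)"
proof (simp add: vec_eq_iff axis_def, intro allI)
  fix i j
  have "(\<Sum>e\<in>E. x $ e * (if (i, j) = e then 1 else 0)) = (\<Sum>e\<in>E. if (i, j) = e then x $ e else 0)"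
    by (rule sum.cong) auto
  also have "\<dots> = x $ (i, j)" using assms by (simp add: edge_space_def)
  finally show "x $ (i, j) = (\<Sum>e\<in>E. x $ e * (if (i, j) = e then 1 else 0))" by simp
qed

text \<open>Because the regular configurations are open, \<open>p \<mapsto> (p, F p)\<close> maps a full ball around \<open>p'\<close> into
  \<open>A\<close>; there \<open>f\<close> coincides with a continuously differentiable map on an open set of the ambient
  space.\<close>

lemma smooth_on_state_space_lipschitz:
  fixes f :: "('d::finite, 'n::{finite,linorder}) config \<times> 'n edge_vec \<Rightarrow> ('d, 'n) config"
  assumes f: "smooth_on A f" and A: "openin (top_of_set (state_space E)) A" "(p', dist_map E p') \<in> A"
  shows "\<exists>r L. 0 < r \<and> (\<forall>p\<in>cball p' r. (p, dist_map E p) \<in> A) \<and>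
    L-lipschitz_on (cball p' r) (\<lambda>p. f (p, dist_map E p))"
proof -
  obtain W g where W: "open W" "(p', dist_map E p') \<in> W" "\<And>k. C_k_on k W g" "\<And>x. x \<in> A \<inter> W \<Longrightarrow> g x = f x"
    by (rule smooth_on_imp_has_derivative[OF f A(2)]) blast
  obtain \<rho> Lg where \<rho>: "0 < \<rho>" "cball (p', dist_map E p') \<rho> \<subseteq> W"
      "Lg-lipschitz_on (cball (p', dist_map E p') \<rho>) g"
    by (rule C1_imp_locally_lipschitz[OF W(3) W(1,2)])
  obtain S where S: "open S" "A = state_space E \<inter> S" using A(1) unfolding openin_open by blast
  define h where "h = (\<lambda>p :: ('d, 'n) config. (p, dist_map E p))"
  have p': "p' \<in> regular_configs E" using A(2) S by (auto simp: state_space_def)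
  have C1: "C_k_on (Suc 0) UNIV h"
    unfolding C_k_on.simps(2) h_def
  proof (intro exI conjI ballI allI)
    fix p :: "('d, 'n) config"
    show "((\<lambda>p. (p, dist_map E p)) has_derivative (\<lambda>w. (w, 2 *\<^sub>R rigidity_matrix E p w))) (at p)"
      by (intro has_derivative_Pair has_derivative_ident dist_map_has_derivative)
  next
    fix w :: "('d, 'n) config"
    have "continuous_on UNIV (\<lambda>p. rigidity_matrix E p w)"
      using bounded_bilinear.bounded_linear_left[OF bounded_bilinear_rigidity_matrix]
      by (rule linear_continuous_on)
    then show "C_k_on 0 UNIV (\<lambda>p. (w, 2 *\<^sub>R rigidity_matrix E p w))"
      unfolding C_k_on.simps by (intro continuous_intros)
  qed
  obtain r1 Lh where r1: "0 < r1" "Lh-lipschitz_on (cball p' r1) h"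
    by (rule C1_imp_locally_lipschitz[OF C1 open_UNIV UNIV_I[of p']])
  have "continuous_on UNIV h"
    unfolding h_def
    by (intro continuous_intros continuous_at_imp_continuous_on ballI
        has_derivative_continuous[OF dist_map_has_derivative])
  then have "open (h -` (ball (p', dist_map E p') \<rho> \<inter> S))"
    using S(1) by (intro open_vimage) auto
  then have "open (h -` (ball (p', dist_map E p') \<rho> \<inter> S) \<inter> regular_configs E)"
    using regular_configs_open by blast
  moreover have "p' \<in> h -` (ball (p', dist_map E p') \<rho> \<inter> S) \<inter> regular_configs E"
    using \<rho>(1) S A(2) p' by (simp add: h_def)
  ultimately have "\<exists>r2>0. cball p' r2 \<subseteq> h -` (ball (p', dist_map E p') \<rho> \<inter> S) \<inter> regular_configs E"
    unfolding open_contains_cball by blast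
  then obtain r2 where r2: "0 < r2"
      "cball p' r2 \<subseteq> h -` (ball (p', dist_map E p') \<rho> \<inter> S) \<inter> regular_configs E" by blast
  define r where "r = min r1 r2"
  have mem: "h p \<in> ball (p', dist_map E p') \<rho>" "h p \<in> A" if p: "p \<in> cball p' r" for p
  proof -
    have p2: "p \<in> h -` (ball (p', dist_map E p') \<rho> \<inter> S) \<inter> regular_configs E"
      using p r2(2) by (auto simp: r_def)
    then show "h p \<in> ball (p', dist_map E p') \<rho>" by blast
    from p2 show "h p \<in> A"
      by (simp add: S(2) state_space_def h_def regular_configs_def)
  qed
  have "(Lg * Lh)-lipschitz_on (cball p' r) (\<lambda>p. g (h p))"
  proof (rule lipschitz_on_compose2[where f = h and g = g])
    show "Lh-lipschitz_on (cball p' r) h"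
      by (rule lipschitz_on_subset[OF r1(2)]) (auto simp: r_def)
    show "Lg-lipschitz_on (h ` cball p' r) g"
    proof (rule lipschitz_on_subset[OF \<rho>(3)])
      show "h ` cball p' r \<subseteq> cball (p', dist_map E p') \<rho>"
        using mem(1) ball_subset_cball by blast
    qed
  qed
  moreover have "f (h p) = g (h p)" if "p \<in> cball p' r" for p
  proof -
    have "h p \<in> ball (p', dist_map E p') \<rho>" using mem that by blast
    then have "h p \<in> cball (p', dist_map E p') \<rho>" using ball_subset_cball by blast
    then have "h p \<in> A \<inter> W" using mem that \<rho>(2) by blast
    then show ?thesis using W(4) by simp
  qed
  ultimately have "(Lg * Lh)-lipschitz_on (cball p' r) (\<lambda>p. f (h p))"
    by (rule lipschitz_on_transform)
  then have "(Lg * Lh)-lipschitz_on (cball p' r) (\<lambda>p. f (p, dist_map E p))" by (simp only: h_def)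
  moreover have "0 < r" using r1 r2 by (simp add: r_def)
  moreover have "(p, dist_map E p) \<in> A" if "p \<in> cball p' r" for p
    using mem(2)[OF that] by (simp add: h_def)
  ultimately show ?thesis by (rule_tac exI[of _ r], rule_tac exI[of _ "Lg * Lh"]) blast
qed

lemma controller_lipschitz_near_target:
  fixes \<nu> :: "('d::finite, 'n::{finite,linorder}) config \<times> 'n edge_vec \<Rightarrow> 'n edge_vec \<Rightarrow> ('d, 'n) config"
  assumes compat: "compatible_controller E A \<nu> \<eta>"
    and A: "openin (top_of_set (state_space E)) A" "(p', dist_map E p') \<in> A"
  obtains r L where "0 < r" "\<And>p. p \<in> cball p' r \<Longrightarrow> (p, dist_map E p) \<in> A"
    "\<And>e. e \<in> E \<Longrightarrow> L-lipschitz_on (cball p' r) (\<lambda>p. \<nu> (p, dist_map E p) (axis e 1))"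
proof -
  have ex: "\<exists>r L. 0 < r \<and> (\<forall>p\<in>cball p' r. (p, dist_map E p) \<in> A) \<and>
      L-lipschitz_on (cball p' r) (\<lambda>p. \<nu> (p, dist_map E p) x)" if "x \<in> edge_space E" for x
  proof -
    have "smooth_on A (\<lambda>s. \<nu> s x)" using compat that by (simp add: compatible_controller_def)
    then show ?thesis by (rule smooth_on_state_space_lipschitz[OF _ A])
  qed
  have "\<exists>r L. 0 < r \<and> (\<forall>p\<in>cball p' r. (p, dist_map E p) \<in> A) \<and>
      (\<forall>e\<in>I. L-lipschitz_on (cball p' r) (\<lambda>p. \<nu> (p, dist_map E p) (axis e 1)))" if "I \<subseteq> E" for I
    using finite_subset[OF that finite] that
  proof (induction I rule: finite_induct)
    case empty
    have "0 \<in> edge_space E" using subspace_0[OF subspace_edge_space] .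
    from ex[OF this] obtain r where "0 < r" "\<forall>p\<in>cball p' r. (p, dist_map E p) \<in> A"
      by (elim exE conjE)
    then show ?case by (intro exI[of _ r] exI conjI) simp_all
  next
    case (insert e I)
    then have "\<exists>r L. 0 < r \<and> (\<forall>p\<in>cball p' r. (p, dist_map E p) \<in> A) \<and>
      (\<forall>e\<in>I. L-lipschitz_on (cball p' r) (\<lambda>p. \<nu> (p, dist_map E p) (axis e 1)))" by simp
    then obtain r L where r: "0 < r" "\<forall>p\<in>cball p' r. (p, dist_map E p) \<in> A"
      "\<forall>e\<in>I. L-lipschitz_on (cball p' r) (\<lambda>p. \<nu> (p, dist_map E p) (axis e 1))"
      by (elim exE conjE)
    have "e \<in> E" using insert.prems by simp
    from ex[OF axis_in_edge_space[OF this]] obtain r' L' where r': "0 < r'"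
      "L'-lipschitz_on (cball p' r') (\<lambda>p. \<nu> (p, dist_map E p) (axis e 1))"
      by (elim exE conjE)
    have sub: "cball p' (min r r') \<subseteq> cball p' r" "cball p' (min r r') \<subseteq> cball p' r'" by auto
    show ?case
    proof (rule exI[of _ "min r r'"], rule exI[of _ "max L L'"], intro conjI ballI)
      fix i assume "i \<in> insert e I"
      then consider "i = e" | "i \<in> I" by blast
      then show "(max L L')-lipschitz_on (cball p' (min r r')) (\<lambda>p. \<nu> (p, dist_map E p) (axis i 1))"
      proof cases
        case 1
        show ?thesis unfolding 1 by (rule lipschitz_on_mono[OF r'(2) sub(2)]) simp
      next
        case 2
        show ?thesis by (rule lipschitz_on_mono[OF bspec[OF r(3) 2] sub(1)]) simp
      qed
    next
      show "0 < min r r'" using r(1) r'(1) by simp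
      show "(p, dist_map E p) \<in> A" if "p \<in> cball p' (min r r')" for p
        using r(2) sub(1) that by blast
    qed
  qed
  from this[OF order_refl] obtain r L where "0 < r" "\<forall>p\<in>cball p' r. (p, dist_map E p) \<in> A"
      "\<forall>e\<in>E. L-lipschitz_on (cball p' r) (\<lambda>p. \<nu> (p, dist_map E p) (axis e 1))"
    by (elim exE conjE)
  then show thesis by (intro that[of r L]) simp_all
qed

section \<open>The closed loop near the target\<close>

text \<open>A ball around the target configuration \<open>p'\<close> on which the controller, read as a function of the
  configuration alone, is defined and Lipschitz.\<close>

locale formation_near_target =
  fixes E :: "('n::{finite,linorder} \<times> 'n) set"
    and p' :: "('d::finite, 'n) config"
    and A :: "(('d, 'n) config \<times> 'n edge_vec) set"
    and \<nu> :: "('d, 'n) config \<times> 'n edge_vec \<Rightarrow> 'n edge_vec \<Rightarrow> ('d, 'n) config"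
    and \<eta> :: "('d, 'n) config \<times> 'n edge_vec \<Rightarrow> 'n edge_vec \<Rightarrow> 'n edge_vec"
    and r L :: real
  assumes regular: "p' \<in> regular_configs E"
    and subset: "A \<subseteq> state_space E"
    and compatible: "compatible_controller E A \<nu> \<eta>"
    and r_pos: "0 < r"
    and in_A: "p \<in> cball p' r \<Longrightarrow> (p, dist_map E p) \<in> A"
    and lipschitz: "e \<in> E \<Longrightarrow> L-lipschitz_on (cball p' r) (\<lambda>p. \<nu> (p, dist_map E p) (axis e 1))"
begin

text \<open>The operators \<open>\<nu>\<close> and \<open>\<eta>\<close> are constrained on the edge space only. \<open>gain\<close> and \<open>err_gain\<close> are their
  linear extensions to the whole space at the state \<open>(p, F p)\<close>; compatibility is built into the
  latter.\<close>

definition gain :: "('d, 'n) config \<Rightarrow> 'n edge_vec \<Rightarrow> ('d, 'n) config" where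
  "gain p x = (\<Sum>e\<in>E. (x $ e) *\<^sub>R \<nu> (p, dist_map E p) (axis e 1))"

text \<open>The closed loop in terms of the configuration alone.\<close>

definition field :: "('d, 'n) config \<Rightarrow> ('d, 'n) config" where
  "field p = gain p (dist_map E p' - dist_map E p)"

definition err :: "('d, 'n) config \<Rightarrow> 'n edge_vec" where
  "err p = dist_map E p - dist_map E p'"

definition err_gain :: "('d, 'n) config \<Rightarrow> 'n edge_vec \<Rightarrow> 'n edge_vec" where
  "err_gain p x = 2 *\<^sub>R rigidity_matrix E p (gain p x)"

sublocale R: bounded_bilinear "rigidity_matrix E :: ('d, 'n) config \<Rightarrow> ('d, 'n) config \<Rightarrow> 'n edge_vec"
  by (rule bounded_bilinear_rigidity_matrix)

lemma linear_gain: "linear (gain p)"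
  by (rule linearI)
    (auto simp: gain_def scaleR_add_left sum.distrib scaleR_right.sum intro!: sum.cong)

lemma linear_err_gain: "linear (err_gain p)"
  unfolding err_gain_def
  using linear_compose[OF linear_gain bounded_linear.linear[OF R.bounded_linear_right]]
  by (intro linear_compose_scale_right) (simp add: o_def)

lemma gain_eq:
  assumes "(p, dist_map E p) \<in> A" "x \<in> edge_space E"
  shows "\<nu> (p, dist_map E p) x = gain p x"
proof -
  have lin: "linear_on_subspace (edge_space E) (\<nu> (p, dist_map E p))"
    using compatible assms(1) by (simp add: compatible_controller_def)
  have "\<nu> (p, dist_map E p) x = \<nu> (p, dist_map E p) (\<Sum>e\<in>E. (x $ e) *\<^sub>R axis e 1)"
    using edge_space_expansion[OF assms(2)] by (rule arg_cong)
  also have "\<dots> = gain p x"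
    unfolding gain_def by (rule linear_on_subspace_sum[OF lin subspace_edge_space axis_in_edge_space])
  finally show ?thesis .
qed

lemma err_gain_eq:
  assumes "(p, dist_map E p) \<in> A" "x \<in> edge_space E"
  shows "\<eta> (p, dist_map E p) x = err_gain p x"
proof -
  have "(\<nu> (p, dist_map E p) x, \<eta> (p, dist_map E p) x) \<in> tangent_space (state_space E) (p, dist_map E p)"
    using compatible assms by (simp add: compatible_controller_def)
  from state_space_tangent[OF this] show ?thesis by (simp add: err_gain_def gain_eq[OF assms])
qed

lemma gain_lipschitz:
  assumes "p \<in> cball p' r" "q \<in> cball p' r"
  shows "norm (gain p x - gain q x) \<le> (real (card E) * L) * norm (p - q) * norm x"
proof -
  have "gain p x - gain q x =
      (\<Sum>e\<in>E. (x $ e) *\<^sub>R (\<nu> (p, dist_map E p) (axis e 1) - \<nu> (q, dist_map E q) (axis e 1)))"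
    by (simp add: gain_def scaleR_diff_right sum_subtractf)
  also have "norm \<dots> \<le> (\<Sum>e\<in>E. norm x * (L * norm (p - q)))"
  proof (rule sum_norm_le)
    fix e assume e: "e \<in> E"
    have "norm (\<nu> (p, dist_map E p) (axis e 1) - \<nu> (q, dist_map E q) (axis e 1)) \<le> L * norm (p - q)"
      using lipschitz_on_normD[OF lipschitz[OF e] assms] .
    moreover have "\<bar>x $ e\<bar> \<le> norm x" by (rule component_le_norm_cart)
    ultimately show "norm ((x $ e) *\<^sub>R (\<nu> (p, dist_map E p) (axis e 1) - \<nu> (q, dist_map E q) (axis e 1)))
        \<le> norm x * (L * norm (p - q))"
      by (simp add: mult_mono)
  qed
  finally show ?thesis by (simp add: mult_ac)
qed

lemma gain_bounded: "\<exists>M>0. \<forall>p\<in>cball p' r. \<forall>x. norm (gain p x) \<le> M * norm x"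
proof -
  obtain M where M: "0 < M" "\<And>x. norm (gain p' x) \<le> M * norm x"
    using linear_bounded_pos[OF linear_gain] by blast
  let ?M = "M + \<bar>real (card E) * L\<bar> * r"
  have "norm (gain p x) \<le> ?M * norm x" if p: "p \<in> cball p' r" for p x
  proof -
    have "norm (gain p x) \<le> norm (gain p' x) + norm (gain p x - gain p' x)"
      by (metis add_diff_cancel_left' add.commute diff_add_cancel norm_triangle_ineq)
    also have "\<dots> \<le> M * norm x + \<bar>real (card E) * L\<bar> * r * norm x"
    proof (intro add_mono M(2))
      have "norm (gain p x - gain p' x) \<le> (real (card E) * L) * norm (p - p') * norm x"
        using p r_pos by (intro gain_lipschitz) auto
      also have "\<dots> \<le> \<bar>real (card E) * L\<bar> * r * norm x"
        using p by (intro mult_right_mono mult_mono) (auto simp: dist_norm norm_minus_commute)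
      finally show "norm (gain p x - gain p' x) \<le> \<bar>real (card E) * L\<bar> * r * norm x" .
    qed
    finally show ?thesis by (simp add: distrib_right)
  qed
  moreover have "0 < ?M" using M r_pos by (intro add_pos_nonneg) auto
  ultimately show ?thesis by blast
qed

lemma field_eq: "field p = - gain p (err p)"
proof -
  have "dist_map E p' - dist_map E p = - err p" by (simp add: err_def)
  then show ?thesis by (simp only: field_def linear_neg[OF linear_gain])
qed

lemma err_has_derivative: "(err has_derivative (\<lambda>w. 2 *\<^sub>R rigidity_matrix E p w)) (at p)"
  unfolding err_def by (auto intro!: derivative_eq_intros dist_map_has_derivative)

lemma err_derivative_field: "2 *\<^sub>R rigidity_matrix E p (field p) = - err_gain p (err p)"
  by (simp add: field_eq err_gain_def R.minus_right)

lemma dist_map_lipschitz: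
  "\<exists>K>0. \<forall>p\<in>cball p' r. \<forall>q\<in>cball p' r. norm (dist_map E p - dist_map E q) \<le> K * norm (p - q)"
proof -
  obtain B where B: "0 < B" "\<And>(p :: ('d, 'n) config) w. norm (rigidity_matrix E p w) \<le> norm p * norm w * B"
    using R.pos_bounded by blast
  let ?K = "2 * (norm p' + r) * B"
  have "norm (dist_map E p - dist_map E q) \<le> ?K * norm (p - q)"
    if pq: "p \<in> cball p' r" "q \<in> cball p' r" for p q
  proof -
    have nrm: "norm s \<le> norm p' + r" if "s \<in> cball p' r" for s
      using that norm_triangle_sub[of s p'] by (simp add: dist_norm norm_minus_commute)
    have "dist_map E p - dist_map E q = rigidity_matrix E (p + q) (p - q)"
      by (simp add: dist_map_eq_rigidity_matrix R.add_left R.diff_right rigidity_matrix_commute[of E q p])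
    also have "norm \<dots> \<le> norm (p + q) * norm (p - q) * B" by (rule B(2))
    also have "\<dots> \<le> (2 * (norm p' + r)) * norm (p - q) * B"
      using B(1) nrm[OF pq(1)] nrm[OF pq(2)] norm_triangle_ineq[of p q]
      by (intro mult_right_mono) auto
    finally show ?thesis by (simp add: mult_ac)
  qed
  moreover have "0 < ?K" using B(1) r_pos by (simp add: add_nonneg_pos)
  ultimately show ?thesis by blast
qed

lemma field_le_err: "\<exists>M>0. \<forall>p\<in>cball p' r. norm (field p) \<le> M * norm (err p)"
  using gain_bounded unfolding field_eq norm_minus_cancel by blast

lemma field_lipschitz: "\<exists>C. C-lipschitz_on (cball p' r) field"
proof -
  obtain M where M: "0 < M" "\<And>p x. p \<in> cball p' r \<Longrightarrow> norm (gain p x) \<le> M * norm x"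
    using gain_bounded by blast
  obtain K where K: "0 < K" "\<And>p q. p \<in> cball p' r \<Longrightarrow> q \<in> cball p' r \<Longrightarrow>
      norm (dist_map E p - dist_map E q) \<le> K * norm (p - q)"
    using dist_map_lipschitz by blast
  let ?c = "\<bar>real (card E) * L\<bar>"
  have "(?c * (K * r) + M * K)-lipschitz_on (cball p' r) field"
  proof (rule lipschitz_onI)
    fix p q assume pq: "p \<in> cball p' r" "q \<in> cball p' r"
    have "norm (err p) \<le> K * norm (p - p')"
      unfolding err_def using pq r_pos by (intro K(2)) auto
    also have "\<dots> \<le> K * r"
      using pq K(1) by (intro mult_left_mono) (auto simp: dist_norm norm_minus_commute)
    finally have e: "norm (err p) \<le> K * r" .
    have "field p - field q = - (gain p (err p) - gain q (err p)) - gain q (err p - err q)"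
      by (simp add: field_eq linear_diff[OF linear_gain])
    then have "norm (field p - field q) \<le> norm (gain p (err p) - gain q (err p)) + norm (gain q (err p - err q))"
      by (metis norm_minus_cancel norm_triangle_ineq4)
    also have "\<dots> \<le> ?c * (K * r) * norm (p - q) + M * K * norm (p - q)"
    proof (intro add_mono)
      have "norm (gain p (err p) - gain q (err p)) \<le> (real (card E) * L) * norm (p - q) * norm (err p)"
        by (rule gain_lipschitz[OF pq])
      also have "\<dots> \<le> ?c * norm (p - q) * (K * r)"
        using e by (intro mult_mono) auto
      finally show "norm (gain p (err p) - gain q (err p)) \<le> ?c * (K * r) * norm (p - q)"
        by (simp add: mult_ac)
      have "norm (gain q (err p - err q)) \<le> M * norm (err p - err q)" using M(2) pq by blast
      also have "\<dots> \<le> M * (K * norm (p - q))"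
        using K(2)[OF pq] M(1) by (intro mult_left_mono) (auto simp: err_def)
      finally show "norm (gain q (err p - err q)) \<le> M * K * norm (p - q)" by simp
    qed
    finally show "dist (field p) (field q) \<le> (?c * (K * r) + M * K) * dist p q"
      by (simp add: dist_norm distrib_right)
  next
    show "0 \<le> ?c * (K * r) + M * K" using M K r_pos by simp
  qed
  then show ?thesis by blast
qed

lemma err_gain_near_target:
  "\<exists>C>0. \<forall>p\<in>cball p' r. \<forall>x. norm (err_gain p x - err_gain p' x) \<le> C * norm (p - p') * norm x"
proof -
  obtain B where B: "0 < B" "\<And>(p :: ('d, 'n) config) w. norm (rigidity_matrix E p w) \<le> norm p * norm w * B"
    using R.pos_bounded by blast
  obtain M where M: "0 < M" "\<And>p x. p \<in> cball p' r \<Longrightarrow> norm (gain p x) \<le> M * norm x"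
    using gain_bounded by blast
  let ?c = "\<bar>real (card E) * L\<bar>"
  let ?C = "2 * (M * B + norm p' * ?c * B)"
  have "norm (err_gain p x - err_gain p' x) \<le> ?C * norm (p - p') * norm x"
    if p: "p \<in> cball p' r" for p x
  proof -
    have "err_gain p x - err_gain p' x =
        2 *\<^sub>R (rigidity_matrix E (p - p') (gain p x) + rigidity_matrix E p' (gain p x - gain p' x))"
      by (simp add: err_gain_def R.diff_left R.diff_right scaleR_diff_right scaleR_add_right)
    then have "norm (err_gain p x - err_gain p' x) =
        2 * norm (rigidity_matrix E (p - p') (gain p x) + rigidity_matrix E p' (gain p x - gain p' x))"
      by simp
    also have "\<dots> \<le> 2 * (norm (p - p') * (M * norm x) * B + norm p' * (?c * norm (p - p') * norm x) * B)"
    proof (intro mult_left_mono norm_triangle_le add_mono)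
      show "norm (rigidity_matrix E (p - p') (gain p x)) \<le> norm (p - p') * (M * norm x) * B"
        using M(2)[OF p, of x] B(1)
        by (intro order_trans[OF B(2)] mult_right_mono mult_left_mono) auto
      have "norm (gain p x - gain p' x) \<le> (real (card E) * L) * norm (p - p') * norm x"
        using p r_pos by (intro gain_lipschitz) auto
      also have "\<dots> \<le> ?c * norm (p - p') * norm x" by (intro mult_right_mono) auto
      finally show "norm (rigidity_matrix E p' (gain p x - gain p' x)) \<le> norm p' * (?c * norm (p - p') * norm x) * B"
        using B(1) by (intro order_trans[OF B(2)] mult_right_mono mult_left_mono) auto
    qed simp
    finally show ?thesis by (simp add: algebra_simps)
  qed
  moreover have "0 < ?C" using M B by (simp add: add_pos_nonneg)
  ultimately show ?thesis by blast
qed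


abbreviation "T \<equiv> range (rigidity_matrix E p')"

lemma subspace_T: "subspace T"
  by (intro linear_subspace_image bounded_linear.linear[OF R.bounded_linear_right]) auto

lemma T_subset_edge_space: "T \<subseteq> edge_space E"
  using rigidity_matrix_in_edge_space by blast

lemma target_in_A: "(p', dist_map E p') \<in> A"
  using in_A[of p'] r_pos by simp

lemma err_gain_in_T: "err_gain p' x \<in> T"
  unfolding err_gain_def R.scaleR_right[symmetric] by blast

lemma controller_on_T: "x \<in> T \<Longrightarrow> \<eta> (p', dist_map E p') x = err_gain p' x"
  using err_gain_eq[OF target_in_A] T_subset_edge_space by blast

lemma trajectory_imp_solution:
  assumes "closed_loop_trajectory A \<nu> \<eta> (dist_map E p') p m"
  shows "solves_in (ball p' r) field p"
  unfolding solves_in_def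
proof (intro conjI allI impI)
  have tr: "(p t, m t) \<in> A"
    "(p has_vector_derivative \<nu> (p t, m t) (dist_map E p' - m t)) (at t within {0..})" if "0 \<le> t" for t
    using assms that unfolding closed_loop_trajectory_def by blast+
  show "continuous_on {0..} p"
    using has_vector_derivative_continuous[OF tr(2)] by (auto simp: continuous_on_eq_continuous_within)
  fix t :: real assume t: "0 \<le> t" "p t \<in> ball p' r"
  have m: "m t = dist_map E (p t)" using tr(1)[OF t(1)] subset by (auto simp: state_space_def)
  have "\<nu> (p t, m t) (dist_map E p' - m t) = field (p t)"
    unfolding m field_def
  proof (rule gain_eq)
    show "(p t, dist_map E (p t)) \<in> A" using t(2) by (intro in_A) auto
    show "dist_map E p' - dist_map E (p t) \<in> edge_space E"
      by (intro subspace_diff subspace_edge_space dist_map_in_edge_space)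
  qed
  then show "(p has_vector_derivative field (p t)) (at t within {0..})" using tr(2)[OF t(1)] by simp
qed

lemma solution_imp_trajectory:
  assumes sol: "solves_in (ball p' r) field p" and stay: "\<And>t. 0 \<le> t \<Longrightarrow> p t \<in> ball p' r"
  shows "closed_loop_trajectory A \<nu> \<eta> (dist_map E p') p (\<lambda>t. dist_map E (p t))"
  unfolding closed_loop_trajectory_def
proof (intro allI impI conjI)
  fix t :: real assume t: "0 \<le> t"
  show pA: "(p t, dist_map E (p t)) \<in> A" using stay[OF t] by (intro in_A) auto
  have es: "dist_map E p' - dist_map E (p t) \<in> edge_space E"
    by (intro subspace_diff subspace_edge_space dist_map_in_edge_space)
  have der: "(p has_vector_derivative field (p t)) (at t within {0..})"
    using sol t stay by (simp add: solves_in_def)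
  then show "(p has_vector_derivative \<nu> (p t, dist_map E (p t)) (dist_map E p' - dist_map E (p t)))
      (at t within {0..})"
    by (simp add: gain_eq[OF pA es] field_def)
  have "((\<lambda>t. dist_map E (p t)) has_derivative
      (\<lambda>s. 2 *\<^sub>R rigidity_matrix E (p t) (s *\<^sub>R field (p t)))) (at t within {0..})"
    by (rule has_derivative_compose[OF der[unfolded has_vector_derivative_def] dist_map_has_derivative])
  then have "((\<lambda>t. dist_map E (p t)) has_vector_derivative 2 *\<^sub>R rigidity_matrix E (p t) (field (p t)))
      (at t within {0..})"
    by (simp add: has_vector_derivative_def R.scaleR_right mult.commute)
  then show "((\<lambda>t. dist_map E (p t)) has_vector_derivative
      \<eta> (p t, dist_map E (p t)) (dist_map E p' - dist_map E (p t))) (at t within {0..})"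
    by (simp add: err_gain_eq[OF pA es] field_def err_gain_def)
qed

text \<open>The error is tangent to first order, so a bound on \<open>T\<close> passes to the error with half the constant.\<close>

lemma form_near_target:
  fixes \<Psi> :: "'n edge_vec \<Rightarrow> 'n edge_vec \<Rightarrow> real"
  assumes bil: "bounded_bilinear \<Psi>" and a: "0 < a" "\<And>x. x \<in> T \<Longrightarrow> a * (norm x)\<^sup>2 \<le> \<Psi> x x"
  shows "\<exists>\<epsilon>>0. \<forall>p\<in>ball p' \<epsilon>. a / 2 * (norm (err p))\<^sup>2 \<le> \<Psi> (err p) (err p)"
proof -
  interpret \<Psi>: bounded_bilinear \<Psi> by fact
  obtain K where K: "0 < K" "\<And>x y. \<bar>\<Psi> x y\<bar> \<le> norm x * norm y * K" using \<Psi>.pos_bounded by auto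
  \<comment> \<open>If \<open>norm (w - v) \<le> d norm w\<close> with \<open>v \<in> T\<close>, passing from \<open>v\<close> to \<open>w\<close> costs at most \<open>d (2 a + 3 K) (norm w)\<^sup>2\<close>.\<close>
  define d where "d = min 1 (a / (2 * (2 * a + 3 * K)))"
  have d: "0 < d" "d \<le> 1" using a K by (auto simp: d_def)
  have d_le: "d * (2 * a + 3 * K) \<le> a / 2"
  proof -
    have "d * (2 * a + 3 * K) \<le> a / (2 * (2 * a + 3 * K)) * (2 * a + 3 * K)"
      using a K by (intro mult_right_mono) (auto simp: d_def)
    also have "\<dots> = a / 2"
    proof -
      have cancel: "a / (2 * s) * s = a / 2" if "s \<noteq> 0" for s :: real using that by simp
      have "2 * a + 3 * K \<noteq> 0" using a(1) K(1) by linarith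
      then show ?thesis by (rule cancel)
    qed
    finally show ?thesis .
  qed
  let ?N = "range (dist_map E :: ('d, 'n) config \<Rightarrow> _)"
  have reg: "dist_map E p' \<in> regular_values TYPE('d) E" using regular by (simp add: regular_configs_def)
  have TN: "tangent_space ?N (dist_map E p') = T" using regular_values_D(2)[OF reg refl] .
  obtain W where W: "open W" "dist_map E p' \<in> W" "embedded_submanifold (?N \<inter> W)"
    using regular_values_D(1)[OF reg] by (elim exE conjE)
  obtain \<delta> where \<delta>: "0 < \<delta>" "\<And>y. y \<in> ?N \<Longrightarrow> dist y (dist_map E p') < \<delta> \<Longrightarrow>
      \<exists>v\<in>T. norm (y - dist_map E p' - v) \<le> d * norm (y - dist_map E p')"
    using submanifold_near_tangent_space(3)[OF W(1,3) rangeI W(2) d(1)] unfolding TN by auto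
  obtain \<epsilon> where \<epsilon>: "0 < \<epsilon>" "\<And>p. dist p p' < \<epsilon> \<Longrightarrow> dist (dist_map E p) (dist_map E p') < \<delta>"
  proof -
    have "isCont (dist_map E) p'" by (rule has_derivative_continuous[OF dist_map_has_derivative])
    then show thesis using \<delta>(1) that unfolding continuous_at_eps_delta by blast
  qed
  have "a / 2 * (norm (err p))\<^sup>2 \<le> \<Psi> (err p) (err p)" if p: "p \<in> ball p' \<epsilon>" for p
  proof -
    let ?w = "err p"
    have "dist (dist_map E p) (dist_map E p') < \<delta>" using \<epsilon>(2)[of p] p by (simp add: dist_commute[of p])
    from \<delta>(2)[OF rangeI this] obtain v where v: "v \<in> T" "norm (?w - v) \<le> d * norm ?w"
      unfolding err_def by blast
    have vup: "norm v \<le> 2 * norm ?w"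
    proof -
      have "norm v \<le> norm ?w + norm (?w - v)" by (metis norm_minus_commute norm_triangle_sub)
      also have "\<dots> \<le> norm ?w + 1 * norm ?w"
        using v(2) d(2) by (intro add_left_mono order_trans[OF v(2)] mult_right_mono) auto
      finally show ?thesis by simp
    qed
    have "(1 - d) * norm ?w \<le> norm v"
      using v(2) norm_triangle_sub[of ?w v] by (simp add: algebra_simps)
    then have "((1 - d) * norm ?w)\<^sup>2 \<le> (norm v)\<^sup>2"
      using d by (intro power_mono) auto
    moreover have "(1 - 2 * d) * (norm ?w)\<^sup>2 \<le> ((1 - d) * norm ?w)\<^sup>2"
      unfolding power_mult_distrib by (intro mult_right_mono) (auto simp: power2_eq_square algebra_simps)
    ultimately have vlow: "(1 - 2 * d) * (norm ?w)\<^sup>2 \<le> (norm v)\<^sup>2" by linarith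
    have "\<Psi> ?w ?w = \<Psi> v v + \<Psi> v (?w - v) + \<Psi> (?w - v) ?w"
      by (simp add: \<Psi>.diff_left \<Psi>.diff_right)
    moreover have "\<bar>\<Psi> v (?w - v)\<bar> \<le> 2 * K * d * (norm ?w)\<^sup>2"
    proof -
      have "\<bar>\<Psi> v (?w - v)\<bar> \<le> norm v * norm (?w - v) * K" by (rule K(2))
      also have "\<dots> \<le> (2 * norm ?w) * (d * norm ?w) * K"
        using vup v(2) K(1) by (intro mult_right_mono mult_mono) auto
      finally show ?thesis by (simp add: power2_eq_square mult_ac)
    qed
    moreover have "\<bar>\<Psi> (?w - v) ?w\<bar> \<le> K * d * (norm ?w)\<^sup>2"
    proof -
      have "\<bar>\<Psi> (?w - v) ?w\<bar> \<le> norm (?w - v) * norm ?w * K" by (rule K(2))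
      also have "\<dots> \<le> (d * norm ?w) * norm ?w * K"
        using v(2) K(1) by (intro mult_right_mono) auto
      finally show ?thesis by (simp add: power2_eq_square mult_ac)
    qed
    moreover have "a * ((1 - 2 * d) * (norm ?w)\<^sup>2) \<le> \<Psi> v v"
      using a(2)[OF v(1)] mult_left_mono[OF vlow, of a] a(1) by linarith
    ultimately have "a * ((1 - 2 * d) * (norm ?w)\<^sup>2) - 2 * K * d * (norm ?w)\<^sup>2 - K * d * (norm ?w)\<^sup>2
        \<le> \<Psi> ?w ?w" by linarith
    moreover have "a * ((1 - 2 * d) * (norm ?w)\<^sup>2) - 2 * K * d * (norm ?w)\<^sup>2 - K * d * (norm ?w)\<^sup>2
        = (a - d * (2 * a + 3 * K)) * (norm ?w)\<^sup>2" by (simp add: algebra_simps)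
    moreover have "a / 2 * (norm ?w)\<^sup>2 \<le> (a - d * (2 * a + 3 * K)) * (norm ?w)\<^sup>2"
      using d_le by (intro mult_right_mono) auto
    ultimately show ?thesis by linarith
  qed
  then show ?thesis using \<epsilon>(1) by blast
qed

text \<open>The velocity of the error is \<open>- err_gain p (err p)\<close>, which differs from \<open>- err_gain p' (err p)\<close> by
  at most a small multiple of the error.\<close>

lemma closed_loop_form_near_target:
  fixes V :: "'n edge_vec \<Rightarrow> 'n edge_vec \<Rightarrow> real"
  assumes V: "bounded_bilinear V"
    and a: "0 < a" "\<And>x. x \<in> T \<Longrightarrow> a * (norm x)\<^sup>2 \<le> V x (- err_gain p' x - \<beta> *\<^sub>R x)"
  shows "\<exists>\<epsilon>>0. \<forall>p\<in>ball p' \<epsilon>. a / 4 * (norm (err p))\<^sup>2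
           \<le> V (err p) (2 *\<^sub>R rigidity_matrix E p (field p)) - \<beta> * V (err p) (err p)"
proof -
  interpret V: bounded_bilinear V by fact
  obtain K where K: "0 < K" "\<And>x y. \<bar>V x y\<bar> \<le> norm x * norm y * K" using V.pos_bounded by auto
  define \<Psi> where "\<Psi> = (\<lambda>x y. V x (- err_gain p' y - \<beta> *\<^sub>R y))"
  have "linear (\<lambda>y. - err_gain p' y - \<beta> *\<^sub>R y)"
    by (intro linear_compose_sub linear_compose_neg linear_err_gain linear_compose_scale_right linear_ident)
  then have "bounded_linear (\<lambda>y. - err_gain p' y - \<beta> *\<^sub>R y)" by (simp add: linear_conv_bounded_linear)
  then have "bounded_bilinear \<Psi>"
    unfolding \<Psi>_def by (rule V.comp[OF bounded_linear_ident])
  then obtain \<epsilon>1 where \<epsilon>1: "0 < \<epsilon>1" "\<And>p. p \<in> ball p' \<epsilon>1 \<Longrightarrow> a / 2 * (norm (err p))\<^sup>2 \<le> \<Psi> (err p) (err p)"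
    using form_near_target[of \<Psi> a] a unfolding \<Psi>_def by blast
  obtain C where C: "0 < C" "\<And>p x. p \<in> cball p' r \<Longrightarrow>
      norm (err_gain p x - err_gain p' x) \<le> C * norm (p - p') * norm x"
    using err_gain_near_target by blast
  define \<epsilon> where "\<epsilon> = min (min \<epsilon>1 r) (a / (4 * K * C))"
  have "0 < \<epsilon>" using \<epsilon>1 r_pos a K C by (simp add: \<epsilon>_def)
  moreover have "a / 4 * (norm (err p))\<^sup>2
      \<le> V (err p) (2 *\<^sub>R rigidity_matrix E p (field p)) - \<beta> * V (err p) (err p)"
    if p: "p \<in> ball p' \<epsilon>" for p
  proof -
    let ?w = "err p"
    have pr: "p \<in> cball p' r" "p \<in> ball p' \<epsilon>1" "norm (p - p') \<le> a / (4 * K * C)"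
      using p by (auto simp: \<epsilon>_def dist_norm norm_minus_commute)
    have "\<bar>V ?w (err_gain p ?w - err_gain p' ?w)\<bar> \<le> norm ?w * norm (err_gain p ?w - err_gain p' ?w) * K"
      by (rule K(2))
    also have "\<dots> \<le> norm ?w * (C * (a / (4 * K * C)) * norm ?w) * K"
    proof (intro mult_right_mono mult_left_mono)
      have "norm (err_gain p ?w - err_gain p' ?w) \<le> C * norm (p - p') * norm ?w" using C(2) pr(1) by blast
      also have "\<dots> \<le> C * (a / (4 * K * C)) * norm ?w"
        using pr(3) C(1) by (intro mult_right_mono mult_left_mono) auto
      finally show "norm (err_gain p ?w - err_gain p' ?w) \<le> C * (a / (4 * K * C)) * norm ?w" .
    qed (use K(1) in auto)
    also have "\<dots> = a / 4 * (norm ?w)\<^sup>2" using K(1) C(1) by (simp add: power2_eq_square)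
    finally have "\<bar>V ?w (err_gain p ?w - err_gain p' ?w)\<bar> \<le> a / 4 * (norm ?w)\<^sup>2" .
    moreover have "V ?w (2 *\<^sub>R rigidity_matrix E p (field p)) - \<beta> * V ?w ?w
        = \<Psi> ?w ?w - V ?w (err_gain p ?w - err_gain p' ?w)"
      unfolding err_derivative_field by (simp add: \<Psi>_def V.diff_right V.minus_right V.scaleR_right)
    moreover have "a / 2 * (norm ?w)\<^sup>2 \<le> \<Psi> ?w ?w" using \<epsilon>1(2) pr(2) by blast
    ultimately show ?thesis by linarith
  qed
  ultimately show ?thesis by blast
qed

text \<open>The neighbourhood \<open>U\<close> consists of the starts from which the path length still to come cannot carry
  the configuration out of the ball. Trajectories exist because composing the field with the
  nearest-point projection onto a closed ball makes it globally Lipschitz and bounded, and the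
  solutions that matter never notice the modification.\<close>

lemma Hurwitz_imp_stable:
  assumes N: "open N" "p' \<in> N" "\<And>q. q \<in> N \<Longrightarrow> dist_map E q = dist_map E p' \<Longrightarrow> congruent_configs p' q"
    and H: "Hurwitz_on T (\<lambda>v. - \<eta> (p', dist_map E p') v)"
  shows "locally_exp_stable E A \<nu> \<eta> p'"
proof -
  let ?f = "\<lambda>x. - err_gain p' x"
  have f: "linear ?f" by (intro linear_compose_neg linear_err_gain)
  have fT: "?f ` T \<subseteq> T" using err_gain_in_T subspace_neg[OF subspace_T] by blast
  have "Hurwitz_on T ?f"
    using H eigenvalue_on_cong[of T ?f "\<lambda>v. - \<eta> (p', dist_map E p') v"] controller_on_T
    unfolding Hurwitz_on_def by simp
  from Hurwitz_lyapunov_form[OF f subspace_T fT this]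
  obtain V a where V: "bounded_bilinear V" "\<forall>x y. V x y = V y x" "(0::real) < a"
      "\<forall>x\<in>T. a * (norm x)\<^sup>2 \<le> V x (?f x)" "\<forall>x\<in>T. V x x \<le> - a * (norm x)\<^sup>2"
    by (elim exE conjE)
  have V4: "a * (norm x)\<^sup>2 \<le> V x (- err_gain p' x - 0 *\<^sub>R x)" if "x \<in> T" for x
    using bspec[OF V(4) that] by simp
  have V5: "a * (norm x)\<^sup>2 \<le> - V x x" if "x \<in> T" for x
    using bspec[OF V(5) that] by simp
  interpret V: bounded_bilinear V by fact
  define V' where "V' = (\<lambda>x y. - V x y)"
  have V': "bounded_bilinear V'" "V' x y = V' y x" for x y
  proof -
    have "bounded_bilinear (\<lambda>x y. V (- x) y)"
      by (rule V.comp[OF _ bounded_linear_ident]) (intro bounded_linear_minus bounded_linear_ident)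
    then show "bounded_bilinear V'" by (simp add: V'_def V.minus_left)
    show "V' x y = V' y x" unfolding V'_def using V(2) by simp
  qed
  obtain D where D: "0 < D" "\<And>x y. \<bar>V' x y\<bar> \<le> norm x * norm y * D"
    using bounded_bilinear.pos_bounded[OF V'(1)] by auto
  obtain \<epsilon>1 where \<epsilon>1: "0 < \<epsilon>1" "\<And>p. p \<in> ball p' \<epsilon>1 \<Longrightarrow> a / 4 * (norm (err p))\<^sup>2
           \<le> V (err p) (2 *\<^sub>R rigidity_matrix E p (field p)) - 0 * V (err p) (err p)"
    using closed_loop_form_near_target[OF V(1,3) V4] by blast
  obtain \<epsilon>2 where \<epsilon>2: "0 < \<epsilon>2" "\<And>p. p \<in> ball p' \<epsilon>2 \<Longrightarrow> a / 2 * (norm (err p))\<^sup>2 \<le> V' (err p) (err p)"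
    using form_near_target[OF V'(1) V(3)] V5 unfolding V'_def by blast
  obtain \<epsilon>3 where \<epsilon>3: "0 < \<epsilon>3" "ball p' \<epsilon>3 \<subseteq> N" using N(1,2) by (rule openE)
  define \<epsilon> where "\<epsilon> = min (min \<epsilon>1 \<epsilon>2) (min \<epsilon>3 (r / 2))"
  have \<epsilon>: "0 < \<epsilon>" "ball p' \<epsilon> \<subseteq> ball p' \<epsilon>1" "ball p' \<epsilon> \<subseteq> ball p' \<epsilon>2" "ball p' \<epsilon> \<subseteq> N"
      "cball p' \<epsilon> \<subseteq> ball p' r" "ball p' \<epsilon> \<subseteq> ball p' r"
    using \<epsilon>1(1) \<epsilon>2(1) \<epsilon>3 r_pos by (auto simp: \<epsilon>_def subset_iff)
  \<comment> \<open>Since \<open>V' w w \<le> D (norm w)\<^sup>2\<close>, a decrease by \<open>a / 4 (norm w)\<^sup>2\<close> is one by \<open>\<kappa> V' w w\<close>.\<close>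
  define \<kappa> where "\<kappa> = a / (4 * D)"
  have \<kappa>: "0 < \<kappa>" using V(3) D(1) by (simp add: \<kappa>_def)
  have dec: "V' (err p) (2 *\<^sub>R rigidity_matrix E p (field p)) \<le> - \<kappa> * V' (err p) (err p)"
    if p: "p \<in> ball p' \<epsilon>" for p
  proof -
    have "\<kappa> * V' (err p) (err p) \<le> \<kappa> * (norm (err p) * norm (err p) * D)"
      using D(2)[of "err p" "err p"] \<kappa> by (intro mult_left_mono) auto
    also have "\<dots> = a / 4 * (norm (err p))\<^sup>2" using D(1) by (simp add: \<kappa>_def power2_eq_square)
    also have "\<dots> \<le> - V' (err p) (2 *\<^sub>R rigidity_matrix E p (field p))"
      using \<epsilon>1(2)[of p] p \<epsilon>(2) by (auto simp: V'_def)
    finally show ?thesis by simp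
  qed
  obtain M where M: "0 < M" "\<And>p. p \<in> cball p' r \<Longrightarrow> norm (field p) \<le> M * norm (err p)"
    using field_le_err by blast
  obtain R where R: "0 < R" "\<And>p. solves_in (ball p' \<epsilon>) field p \<Longrightarrow> dist p' (p 0) + R * norm (err (p 0)) < \<epsilon> \<Longrightarrow>
    (\<forall>t\<ge>0. p t \<in> ball p' \<epsilon>) \<and>
    (\<exists>q. dist p' q \<le> dist p' (p 0) + R * norm (err (p 0)) \<and> err q = 0 \<and>
      (\<forall>t\<ge>0. norm (p t - q) \<le> R * norm (err (p 0)) * exp (- \<kappa> * t)))"
  proof (rule exponential_convergence[OF V' err_has_derivative dec \<kappa>])
    show "0 < a / 2" using V(3) by simp
    show "a / 2 * (norm (err x))\<^sup>2 \<le> V' (err x) (err x)" if "x \<in> ball p' \<epsilon>" for x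
      using \<epsilon>2(2) \<epsilon>(3) that by blast
    show "0 \<le> M" using M(1) by simp
    show "norm (field x) \<le> M * norm (err x)" if "x \<in> ball p' \<epsilon>" for x
      using M(2)[of x] \<epsilon>(6) that by auto
  qed (assumption | rule that)+
  define U where "U = {p. dist p' p + R * norm (err p) < \<epsilon>}"
  have contF: "continuous_on UNIV err"
    using has_derivative_continuous[OF err_has_derivative] by (intro continuous_at_imp_continuous_on) blast
  have "open U"
    unfolding U_def by (intro open_Collect_less continuous_intros contF)
  moreover have "p' \<in> U" using \<epsilon>(1) by (simp add: U_def err_def)
  moreover have conv: "\<exists>q\<in>U. congruent_configs p' q \<and> (\<forall>t\<ge>0. norm (p t - q) \<le> \<epsilon> * exp (- \<kappa> * t))"
    if p: "solves_in (ball p' \<epsilon>) field p" "p 0 \<in> U" for p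
  proof -
    have start: "dist p' (p 0) + R * norm (err (p 0)) < \<epsilon>" using p(2) by (simp add: U_def)
    from R(2)[OF p(1) start] obtain q where q: "dist p' q \<le> dist p' (p 0) + R * norm (err (p 0))" "err q = 0"
      "\<And>t. 0 \<le> t \<Longrightarrow> norm (p t - q) \<le> R * norm (err (p 0)) * exp (- \<kappa> * t)" by blast
    have "dist p' q < \<epsilon>" using q(1) start by linarith
    then have "q \<in> U" "q \<in> N" using q(2) \<epsilon>(4) by (auto simp: U_def)
    moreover have "dist_map E q = dist_map E p'" using q(2) by (simp add: err_def)
    moreover have "norm (p t - q) \<le> \<epsilon> * exp (- \<kappa> * t)" if "0 \<le> t" for t
    proof -
      have "R * norm (err (p 0)) \<le> \<epsilon>" using start zero_le_dist[of p' "p 0"] by linarith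
      then show ?thesis using q(3)[OF that] by (meson exp_ge_zero mult_right_mono order_trans)
    qed
    ultimately show ?thesis using N(3) by blast
  qed
  moreover have "\<exists>p m. closed_loop_trajectory A \<nu> \<eta> (dist_map E p') p m \<and> p 0 = p0 \<and> m 0 = dist_map E p0"
    if p0: "p0 \<in> U" for p0
  proof -
    let ?c = "closest_point (cball p' \<epsilon>)"
    have ne: "cball p' \<epsilon> \<noteq> {}" using \<epsilon>(1) by simp
    obtain C where "C-lipschitz_on (cball p' r) field" using field_lipschitz by blast
    moreover have cb: "cball p' \<epsilon> \<subseteq> cball p' r" using \<epsilon>(5) ball_subset_cball by blast
    ultimately have C: "C-lipschitz_on (cball p' \<epsilon>) field" by (rule lipschitz_on_subset)
    have c_in: "?c x \<in> cball p' \<epsilon>" for x by (rule closest_point_in_set[OF closed_cball ne])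
    have "1-lipschitz_on UNIV ?c"
      using closest_point_lipschitz[OF convex_cball closed_cball ne] by (intro lipschitz_onI) auto
    moreover have "C-lipschitz_on (range ?c) field"
      by (rule lipschitz_on_subset[OF C]) (use c_in in blast)
    ultimately have lip: "(C * 1)-lipschitz_on UNIV (\<lambda>x. field (?c x))"
      by (rule lipschitz_on_compose2[where f = ?c and g = field])
    have "compact (field ` cball p' \<epsilon>)"
      using lipschitz_on_continuous_on[OF C] by (intro compact_continuous_image) auto
    then have "bounded (field ` cball p' \<epsilon>)" by (rule compact_imp_bounded)
    then obtain B where B: "\<forall>y\<in>field ` cball p' \<epsilon>. norm y \<le> B" unfolding bounded_iff by (elim exE)
    have Bc: "norm (field (?c x)) \<le> B" for x by (rule bspec[OF B imageI[OF c_in]])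
    obtain p where p: "p 0 = p0" "continuous_on {0..} p"
      "\<And>t. 0 \<le> t \<Longrightarrow> (p has_vector_derivative field (?c (p t))) (at t within {0..})"
      by (rule global_solution_exists[OF lip Bc, of p0]) blast
    have self: "?c x = x" if "x \<in> ball p' \<epsilon>" for x
      using that ball_subset_cball by (intro closest_point_self) blast
    have sol: "solves_in (ball p' \<epsilon>) field p"
      unfolding solves_in_def
    proof (intro conjI allI impI p(2))
      fix t :: real assume "0 \<le> t" "p t \<in> ball p' \<epsilon>"
      then show "(p has_vector_derivative field (p t)) (at t within {0..})" using p(3)[of t] self by simp
    qed
    have stay: "p t \<in> ball p' \<epsilon>" if "0 \<le> t" for t
      using R(2)[OF sol] p0 that by (simp add: U_def p(1))
    have "solves_in (ball p' r) field p"
      unfolding solves_in_def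
    proof (intro conjI allI impI p(2))
      fix t :: real assume "0 \<le> t"
      then show "(p has_vector_derivative field (p t)) (at t within {0..})" using p(3)[of t] self stay by simp
    qed
    then have "closed_loop_trajectory A \<nu> \<eta> (dist_map E p') p (\<lambda>t. dist_map E (p t))"
      using stay \<epsilon>(6) by (intro solution_imp_trajectory) blast+
    then show ?thesis using p(1) by blast
  qed
  moreover have "solves_in (ball p' \<epsilon>) field p" if "closed_loop_trajectory A \<nu> \<eta> (dist_map E p') p m" for p m
    using solves_in_subset[OF trajectory_imp_solution[OF that] \<epsilon>(6)] .
  ultimately have "\<forall>p0\<in>U.
        (\<exists>p m. closed_loop_trajectory A \<nu> \<eta> (dist_map E p') p m \<and> p 0 = p0 \<and> m 0 = dist_map E p0) \<and>
        (\<forall>p m. closed_loop_trajectory A \<nu> \<eta> (dist_map E p') p m \<and> p 0 = p0 \<and> m 0 = dist_map E p0 \<longrightarrow>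
           (\<exists>q\<in>U. congruent_configs p' q \<and> (\<forall>t\<ge>0. norm (p t - q) \<le> \<epsilon> * exp (- \<kappa> * t))))"
    by blast
  with \<open>open U\<close> \<open>p' \<in> U\<close> \<epsilon>(1) \<kappa> show ?thesis
    unfolding locally_exp_stable_def by blast
qed


text \<open>A displacement \<open>h w\<close> of the target with \<open>2 R p' w = x\<close> produces the error \<open>h (x + h F w)\<close> exactly,
  and \<open>V\<close> is positive near \<open>x\<close>.\<close>

lemma small_perturbation_positive:
  fixes V :: "'n edge_vec \<Rightarrow> 'n edge_vec \<Rightarrow> real"
  assumes V: "bounded_bilinear V" and x: "x \<in> T" "0 < V x x" and U: "open U" "p' \<in> U"
  shows "\<exists>p\<in>U. 0 < V (err p) (err p)"
proof -
  interpret V: bounded_bilinear V by fact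
  obtain w0 where w0: "x = rigidity_matrix E p' w0" using x(1) by blast
  define w where "w = (1/2) *\<^sub>R w0"
  have w: "2 *\<^sub>R rigidity_matrix E p' w = x" by (simp add: w_def w0 R.scaleR_right)
  define b where "b = dist_map E w"
  have "continuous_on UNIV (\<lambda>h::real. V (x + h *\<^sub>R b) (x + h *\<^sub>R b))"
    by (intro V.continuous_on continuous_intros)
  then have "open ((\<lambda>h::real. V (x + h *\<^sub>R b) (x + h *\<^sub>R b)) -` {0<..})"
    by (intro open_vimage open_greaterThan)
  moreover have "open ((\<lambda>h::real. p' + h *\<^sub>R w) -` U)"
    by (intro open_vimage U(1) continuous_intros)
  ultimately have op: "open ((\<lambda>h::real. V (x + h *\<^sub>R b) (x + h *\<^sub>R b)) -` {0<..} \<inter> (\<lambda>h. p' + h *\<^sub>R w) -` U)"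
    by (rule open_Int)
  have z: "0 \<in> (\<lambda>h::real. V (x + h *\<^sub>R b) (x + h *\<^sub>R b)) -` {0<..} \<inter> (\<lambda>h. p' + h *\<^sub>R w) -` U"
    using x(2) U(2) by simp
  obtain e where e: "0 < e" "ball 0 e \<subseteq> (\<lambda>h::real. V (x + h *\<^sub>R b) (x + h *\<^sub>R b)) -` {0<..} \<inter> (\<lambda>h. p' + h *\<^sub>R w) -` U"
    using op z by (rule openE)
  define h where "h = e / 2"
  have "h \<in> ball 0 e" and h0: "0 < h" using e(1) by (simp_all add: h_def)
  from subsetD[OF e(2) this(1)] have h: "0 < V (x + h *\<^sub>R b) (x + h *\<^sub>R b)" "p' + h *\<^sub>R w \<in> U"
    by simp_all
  have "err (p' + h *\<^sub>R w) = h *\<^sub>R (x + h *\<^sub>R b)"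
    unfolding err_def dist_map_line w b_def[symmetric] by (simp add: scaleR_add_right power2_eq_square)
  then have "V (err (p' + h *\<^sub>R w)) (err (p' + h *\<^sub>R w)) = h * h * V (x + h *\<^sub>R b) (x + h *\<^sub>R b)"
    by (simp only: V.scaleR_left V.scaleR_right) simp
  also have "\<dots> > 0" using h(1) h0 by simp
  finally show ?thesis using h(2) by blast
qed

text \<open>Choose \<open>\<tau>\<close> such that the exponential bound is below \<open>\<epsilon> / 4\<close> from time \<open>\<tau>\<close> on. Up to time \<open>\<tau>\<close> the
  trajectory is within \<open>\<epsilon> / 4\<close> of the equilibrium, if it starts close enough to it. At time \<open>\<tau>\<close> it is
  near both the target and its limit \<open>q\<close>, and from then on it stays near \<open>q\<close>.\<close>

lemma stable_imp_confined:
  assumes stable: "open U" "p' \<in> U" "0 < K" "0 < c"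
      "\<forall>p m. closed_loop_trajectory A \<nu> \<eta> (dist_map E p') p m \<and> p 0 \<in> U \<and> m 0 = dist_map E (p 0) \<longrightarrow>
         (\<exists>q\<in>U. congruent_configs p' q \<and> (\<forall>t\<ge>0. norm (p t - q) \<le> K * exp (- c * t)))"
    and \<epsilon>: "0 < \<epsilon>" "\<epsilon> \<le> r"
  shows "\<exists>\<delta>>0. \<forall>p m. closed_loop_trajectory A \<nu> \<eta> (dist_map E p') p m \<longrightarrow> p 0 \<in> U \<inter> ball p' \<delta> \<longrightarrow>
    m 0 = dist_map E (p 0) \<longrightarrow>
    (\<forall>t\<ge>0. p t \<in> ball p' \<epsilon>) \<and> (\<exists>q\<in>ball p' \<epsilon>. err q = 0 \<and> (\<forall>t\<ge>0. norm (p t - q) \<le> K * exp (- c * t)))"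
proof -
  obtain M where M: "0 < M" "\<And>p. p \<in> cball p' r \<Longrightarrow> norm (field p) \<le> M * norm (err p)"
    using field_le_err by blast
  obtain F where F: "0 < F" "\<And>p q. p \<in> cball p' r \<Longrightarrow> q \<in> cball p' r \<Longrightarrow>
      norm (dist_map E p - dist_map E q) \<le> F * norm (p - q)"
    using dist_map_lipschitz by blast
  have G: "norm (field x) \<le> (M * F) * dist p' x" if x: "x \<in> ball p' \<epsilon>" for x
  proof -
    have xr: "x \<in> cball p' r" "p' \<in> cball p' r" using x \<epsilon>(2) r_pos by auto
    have "norm (field x) \<le> M * norm (err x)" by (rule M(2)[OF xr(1)])
    also have "\<dots> \<le> M * (F * norm (x - p'))"
      unfolding err_def using F(2)[OF xr] M(1) by (intro mult_left_mono) auto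
    finally show ?thesis by (simp add: dist_norm norm_minus_commute)
  qed
  have "0 < \<epsilon> / 4" using \<epsilon>(1) by simp
  from exp_eventually_small[OF stable(4) this, of K]
  obtain \<tau> where \<tau>: "0 \<le> \<tau>" "K * exp (- c * \<tau>) < \<epsilon> / 4" by (elim exE conjE)
  define \<delta> where "\<delta> = \<epsilon> / 4 / exp (M * F * \<tau>)"
  have \<delta>: "0 < \<delta>" using \<epsilon>(1) by (simp add: \<delta>_def)
  have "(\<forall>t\<ge>0. p t \<in> ball p' \<epsilon>) \<and> (\<exists>q\<in>ball p' \<epsilon>. err q = 0 \<and> (\<forall>t\<ge>0. norm (p t - q) \<le> K * exp (- c * t)))"
    if tr: "closed_loop_trajectory A \<nu> \<eta> (dist_map E p') p m" and p0: "p 0 \<in> U \<inter> ball p' \<delta>"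
      and m0: "m 0 = dist_map E (p 0)" for p m
  proof -
    have p0U: "p 0 \<in> U" "dist p' (p 0) < \<delta>" using p0 by auto
    from stable(5) tr p0U(1) m0 obtain q where q: "congruent_configs p' q"
      "\<And>t. 0 \<le> t \<Longrightarrow> norm (p t - q) \<le> K * exp (- c * t)" by blast
    have sol: "solves_in (ball p' \<epsilon>) field p"
      by (rule solves_in_subset[OF trajectory_imp_solution[OF tr]]) (use \<epsilon>(2) in auto)
    have small: "exp (M * F * \<tau>) * dist p' (p 0) < \<epsilon> / 4"
      using p0U(2) by (simp add: \<delta>_def pos_less_divide_eq mult.commute)
    then have small': "exp (M * F * \<tau>) * dist p' (p 0) < \<epsilon>" using \<epsilon>(1) by linarith
    have MF: "0 \<le> M * F" using M(1) F(1) by simp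
    have early: "dist p' (p t) < \<epsilon> / 4" if "0 \<le> t" "t \<le> \<tau>" for t
      using solution_near_equilibrium[OF G sol MF \<tau>(1) small' that] small by linarith
    have "norm (p \<tau> - q) < \<epsilon> / 4" using q(2)[OF \<tau>(1)] \<tau>(2) by linarith
    then have dq: "dist p' q < \<epsilon> / 2"
      using early[OF \<tau>(1) order_refl] dist_triangle[of p' q "p \<tau>"] by (simp add: dist_norm)
    have "p t \<in> ball p' \<epsilon>" if t: "0 \<le> t" for t
    proof (cases "t \<le> \<tau>")
      case True
      then show ?thesis using early[OF t] \<epsilon>(1) by simp
    next
      case False
      have "norm (p t - q) \<le> K * exp (- c * t)" by (rule q(2)[OF t])
      also have "\<dots> \<le> K * exp (- c * \<tau>)"
        using False stable(3,4) by (intro mult_left_mono) auto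
      finally have "dist q (p t) < \<epsilon> / 4" using \<tau>(2) by (simp add: dist_norm norm_minus_commute)
      then have "dist p' (p t) < \<epsilon>" using dq dist_triangle[of p' "p t" q] \<epsilon>(1) by linarith
      then show ?thesis by simp
    qed
    moreover have "q \<in> ball p' \<epsilon>" using dq \<epsilon>(1) by simp
    moreover have "err q = 0" using congruent_configs_imp_dist_map_eq[OF q(1)] by (simp add: err_def)
    ultimately show ?thesis using q(2) by blast
  qed
  then show ?thesis using \<delta> by blast
qed

text \<open>The bound on the trajectory is not proportional to its initial error, so linearising the flow at
  the target gives no contradiction. What contradicts it is a single trajectory with
  \<open>V(w, w) > 0\<close>: such a trajectory cannot lose more than the factor \<open>exp (- 2 \<beta> t)\<close>.\<close>

lemma stable_imp_Hurwitz:
  assumes "locally_exp_stable E A \<nu> \<eta> p'"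
  shows "Hurwitz_on T (\<lambda>v. - \<eta> (p', dist_map E p') v)"
proof (rule ccontr)
  let ?f = "\<lambda>x. - err_gain p' x"
  have f: "linear ?f" by (intro linear_compose_neg linear_err_gain)
  have fT: "?f ` T \<subseteq> T" using err_gain_in_T subspace_neg[OF subspace_T] by blast
  assume "\<not> ?thesis"
  then obtain \<mu> where "eigenvalue_on T (\<lambda>v. - \<eta> (p', dist_map E p') v) \<mu>" and Re: "0 \<le> Re \<mu>"
    unfolding Hurwitz_on_def by (auto simp: not_less)
  then have \<mu>: "eigenvalue_on T ?f \<mu>"
    using eigenvalue_on_cong[of T ?f "\<lambda>v. - \<eta> (p', dist_map E p') v"] controller_on_T by simp
  obtain U K c where U: "open U" "p' \<in> U" "0 < K" "0 < c" and st: "\<forall>p0\<in>U.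
        (\<exists>p m. closed_loop_trajectory A \<nu> \<eta> (dist_map E p') p m \<and> p 0 = p0 \<and> m 0 = dist_map E p0) \<and>
        (\<forall>p m. closed_loop_trajectory A \<nu> \<eta> (dist_map E p') p m \<and> p 0 = p0 \<and> m 0 = dist_map E p0 \<longrightarrow>
           (\<exists>q\<in>U. congruent_configs p' q \<and> (\<forall>t\<ge>0. norm (p t - q) \<le> K * exp (- c * t))))"
    using assms unfolding locally_exp_stable_def by (elim exE conjE)
  from unstable_lyapunov_form[OF f subspace_T fT \<mu> Re U(4)]
  obtain \<beta> V a x where \<beta>: "0 < \<beta>" "\<beta> < c" and V: "bounded_bilinear V" "\<forall>x y. V x y = V y x" "(0::real) < a"
    "\<forall>x\<in>T. a * (norm x)\<^sup>2 \<le> V x (?f x - (- \<beta>) *\<^sub>R x)" and x: "x \<in> T" "0 < V x x"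
    by (elim exE conjE)
  interpret V: bounded_bilinear V by fact
  have V4: "a * (norm x)\<^sup>2 \<le> V x (?f x - (- \<beta>) *\<^sub>R x)" if "x \<in> T" for x
    by (rule bspec[OF V(4) that])
  obtain D where D: "0 < D" "\<And>x y. \<bar>V x y\<bar> \<le> norm x * norm y * D" using V.pos_bounded by auto
  obtain \<epsilon>1 where \<epsilon>1: "0 < \<epsilon>1" "\<forall>p\<in>ball p' \<epsilon>1. a / 4 * (norm (err p))\<^sup>2
           \<le> V (err p) (2 *\<^sub>R rigidity_matrix E p (field p)) - (- \<beta>) * V (err p) (err p)"
    using closed_loop_form_near_target[OF V(1,3) V4] by blast
  obtain F where F: "0 < F" "\<And>p q. p \<in> cball p' r \<Longrightarrow> q \<in> cball p' r \<Longrightarrow>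
      norm (dist_map E p - dist_map E q) \<le> F * norm (p - q)"
    using dist_map_lipschitz by blast
  define \<epsilon> where "\<epsilon> = min \<epsilon>1 r"
  have \<epsilon>: "0 < \<epsilon>" "\<epsilon> \<le> r" "ball p' \<epsilon> \<subseteq> ball p' \<epsilon>1" "ball p' \<epsilon> \<subseteq> ball p' r"
    using \<epsilon>1(1) r_pos by (auto simp: \<epsilon>_def)
  have "\<forall>p m. closed_loop_trajectory A \<nu> \<eta> (dist_map E p') p m \<and> p 0 \<in> U \<and> m 0 = dist_map E (p 0) \<longrightarrow>
      (\<exists>q\<in>U. congruent_configs p' q \<and> (\<forall>t\<ge>0. norm (p t - q) \<le> K * exp (- c * t)))"
    using st by blast
  from stable_imp_confined[OF U this \<epsilon>(1,2)]
  obtain \<delta> where \<delta>: "0 < \<delta>" and conf: "\<forall>p m. closed_loop_trajectory A \<nu> \<eta> (dist_map E p') p m \<longrightarrow>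
      p 0 \<in> U \<inter> ball p' \<delta> \<longrightarrow> m 0 = dist_map E (p 0) \<longrightarrow>
    (\<forall>t\<ge>0. p t \<in> ball p' \<epsilon>) \<and> (\<exists>q\<in>ball p' \<epsilon>. err q = 0 \<and> (\<forall>t\<ge>0. norm (p t - q) \<le> K * exp (- c * t)))"
    by (elim exE conjE)
  have "open (U \<inter> ball p' \<delta>)" "p' \<in> U \<inter> ball p' \<delta>" using U(1,2) \<delta> by auto
  from small_perturbation_positive[OF V(1) x this]
  obtain p0 where p0: "p0 \<in> U \<inter> ball p' \<delta>" "0 < V (err p0) (err p0)" by blast
  then obtain p m where tr: "closed_loop_trajectory A \<nu> \<eta> (dist_map E p') p m" "p 0 = p0" "m 0 = dist_map E p0"
    using st by blast
  have stay: "p t \<in> ball p' \<epsilon>" if "0 \<le> t" for t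
    using conf tr p0(1) that by metis
  have "\<exists>q\<in>ball p' \<epsilon>. err q = 0 \<and> (\<forall>t\<ge>0. norm (p t - q) \<le> K * exp (- c * t))"
    using conf tr p0(1) by metis
  then obtain q where q: "q \<in> ball p' \<epsilon>" "err q = 0" "\<And>t. 0 \<le> t \<Longrightarrow> norm (p t - q) \<le> K * exp (- c * t)"
    by blast
  have sol: "solves_in (ball p' \<epsilon>) field p"
    by (rule solves_in_subset[OF trajectory_imp_solution[OF tr(1)] \<epsilon>(4)])
  define V' where "V' = (\<lambda>x y. - V x y)"
  have V': "bounded_bilinear V'" "V' x y = V' y x" for x y
  proof -
    have "bounded_bilinear (\<lambda>x y. V (- x) y)"
      by (rule V.comp[OF _ bounded_linear_ident]) (intro bounded_linear_minus bounded_linear_ident)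
    then show "bounded_bilinear V'" by (simp add: V'_def V.minus_left)
    show "V' x y = V' y x" unfolding V'_def using V(2) by simp
  qed
  have dec: "V' (err s) (2 *\<^sub>R rigidity_matrix E s (field s)) \<le> - \<beta> * V' (err s) (err s)"
    if s: "s \<in> ball p' \<epsilon>" for s
  proof -
    have "0 \<le> a / 4 * (norm (err s))\<^sup>2" using V(3) by simp
    also have "\<dots> \<le> V (err s) (2 *\<^sub>R rigidity_matrix E s (field s)) - (- \<beta>) * V (err s) (err s)"
      using \<epsilon>1(2) \<epsilon>(3) s by blast
    finally show ?thesis by (simp add: V'_def)
  qed
  have low: "V (err p0) (err p0) \<le> D * (F * K)\<^sup>2 * exp (- (2 * (c - \<beta>)) * t)" if t: "0 \<le> t" for t
  proof -
    have "V' (err (p t)) (err (p t)) \<le> exp (- 2 * \<beta> * t) * V' (err (p 0)) (err (p 0))"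
      by (rule form_decay[OF sol V' err_has_derivative dec t stay])
    then have 1: "exp (- 2 * \<beta> * t) * V (err p0) (err p0) \<le> V (err (p t)) (err (p t))"
      by (simp add: V'_def tr(2))
    have "err (p t) = dist_map E (p t) - dist_map E q" using q(2) by (simp add: err_def)
    also have "norm \<dots> \<le> F * norm (p t - q)"
      using stay[OF t] q(1) \<epsilon>(2) by (intro F(2)) auto
    also have "\<dots> \<le> F * (K * exp (- c * t))" using q(3)[OF t] F(1) by (intro mult_left_mono) auto
    finally have 2: "norm (err (p t)) \<le> F * K * exp (- c * t)" by simp
    have "V (err (p t)) (err (p t)) \<le> norm (err (p t)) * norm (err (p t)) * D"
      using D(2)[of "err (p t)" "err (p t)"] by linarith
    also have "\<dots> \<le> (F * K * exp (- c * t)) * (F * K * exp (- c * t)) * D"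
      using 2 D(1) F(1) U(3) by (intro mult_right_mono mult_mono) auto
    finally have "exp (2 * \<beta> * t) * (exp (- 2 * \<beta> * t) * V (err p0) (err p0))
        \<le> exp (2 * \<beta> * t) * ((F * K * exp (- c * t)) * (F * K * exp (- c * t)) * D)"
      using 1 by (intro mult_left_mono) auto
    moreover have "exp (2 * \<beta> * t) * (exp (- 2 * \<beta> * t) * V (err p0) (err p0)) = V (err p0) (err p0)"
      by (simp add: mult.assoc[symmetric] exp_add[symmetric])
    moreover have "exp (2 * \<beta> * t) * ((F * K * exp (- c * t)) * (F * K * exp (- c * t)) * D)
        = D * (F * K)\<^sup>2 * exp (- (2 * (c - \<beta>)) * t)"
    proof -
      have "exp (- (2 * (c - \<beta>)) * t) = exp (2 * \<beta> * t) * (exp (- c * t) * exp (- c * t))"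
        by (simp add: exp_add[symmetric] algebra_simps)
      then show ?thesis by (simp add: power2_eq_square)
    qed
    ultimately show ?thesis by (simp only:)
  qed
  have "0 < 2 * (c - \<beta>)" using \<beta>(2) by simp
  from exp_eventually_small[OF this p0(2), of "D * (F * K)\<^sup>2"]
  obtain t where "0 \<le> t" "D * (F * K)\<^sup>2 * exp (- (2 * (c - \<beta>)) * t) < V (err p0) (err p0)"
    by (elim exE conjE)
  with low[of t] show False by linarith
qed

end

theorem mainTheorem2:
  fixes E :: "('n::{finite,linorder} \<times> 'n) set"
    and p_star :: "('d::finite, 'n) config" and m_star :: "'n edge_vec"
    and A :: "(('d, 'n) config \<times> 'n edge_vec) set"
    and \<nu> :: "('d, 'n) config \<times> 'n edge_vec \<Rightarrow> 'n edge_vec \<Rightarrow> ('d, 'n) config"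
    and \<eta> :: "('d, 'n) config \<times> 'n edge_vec \<Rightarrow> 'n edge_vec \<Rightarrow> 'n edge_vec"
    and \<eta>_star :: "'n edge_vec \<Rightarrow> 'n edge_vec" and T :: "'n edge_vec set"
  assumes "simple_graph E"
    and "rigid TYPE('d) E"
    and "p_star \<in> regular_configs E"
    and "m_star = dist_map E p_star"
    and "openin (top_of_set (state_space E)) A" and "(p_star, m_star) \<in> A"
    and "compatible_controller E A \<nu> \<eta>"
    and "\<eta>_star = \<eta> (p_star, m_star)"
    and "T = tangent_space (regular_values TYPE('d) E) m_star"
  shows "\<eta>_star ` T \<subseteq> T \<and>
    (Hurwitz_on T (\<lambda>v. - \<eta>_star v) \<or> (\<forall>v\<in>T. v \<noteq> 0 \<longrightarrow> v \<bullet> \<eta>_star v > 0)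
       \<longrightarrow> locally_exp_stable E A \<nu> \<eta> p_star) \<and>
    (locally_exp_stable E A \<nu> \<eta> p_star \<longrightarrow> Hurwitz_on T (\<lambda>v. - \<eta>_star v))"
proof -
  have target: "(p_star, dist_map E p_star) \<in> A" using assms(4,6) by simp
  obtain r L where chart: "0 < r" "\<And>p. p \<in> cball p_star r \<Longrightarrow> (p, dist_map E p) \<in> A"
    "\<And>e. e \<in> E \<Longrightarrow> L-lipschitz_on (cball p_star r) (\<lambda>p. \<nu> (p, dist_map E p) (axis e 1))"
    by (rule controller_lipschitz_near_target[OF assms(7,5) target]) blast
  interpret formation_near_target E p_star A \<nu> \<eta> r L
  proof
    show "A \<subseteq> state_space E" using openin_imp_subset[OF assms(5)] .
  qed (use assms(3,7) chart in auto)
  have T: "T = range (rigidity_matrix E p_star)"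
    unfolding assms(9,4) by (rule tangent_space_regular_values[OF assms(3)])
  have eta: "\<eta>_star = \<eta> (p_star, dist_map E p_star)" by (simp only: assms(4,8))
  have "\<eta>_star ` T \<subseteq> T"
    unfolding T eta using controller_on_T err_gain_in_T by auto
  moreover have "locally_exp_stable E A \<nu> \<eta> p_star" if H: "Hurwitz_on T (\<lambda>v. - \<eta>_star v)"
  proof -
    have "\<exists>N. open N \<and> p_star \<in> N \<and> (\<forall>q\<in>N. dist_map E q = dist_map E p_star \<longrightarrow> congruent_configs p_star q)"
      using assms(2,3) unfolding rigid_def by blast
    then obtain N where "open N" "p_star \<in> N"
      "\<forall>q\<in>N. dist_map E q = dist_map E p_star \<longrightarrow> congruent_configs p_star q" by (elim exE conjE)
    then show ?thesis using Hurwitz_imp_stable[of N] H unfolding T eta by blast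
  qed
  moreover have "Hurwitz_on T (\<lambda>v. - \<eta>_star v)" if "\<forall>v\<in>T. v \<noteq> 0 \<longrightarrow> v \<bullet> \<eta>_star v > 0"
    using that by (intro positive_form_imp_Hurwitz) blast
  moreover have "Hurwitz_on T (\<lambda>v. - \<eta>_star v)" if "locally_exp_stable E A \<nu> \<eta> p_star"
    using stable_imp_Hurwitz[OF that] unfolding T eta .
  ultimately show ?thesis by blast
qed

end
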